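(* Let $-\Delta$ be the Kigami Laplacian on the Sierpinski gasket $SG$, with either Dirichlet or Neumann boundary conditions, let $N(\lambda)$ be its eigenvalue counting function, and let $\pi_0,\pi_1,\pi_2$ be the irreducible representations of the dihedral symmetry group $D_3$ of $SG$: the trivial one ($d_0=1$), the alternating one ($d_1=1$), and the 2-dimensional one ($d_2=2$). Let $N_j(\lambda)$ be the eigenvalue counting function of the part of $-\Delta$ that transforms according to $\pi_j$. Then for each $j\in\{0,1,2\}$, $$N_j(\lambda)=\frac{d_j^2}{6}\,N(\lambda)+O(\log\lambda)\qquad\text{as }\lambda\to\infty.$$
   Context: Let $q_0,q_1,q_2$ be the vertices of an equilateral triangle in the plane and $F_i(x)=\frac12x+\frac12q_i$. The Sierpinski gasket $SG$ is the unique nonempty compact set with $SG=\bigcup_{i}F_i(SG)$, and its boundary is $\{q_0,q_1,q_2\}$. The graphs $\Gamma_m$ approximating $SG$ are defined as follows: $\Gamma_0$ is the complete graph on $\{q_0,q_1,q_2\}$, and $\Gamma_m=\bigcup_iF_i(\Gamma_{m-1})$. At nonboundary vertices $x$ of $\Gamma_m$ put $\Delta_mu(x)=\sum_{y\sim_m x}(u(y)-u(x))$, where $y\sim_m x$ means that $x,y$ are joined by an edge of $\Gamma_m$. The Kigami Laplacian is $\Delta u=\frac32\lim_{m\to\infty}5^m\Delta_mu$. Equivalently, let $\mu$ be the self-similar probability measure on $SG$ giving mass $3^{-m}$ to each cell $F_{i_1}\circ\cdots\circ F_{i_m}(SG)$, and let $\mathcal E(u,u)=\lim_{m\to\infty}(5/3)^m\sum_{x\sim_m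 y}|u(x)-u(y)|^2$, with domain the continuous functions of finite energy (Neumann), or those that also vanish on $\{q_0,q_1,q_2\}$ (Dirichlet). Then $-\Delta$ is the nonnegative self-adjoint operator on $L^2(SG,\mu)$ associated with $\mathcal E$. It has discrete spectrum. $N(\lambda)$ is the number of eigenvalues $\le\lambda$, counted with multiplicity. The group $D_3$ of symmetries of the triangle acts on $SG$, preserving $\mu$ and $-\Delta$. $L^2_j(SG)$ denotes the $\pi_j$-isotypic subspace of $L^2(SG,\mu)$ (the closed span of all $D_3$-invariant subspaces on which $D_3$ acts equivalently to $\pi_j$), and $N_j(\lambda)$ is the number of eigenvalues $\le\lambda$, counted with multiplicity, of the restriction of $-\Delta$ to $L^2_j(SG)$. *)

theory Defs
  imports "HOL-Probability.Probability" "HOL-Library.Function_Algebras"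
    "HOL-Library.Landau_Symbols"
begin

section \<open>The Sierpinski gasket and its self-similar measure\<close>

text \<open>The plane is the complex plane; the triangle is centred at the origin, so that its
  symmetries are real-linear.\<close>

definition q :: "nat \<Rightarrow> complex" where
  "q i = cis (2 * pi * real i / 3)"

definition V0 :: "complex set" where
  "V0 = q ` {..<3}"

definition F :: "nat \<Rightarrow> complex \<Rightarrow> complex" where
  "F i x = x / 2 + q i / 2"

definition SG :: "complex set" where
  "SG = (THE K. compact K \<and> K \<noteq> {} \<and> K = (\<Union>i<3. F i ` K))"

definition cell :: "nat list \<Rightarrow> complex set" where
  "cell w = foldr (\<lambda>i A. F i ` A) w SG"

definition \<mu> :: "complex measure" where
  "\<mu> = (THE M. sets M = sets borel \<and> prob_space M \<and>
      (\<forall>w. set w \<subseteq> {..<3} \<longrightarrow> measure M (cell w) = (1 / 3) ^ length w))"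

section \<open>Graph approximations and the energy form\<close>

text \<open>The edge set of the graph of level m, as a symmetric relation: every edge occurs as two
  ordered pairs, whence the factor 1/2 in the energy.\<close>

primrec edges :: "nat \<Rightarrow> (complex \<times> complex) set" where
  "edges 0 = {(x, y). x \<in> V0 \<and> y \<in> V0 \<and> x \<noteq> y}"
| "edges (Suc m) = (\<Union>i<3. map_prod (F i) (F i) ` edges m)"

definition energy_approx :: "nat \<Rightarrow> (complex \<Rightarrow> complex) \<Rightarrow> (complex \<Rightarrow> complex) \<Rightarrow> complex" where
  "energy_approx m u v =
    (5 / 3) ^ m * (1 / 2) * (\<Sum>(x, y)\<in>edges m. (u x - u y) * cnj (v x - v y))"

definition energy :: "(complex \<Rightarrow> complex) \<Rightarrow> (complex \<Rightarrow> complex) \<Rightarrow> complex" where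
  "energy u v = lim (\<lambda>m. energy_approx m u v)"

datatype boundary_condition = Dirichlet | Neumann

text \<open>Functions on the gasket are represented by functions on the plane that vanish off the
  gasket, so that equality of functions on the gasket is equality.\<close>

definition form_domain :: "boundary_condition \<Rightarrow> (complex \<Rightarrow> complex) set" where
  "form_domain bc = {u. continuous_on SG u \<and> (\<forall>x. x \<notin> SG \<longrightarrow> u x = 0) \<and>
      convergent (\<lambda>m. energy_approx m u u) \<and>
      (bc = Dirichlet \<longrightarrow> (\<forall>x\<in>V0. u x = 0))}"

section \<open>The Laplacian\<close>

text \<open>Square integrable functions, not identified modulo null functions. As the complement of
  the gasket is a null set, values there are irrelevant.\<close>

definition L2 :: "(complex \<Rightarrow> complex) set" where
  "L2 = {f. f \<in> borel_measurable \<mu> \<and> integrable \<mu> (\<lambda>x. (cmod (f x))\<^sup>2)}"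

definition L2_norm :: "(complex \<Rightarrow> complex) \<Rightarrow> real" where
  "L2_norm f = sqrt (LINT x|\<mu>. (cmod (f x))\<^sup>2)"

text \<open>The graph of the operator associated with the energy form: u is in its domain with image f
  iff E(u,v) = <f,v> for all v in the form domain.\<close>

definition neg_laplacian ::
  "boundary_condition \<Rightarrow> ((complex \<Rightarrow> complex) \<times> (complex \<Rightarrow> complex)) set" where
  "neg_laplacian bc = {(u, f). u \<in> form_domain bc \<and> f \<in> L2 \<and>
      (\<forall>v\<in>form_domain bc. energy u v = (LINT x|\<mu>. f x * cnj (v x)))}"

definition eigenspace :: "boundary_condition \<Rightarrow> real \<Rightarrow> (complex \<Rightarrow> complex) set" where
  "eigenspace bc t = {u. (u, \<lambda>x. of_real t * u x) \<in> neg_laplacian bc}"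

definition cscale :: "complex \<Rightarrow> (complex \<Rightarrow> complex) \<Rightarrow> (complex \<Rightarrow> complex)" where
  "cscale c f = (\<lambda>x. c * f x)"

global_interpretation cfun: vector_space cscale
  by unfold_locales (auto simp: cscale_def fun_eq_iff algebra_simps)

text \<open>Number of eigenvalues at most t, with multiplicity, of the restriction of the operator to
  an invariant subspace H. The index set and the dimensions are finite because the spectrum is
  discrete, so the conventions for infinite sums and infinite dimensions are never used.\<close>

definition counting ::
  "boundary_condition \<Rightarrow> (complex \<Rightarrow> complex) set \<Rightarrow> real \<Rightarrow> nat" where
  "counting bc H t =
    (\<Sum>s | s \<le> t \<and> eigenspace bc s \<inter> H \<noteq> {0}. cfun.dim (eigenspace bc s \<inter> H))"

section \<open>The symmetry group and isotypic subspaces\<close>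

definition D3 :: "(complex \<Rightarrow> complex) set" where
  "D3 = {g. (\<forall>x y. dist (g x) (g y) = dist x y) \<and> g ` V0 = V0}"

definition irrep_dim :: "nat \<Rightarrow> nat" where
  "irrep_dim j = (if j = 2 then 2 else 1)"

text \<open>Every g in D3 is a real-linear isometry of the plane; its matrix in the
  basis 1, \<i> is the two-dimensional irreducible representation.\<close>

definition plane_matrix :: "(complex \<Rightarrow> complex) \<Rightarrow> nat \<Rightarrow> nat \<Rightarrow> real" where
  "plane_matrix g l k = (if l = 0 then Re else Im) (g (if k = 0 then 1 else \<i>))"

text \<open>Entry in row l and column k of the matrix of g in the representation number j. The
  alternating one is the determinant: 1 on rotations and -1 on reflections.\<close>

definition irrep :: "nat \<Rightarrow> (complex \<Rightarrow> complex) \<Rightarrow> nat \<Rightarrow> nat \<Rightarrow> complex" where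
  "irrep j g l k = of_real
    (if j = 0 then 1
     else if j = 1 then
       plane_matrix g 0 0 * plane_matrix g 1 1 - plane_matrix g 0 1 * plane_matrix g 1 0
     else plane_matrix g l k)"

text \<open>V is (the preimage in L2 of) an invariant subspace of the space of classes of L2 on which
  the action f \<mapsto> f \<circ> inv g is equivalent to representation number j: V has a basis, modulo null
  functions, in which the action is given by the matrices of the representation.\<close>

definition acts_as :: "nat \<Rightarrow> (complex \<Rightarrow> complex) set \<Rightarrow> bool" where
  "acts_as j V \<longleftrightarrow> (\<exists>e :: nat \<Rightarrow> complex \<Rightarrow> complex.
      (\<forall>k<irrep_dim j. e k \<in> L2) \<and>
      (\<forall>c. (AE x in \<mu>. (\<Sum>k<irrep_dim j. c k * e k x) = 0) \<longrightarrow> (\<forall>k<irrep_dim j. c k = 0)) \<and>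
      V = {f \<in> L2. \<exists>c. AE x in \<mu>. f x = (\<Sum>k<irrep_dim j. c k * e k x)} \<and>
      (\<forall>g\<in>D3. \<forall>k<irrep_dim j.
        AE x in \<mu>. e k (inv g x) = (\<Sum>l<irrep_dim j. irrep j g l k * e l x)))"

definition isotypic :: "nat \<Rightarrow> (complex \<Rightarrow> complex) set" where
  "isotypic j = {f \<in> L2. \<forall>\<epsilon>>0. \<exists>h\<in>cfun.span (\<Union>{V. acts_as j V}). L2_norm (f - h) < \<epsilon>}"

end

theory Submission
  imports Defs "HOL-Complex_Analysis.Great_Picard"
begin

text \<open>By the min-max principle the number of eigenvalues at most t is the largest dimension of a space
  of functions u with energy at most t times the squared norm, so prescribing k zeros changes it by
  at most k. The copies F 0 SG, F 1 SG, F 2 SG meet in three points only; multiplying them by the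
  powers of a cube root of unity turns functions of one rotation character that vanish there into
  functions of another, so all three characters have the same counting function up to a constant.
  The axes of reflection meet the gasket in the vertices and in points that accumulate only at the
  vertices, and a cell of level n carries no Dirichlet eigenvalue at most t once 25 t < 5 ^ n.
  Hence, after O(log t) zeros have been prescribed, one may change the sign of a rotation invariant
  function in every other chamber and discard it on the three cells of level n at the vertices;
  this exchanges invariant and alternating functions.\<close>

section \<open>Hermitian forms and their eigenvalues\<close>

text \<open>Multiplying an eigenfunction by a piecewise constant factor does not give an
  eigenfunction; what survives is the bound on its Rayleigh quotient. Hence counts are compared
  through test functions, and each counting function is characterised by a variational certificate.
  A jump of the factor costs no energy where the function vanishes, because every edge of a fine
  graph lies in a single cell.

  The obstacle is the change of parity: an axis meets the gasket in infinitely many points, too many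
  to prescribe zeros at. On the part cut off near the vertices a Poincare inequality with constant
  25 / 5 ^ n holds: 25 is the square of an oscillation bound, and each level contributes 1/3 in mass
  and 3/5 in energy. It puts the quotient of that part above t, so dropping it keeps the rest at
  most t. The error grows with n, like log t; the rotation characters alone cause a bounded error.

  The fractions arise as N/3 for each rotation character, halved by parity for the trivial one, and
  2N/3 for the two others together.\<close>

lemma homogeneous_system_nontrivial:
  fixes a :: "'i \<Rightarrow> 'b \<Rightarrow> 'k::field"
  assumes "finite I" "finite B" "card I < card B"
  shows "\<exists>c. (\<exists>b\<in>B. c b \<noteq> 0) \<and> (\<forall>i\<in>I. (\<Sum>b\<in>B. a i b * c b) = 0)"
  using assms
proof (induction I arbitrary: B a rule: finite_induct)
  case empty
  then have "B \<noteq> {}" by auto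
  then show ?case by (intro exI[of _ "\<lambda>_. 1"]) auto
next
  case (insert i I)
  show ?case
  proof (cases "\<forall>b\<in>B. a i b = 0")
    case True
    have "card I < card B" using insert by simp
    from insert.IH[OF insert.prems(1) this, of a] True show ?thesis by auto
  next
    case False
    \<comment> \<open>Gaussian elimination: equation \<open>i\<close> is solved for the unknown
      \<open>b0\<close>, and substitution into the other equations leaves a system for
      \<open>?B\<close> with the modified coefficients below.\<close>
    then obtain b0 where b0: "b0 \<in> B" "a i b0 \<noteq> 0" by auto
    let ?B = "B - {b0}"
    have c: "card I < card ?B" using insert b0 by simp
    obtain c' where c': "\<exists>b\<in>?B. c' b \<noteq> 0"
      "\<forall>i'\<in>I. (\<Sum>b\<in>?B. (a i' b - a i' b0 * a i b / a i b0) * c' b) = 0"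
      using insert.IH[OF _ c, of "\<lambda>i' b. a i' b - a i' b0 * a i b / a i b0"] insert.prems by auto
    define s where "s = (\<Sum>b\<in>?B. a i b * c' b)"
    define c where "c = c'(b0 := - s / a i b0)"
    have split: "(\<Sum>b\<in>B. a i' b * c b) = - a i' b0 * s / a i b0 + (\<Sum>b\<in>?B. a i' b * c' b)" for i'
    proof -
      have "(\<Sum>b\<in>B. a i' b * c b) = a i' b0 * c b0 + (\<Sum>b\<in>?B. a i' b * c b)"
        using insert.prems b0 by (subst sum.remove[of B b0]) auto
      also have "(\<Sum>b\<in>?B. a i' b * c b) = (\<Sum>b\<in>?B. a i' b * c' b)"
        by (intro sum.cong) (auto simp: c_def)
      finally show ?thesis by (simp add: c_def)
    qed
    have "(\<Sum>b\<in>B. a i' b * c b) = 0" if "i' \<in> I" for i'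
    proof -
      have "0 = (\<Sum>b\<in>?B. (a i' b - a i' b0 * a i b / a i b0) * c' b)" using c' that by simp
      also have "\<dots> = (\<Sum>b\<in>?B. a i' b * c' b - a i' b0 / a i b0 * (a i b * c' b))"
        by (intro sum.cong) (auto simp: algebra_simps)
      also have "\<dots> = (\<Sum>b\<in>?B. a i' b * c' b) - a i' b0 / a i b0 * s"
        by (simp add: sum_subtractf s_def sum_distrib_left)
      finally show ?thesis by (simp add: split)
    qed
    moreover have "(\<Sum>b\<in>B. a i b * c b) = 0"
      using split[of i] b0 by (simp add: s_def)
    moreover have "\<exists>b\<in>B. c b \<noteq> 0" using c'(1) by (auto simp: c_def)
    ultimately show ?thesis by (intro exI[of _ c]) auto
  qed
qed

definition lincomb :: "((complex \<Rightarrow> complex) \<Rightarrow> complex) \<Rightarrow> (complex \<Rightarrow> complex) set \<Rightarrow> complex \<Rightarrow> complex" where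
  "lincomb c B = (\<Sum>b\<in>B. cscale (c b) b)"

lemma cscale_simps [simp]: "cscale 1 u = u" "cscale 0 u = 0" "cscale c 0 = 0" "cscale (-1) u = - u"
  by (auto simp: cscale_def fun_eq_iff)

lemma lincomb_apply: "lincomb c B x = (\<Sum>b\<in>B. c b * b x)"
  by (induction B rule: infinite_finite_induct) (auto simp: lincomb_def cscale_def)

lemma lincomb_in_span: "lincomb c B \<in> cfun.span B"
  unfolding lincomb_def by (intro cfun.span_sum cfun.span_scale cfun.span_base)

text \<open>The carrier \<open>D\<close> is explicit because the energy is a limit that is known to
  exist, and hence to be additive, only on the form domain. The form need not be definite: the
  locale also serves for differences \<open>E - t P\<close>.\<close>

locale hermitian_form =
  fixes D :: "(complex \<Rightarrow> complex) set" and Q :: "(complex \<Rightarrow> complex) \<Rightarrow> (complex \<Rightarrow> complex) \<Rightarrow> complex"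
  assumes subspace: "cfun.subspace D"
    and add_left: "\<And>u v w. u \<in> D \<Longrightarrow> v \<in> D \<Longrightarrow> w \<in> D \<Longrightarrow> Q (u + v) w = Q u w + Q v w"
    and scale_left: "\<And>c u w. u \<in> D \<Longrightarrow> w \<in> D \<Longrightarrow> Q (cscale c u) w = c * Q u w"
    and sym: "\<And>u v. u \<in> D \<Longrightarrow> v \<in> D \<Longrightarrow> Q v u = cnj (Q u v)"
begin

lemma zero_mem: "0 \<in> D" and add_mem: "u \<in> D \<Longrightarrow> v \<in> D \<Longrightarrow> u + v \<in> D"
  and scale_mem: "u \<in> D \<Longrightarrow> cscale c u \<in> D" and diff_mem: "u \<in> D \<Longrightarrow> v \<in> D \<Longrightarrow> u - v \<in> D"
  using subspace by (auto intro: cfun.subspace_0 cfun.subspace_add cfun.subspace_scale cfun.subspace_diff)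

lemma lincomb_mem: "B \<subseteq> D \<Longrightarrow> lincomb c B \<in> D"
  unfolding lincomb_def by (intro cfun.subspace_sum subspace) (auto intro: scale_mem)

lemma add_right: "u \<in> D \<Longrightarrow> v \<in> D \<Longrightarrow> w \<in> D \<Longrightarrow> Q w (u + v) = Q w u + Q w v"
  using add_left[of u v w] sym[of "u + v" w] sym[of u w] sym[of v w] add_mem[of u v] by simp

lemma scale_right: "u \<in> D \<Longrightarrow> w \<in> D \<Longrightarrow> Q w (cscale c u) = cnj c * Q w u"
  using scale_left[of u w c] sym[of "cscale c u" w] sym[of u w] scale_mem[of u c] by simp

lemma zero_left: "w \<in> D \<Longrightarrow> Q 0 w = 0"
  using scale_left[of 0 w 0] zero_mem by simp

lemma zero_right: "w \<in> D \<Longrightarrow> Q w 0 = 0"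
  using scale_right[of 0 w 0] zero_mem by simp

lemma diff_left: "u \<in> D \<Longrightarrow> v \<in> D \<Longrightarrow> w \<in> D \<Longrightarrow> Q (u - v) w = Q u w - Q v w"
  using add_left[of u "cscale (-1) v" w] scale_left[of v w "-1"] scale_mem[of v "-1"] by simp

lemma sum_left: "finite I \<Longrightarrow> (\<And>i. i \<in> I \<Longrightarrow> f i \<in> D) \<Longrightarrow> w \<in> D \<Longrightarrow> Q (\<Sum>i\<in>I. f i) w = (\<Sum>i\<in>I. Q (f i) w)"
proof (induction I rule: finite_induct)
  case empty
  then show ?case using zero_left by (simp add: zero_fun_def)
next
  case (insert i I)
  have "(\<Sum>i\<in>I. f i) \<in> D" using insert by (intro cfun.subspace_sum subspace) auto
  then have "Q (f i + sum f I) w = Q (f i) w + Q (sum f I) w" using insert by (intro add_left) auto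
  also have "\<dots> = (\<Sum>i\<in>insert i I. Q (f i) w)" using insert by simp
  finally show ?case unfolding sum.insert[OF insert.hyps(1,2)] .
qed

lemma lincomb_left:
  assumes "finite B" "B \<subseteq> D" "w \<in> D" shows "Q (lincomb c B) w = (\<Sum>b\<in>B. c b * Q b w)"
proof -
  have "Q (lincomb c B) w = (\<Sum>b\<in>B. Q (cscale (c b) b) w)"
    unfolding lincomb_def using assms by (intro sum_left) (auto intro: scale_mem)
  also have "\<dots> = (\<Sum>b\<in>B. c b * Q b w)" using assms by (intro sum.cong) (auto simp: scale_left)
  finally show ?thesis .
qed

lemma lincomb_right:
  assumes "finite B" "B \<subseteq> D" "w \<in> D" shows "Q w (lincomb c B) = (\<Sum>b\<in>B. cnj (c b) * Q w b)"
proof -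
  have "Q w (lincomb c B) = cnj (\<Sum>b\<in>B. c b * Q b w)"
    using lincomb_left[OF assms] sym[of "lincomb c B" w] lincomb_mem assms by simp
  also have "\<dots> = (\<Sum>b\<in>B. cnj (c b) * Q w b)"
    unfolding cnj_sum
  proof (intro sum.cong refl)
    fix b assume "b \<in> B"
    then show "cnj (c b * Q b w) = cnj (c b) * Q w b"
      using assms sym[of b w] by (simp add: subset_iff)
  qed
  finally show ?thesis .
qed

lemma lincomb_orthogonal:
  assumes "finite B" "B \<subseteq> D" "\<And>b b'. b \<in> B \<Longrightarrow> b' \<in> B \<Longrightarrow> b \<noteq> b' \<Longrightarrow> Q b b' = 0"
  shows "Re (Q (lincomb c B) (lincomb c B)) = (\<Sum>b\<in>B. (cmod (c b))\<^sup>2 * Re (Q b b))"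
proof -
  have "Q (lincomb c B) (lincomb c B) = (\<Sum>b\<in>B. c b * (\<Sum>b'\<in>B. cnj (c b') * Q b b'))"
    using assms lincomb_mem[of B c] by (subst lincomb_left) (auto intro!: sum.cong simp: lincomb_right subset_iff)
  also have "\<dots> = (\<Sum>b\<in>B. c b * (cnj (c b) * Q b b))"
  proof (intro sum.cong refl)
    fix b assume b: "b \<in> B"
    have "(\<Sum>b'\<in>B. cnj (c b') * Q b b') = (\<Sum>b'\<in>{b}. cnj (c b') * Q b b')"
      using assms b by (intro sum.mono_neutral_right) auto
    then show "c b * (\<Sum>b'\<in>B. cnj (c b') * Q b b') = c b * (cnj (c b) * Q b b)" by simp
  qed
  also have "\<dots> = (\<Sum>b\<in>B. of_real ((cmod (c b))\<^sup>2) * Q b b)"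
    by (intro sum.cong) (auto simp: complex_mult_cnj cmod_def)
  finally show ?thesis by simp
qed

lemma quadratic_add:
  assumes "u \<in> D" "v \<in> D"
  shows "Re (Q (u + v) (u + v)) = Re (Q u u) + Re (Q v v) + 2 * Re (Q u v)"
  using assms sym[of u v] by (simp add: add_left add_right add_mem)

lemma quadratic_scale:
  assumes "u \<in> D" shows "Re (Q (cscale c u) (cscale c u)) = (cmod c)\<^sup>2 * Re (Q u u)"
proof -
  have "Q (cscale c u) (cscale c u) = (c * cnj c) * Q u u"
    using assms by (simp add: scale_left scale_right scale_mem)
  then show ?thesis by (simp add: complex_mult_cnj cmod_def)
qed

text \<open>The degenerate case of the Cauchy-Schwarz inequality: if \<open>Q u v\<close> were not
  zero, a small step from \<open>u\<close> along a multiple of \<open>v\<close> would make the form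
  negative. Applied to \<open>E - \<kappa> P\<close> at a minimizer it is the Euler-Lagrange
  equation.\<close>

lemma null_vector_of_nonneg_form:
  assumes D': "cfun.subspace D'" "D' \<subseteq> D"
    and nonneg: "\<And>w. w \<in> D' \<Longrightarrow> 0 \<le> Re (Q w w)"
    and u: "u \<in> D'" "Re (Q u u) = 0" and v: "v \<in> D'"
  shows "Q u v = 0"
proof (rule ccontr)
  assume ne: "Q u v \<noteq> 0"
  have uD: "u \<in> D" "v \<in> D" using u v D' by auto
  \<comment> \<open>This choice gives \<open>r * Re (Q v v) < 1\<close> even when
    \<open>Q v v = 0\<close>, which makes the factor \<open>r * Re (Q v v) - 2\<close> below
    negative.\<close>
  define r where "r = 1 / (Re (Q v v) + 1)"
  have qv: "0 \<le> Re (Q v v)" using nonneg v by simp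
  have r: "0 < r" "r * Re (Q v v) < 1" using qv by (auto simp: r_def divide_simps)
  define c where "c = - of_real r * Q u v"
  have "0 \<le> Re (Q (u + cscale c v) (u + cscale c v))"
    using D' u v by (intro nonneg cfun.subspace_add cfun.subspace_scale) auto
  also have "\<dots> = (cmod c)\<^sup>2 * Re (Q v v) + 2 * Re (cnj c * Q u v)"
  proof -
    have "Re (Q (u + cscale c v) (u + cscale c v)) = Re (Q u u) + Re (Q (cscale c v) (cscale c v)) + 2 * Re (Q u (cscale c v))"
      by (rule quadratic_add) (use uD scale_mem in auto)
    then show ?thesis unfolding quadratic_scale[OF uD(2)] scale_right[OF uD(2,1)] u(2) by simp
  qed
  also have "\<dots> = r * (cmod (Q u v))\<^sup>2 * (r * Re (Q v v) - 2)"
  proof -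
    have "Re (cnj c * Q u v) = - r * (cmod (Q u v))\<^sup>2"
      by (simp add: c_def cmod_power2 algebra_simps) (simp add: power2_eq_square)
    moreover have "(cmod c)\<^sup>2 = r\<^sup>2 * (cmod (Q u v))\<^sup>2"
      using r by (simp add: c_def norm_mult power_mult_distrib)
    ultimately show ?thesis by (simp add: power2_eq_square algebra_simps)
  qed
  also have "\<dots> < 0"
    using r ne by (intro mult_pos_neg mult_pos_pos) auto
  finally show False by simp
qed

end

lemma hermitian_form_diff:
  assumes "hermitian_form D E" "hermitian_form D P"
  shows "hermitian_form D (\<lambda>u v. E u v - of_real t * P u v)"
proof -
  interpret E: hermitian_form D E by fact
  interpret P: hermitian_form D P by fact
  show ?thesis
  proof
    fix u v assume "u \<in> D" "v \<in> D"
    then show "E v u - of_real t * P v u = cnj (E u v - of_real t * P u v)"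
      using E.sym[of u v] P.sym[of u v] by simp
  qed (auto simp: E.subspace E.add_left P.add_left E.scale_left P.scale_left algebra_simps)
qed

lemma hermitian_form_subset:
  assumes "hermitian_form D Q" "cfun.subspace D'" "D' \<subseteq> D" shows "hermitian_form D' Q"
proof -
  interpret hermitian_form D Q by fact
  show ?thesis
  proof
    fix u v assume "u \<in> D'" "v \<in> D'"
    then show "Q v u = cnj (Q u v)" using assms(3) by (intro sym) auto
  qed (use assms in \<open>auto simp: add_left scale_left subset_iff\<close>)
qed

text \<open>A certificate that exactly card B eigenvalues of the form E relative to P are at most t.\<close>

definition spectral_cut :: "(complex \<Rightarrow> complex) set \<Rightarrow> ((complex \<Rightarrow> complex) \<Rightarrow> (complex \<Rightarrow> complex) \<Rightarrow> complex) \<Rightarrow>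
    ((complex \<Rightarrow> complex) \<Rightarrow> (complex \<Rightarrow> complex) \<Rightarrow> complex) \<Rightarrow> real \<Rightarrow> (complex \<Rightarrow> complex) set \<Rightarrow> bool" where
  "spectral_cut D E P t B \<longleftrightarrow> finite B \<and> B \<subseteq> D - {0} \<and> (\<forall>b\<in>B. \<forall>b'\<in>B. b \<noteq> b' \<longrightarrow> P b b' = 0) \<and>
    (\<forall>c. Re (E (lincomb c B) (lincomb c B)) \<le> t * Re (P (lincomb c B) (lincomb c B))) \<and>
    (\<forall>u\<in>D. u \<noteq> 0 \<longrightarrow> (\<forall>b\<in>B. P u b = 0) \<longrightarrow> t * Re (P u u) < Re (E u u))"

text \<open>These assumptions replace a Hilbert space and a compact resolvent. The limit of a
  bounded sequence has to keep norm one and must not gain energy, as the direct method requires;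
  that finitely many zeros force the quotient above \<open>t\<close> makes the spectrum below
  \<open>t\<close> finite.\<close>

locale compact_form = E: hermitian_form D E + P: hermitian_form D P for D E P +
  assumes energy_nonneg: "\<And>u. u \<in> D \<Longrightarrow> 0 \<le> Re (E u u)"
    and inner_pos: "\<And>u. u \<in> D \<Longrightarrow> u \<noteq> 0 \<Longrightarrow> 0 < Re (P u u)"
    and compactness: "\<And>f C. (\<And>n::nat. f n \<in> D) \<Longrightarrow> (\<And>n. Re (P (f n) (f n)) = 1) \<Longrightarrow> (\<And>n. Re (E (f n) (f n)) \<le> C) \<Longrightarrow>
      \<exists>u\<in>D. Re (P u u) = 1 \<and>
        (\<exists>r. strict_mono (r :: nat \<Rightarrow> nat) \<and> (\<forall>v\<in>D. (\<lambda>n. P (f (r n)) v) \<longlonglongrightarrow> P u v)) \<and>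
        (\<forall>L. (\<lambda>n. Re (E (f n) (f n))) \<longlonglongrightarrow> L \<longrightarrow> Re (E u u) \<le> L)"
    and finite_codim: "\<And>t. \<exists>Z. finite Z \<and> (\<forall>u\<in>D. u \<noteq> 0 \<longrightarrow> (\<forall>z\<in>Z. u z = 0) \<longrightarrow> t * Re (P u u) < Re (E u u))"
begin

definition eig :: "real \<Rightarrow> (complex \<Rightarrow> complex) set" where
  "eig s = {u \<in> D. \<forall>v\<in>D. E u v = of_real s * P u v}"

lemma subspace_eig: "cfun.subspace (eig s)"
proof (rule cfun.subspaceI)
  show "0 \<in> eig s" unfolding eig_def using E.zero_mem E.zero_left P.zero_left by auto
  fix u v c assume "u \<in> eig s" "v \<in> eig s"
  then show "u + v \<in> eig s" "cscale c u \<in> eig s" unfolding eig_def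
    by (auto simp: E.add_left P.add_left E.scale_left P.scale_left E.add_mem E.scale_mem algebra_simps)
qed

lemma eig_orthogonal:
  assumes "u \<in> eig s" "v \<in> eig s'" "s \<noteq> s'" shows "P u v = 0"
proof -
  have D: "u \<in> D" "v \<in> D" using assms by (auto simp: eig_def)
  have "E u v = of_real s * P u v" using assms by (auto simp: eig_def)
  moreover have "E u v = of_real s' * P u v"
    using assms D E.sym[of v u] P.sym[of v u] by (auto simp: eig_def)
  ultimately show ?thesis using assms(3) by auto
qed

text \<open>A largest family of this kind will turn out to contain an orthogonal basis of every
  eigenspace with eigenvalue at most \<open>t\<close>.\<close>

definition eigenfamily :: "real \<Rightarrow> (complex \<Rightarrow> complex) set \<Rightarrow> bool" where
  "eigenfamily t B \<longleftrightarrow> finite B \<and> B \<subseteq> D - {0} \<and> (\<forall>b\<in>B. \<forall>b'\<in>B. b \<noteq> b' \<longrightarrow> P b b' = 0) \<and>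
    (\<forall>b\<in>B. \<exists>s\<le>t. b \<in> eig s)"

text \<open>Eigenvectors that are orthogonal for \<open>P\<close> are orthogonal for
  \<open>E\<close> too, so both forms are diagonal on the family and the bound holds term by
  term.\<close>

lemma eigenfamily_bound:
  assumes B: "eigenfamily t B"
  shows "Re (E (lincomb c B) (lincomb c B)) \<le> t * Re (P (lincomb c B) (lincomb c B))"
proof -
  have f: "finite B" "B \<subseteq> D" and orth: "\<And>b b'. b \<in> B \<Longrightarrow> b' \<in> B \<Longrightarrow> b \<noteq> b' \<Longrightarrow> P b b' = 0"
    using B by (auto simp: eigenfamily_def)
  have E_orth: "E b b' = 0" if "b \<in> B" "b' \<in> B" "b \<noteq> b'" for b b'
  proof -
    obtain s where "b \<in> eig s" using B \<open>b \<in> B\<close> by (auto simp: eigenfamily_def)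
    then show ?thesis using that orth[OF that] f by (auto simp: eig_def)
  qed
  have le: "Re (E b b) \<le> t * Re (P b b)" if "b \<in> B" for b
  proof -
    obtain s where "s \<le> t" "b \<in> eig s" using B \<open>b \<in> B\<close> by (auto simp: eigenfamily_def)
    moreover have "0 < Re (P b b)" using B \<open>b \<in> B\<close> by (intro inner_pos) (auto simp: eigenfamily_def)
    ultimately show ?thesis by (auto simp: eig_def)
  qed
  have "Re (E (lincomb c B) (lincomb c B)) = (\<Sum>b\<in>B. (cmod (c b))\<^sup>2 * Re (E b b))"
    by (rule E.lincomb_orthogonal[OF f E_orth])
  also have "\<dots> \<le> (\<Sum>b\<in>B. (cmod (c b))\<^sup>2 * (t * Re (P b b)))"
    using le by (intro sum_mono mult_left_mono) auto
  also have "\<dots> = t * (\<Sum>b\<in>B. (cmod (c b))\<^sup>2 * Re (P b b))"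
    by (simp add: sum_distrib_left mult.left_commute)
  also have "(\<Sum>b\<in>B. (cmod (c b))\<^sup>2 * Re (P b b)) = Re (P (lincomb c B) (lincomb c B))"
    by (rule P.lincomb_orthogonal[OF f orth, symmetric])
  finally show ?thesis .
qed

lemma orthogonal_lincomb_nonzero:
  assumes "finite B" "B \<subseteq> D - {0}" "\<forall>b\<in>B. \<forall>b'\<in>B. b \<noteq> b' \<longrightarrow> P b b' = 0" "\<exists>b\<in>B. c b \<noteq> 0"
  shows "lincomb c B \<noteq> 0"
proof
  assume z: "lincomb c B = 0"
  obtain b where b: "b \<in> B" "c b \<noteq> 0" using assms by auto
  have bD: "b \<in> D" "b \<noteq> 0" using b assms by auto
  have "0 = P (lincomb c B) b" using z P.zero_left bD by simp
  also have "\<dots> = (\<Sum>b'\<in>B. c b' * P b' b)" using assms bD by (intro P.lincomb_left) auto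
  also have "\<dots> = (\<Sum>b'\<in>{b}. c b' * P b' b)" using assms b by (intro sum.mono_neutral_right) auto
  finally show False using b inner_pos[OF bD] by auto
qed

text \<open>Linearity of the conditions is asked only along \<open>B\<close>, so point values, inner
  products and inner products after a transformation can be imposed at the same time.\<close>

lemma lincomb_with_zeros:
  fixes \<phi> :: "'i \<Rightarrow> (complex \<Rightarrow> complex) \<Rightarrow> complex"
  assumes "finite B" "B \<subseteq> D - {0}" "\<forall>b\<in>B. \<forall>b'\<in>B. b \<noteq> b' \<longrightarrow> P b b' = 0" "finite I" "card I < card B"
    and lin: "\<And>i c. i \<in> I \<Longrightarrow> \<phi> i (lincomb c B) = (\<Sum>b\<in>B. c b * \<phi> i b)"
  obtains c where "lincomb c B \<noteq> 0" "\<And>i. i \<in> I \<Longrightarrow> \<phi> i (lincomb c B) = 0"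
proof -
  obtain c where c: "\<exists>b\<in>B. c b \<noteq> 0" "\<forall>i\<in>I. (\<Sum>b\<in>B. \<phi> i b * c b) = 0"
    using homogeneous_system_nontrivial[OF assms(4,1,5), of \<phi>] by blast
  show ?thesis
    using that[of c] orthogonal_lincomb_nonzero[OF assms(1-3) c(1)] c(2) lin by (simp add: mult.commute)
qed

text \<open>The span of a family with more members than \<open>Z\<close> would contain a nonzero
  function vanishing on \<open>Z\<close>; its quotient would be at most \<open>t\<close> by
  \<open>eigenfamily_bound\<close> and above \<open>t\<close> by the choice of
  \<open>Z\<close>.\<close>

lemma eigenfamily_card_bounded: "\<exists>K. \<forall>B. eigenfamily t B \<longrightarrow> card B \<le> K"
proof -
  obtain Z where Z: "finite Z" "\<forall>u\<in>D. u \<noteq> 0 \<longrightarrow> (\<forall>z\<in>Z. u z = 0) \<longrightarrow> t * Re (P u u) < Re (E u u)"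
    using finite_codim by blast
  have "card B \<le> card Z" if B: "eigenfamily t B" for B
  proof (rule ccontr)
    assume "\<not> card B \<le> card Z"
    then have "card Z < card B" by simp
    have fam: "finite B" "B \<subseteq> D - {0}" "\<forall>b\<in>B. \<forall>b'\<in>B. b \<noteq> b' \<longrightarrow> P b b' = 0"
      using B by (auto simp: eigenfamily_def)
    obtain c where c: "lincomb c B \<noteq> 0" "\<And>z. z \<in> Z \<Longrightarrow> lincomb c B z = 0"
      by (rule lincomb_with_zeros[OF fam Z(1) \<open>card Z < card B\<close>, of "\<lambda>z u. u z"])
        (auto simp: lincomb_apply)
    have "lincomb c B \<in> D" using B by (intro E.lincomb_mem) (auto simp: eigenfamily_def)
    then show False using Z c eigenfamily_bound[OF B, of c] by (meson linorder_not_less)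
  qed
  then show ?thesis by blast
qed

text \<open>The direct method: a normalized minimizing sequence in the orthogonal complement of
  \<open>B\<close> has a limit of norm one, the constraints pass to the weak limit, and the energy
  does not increase.\<close>

lemma minimizer_exists:
  assumes B: "B \<subseteq> D" and u0: "u0 \<in> D" "u0 \<noteq> 0" "\<forall>b\<in>B. P u0 b = 0" "Re (E u0 u0) \<le> t * Re (P u0 u0)"
  obtains u \<kappa> where "u \<in> D" "u \<noteq> 0" "\<forall>b\<in>B. P u b = 0" "\<kappa> \<le> t" "Re (E u u) = \<kappa> * Re (P u u)"
    "\<And>v. v \<in> D \<Longrightarrow> \<forall>b\<in>B. P v b = 0 \<Longrightarrow> \<kappa> * Re (P v v) \<le> Re (E v v)"
proof -
  define S where "S = {v \<in> D. (\<forall>b\<in>B. P v b = 0) \<and> Re (P v v) = 1}"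
  define \<kappa> where "\<kappa> = (INF v\<in>S. Re (E v v))"
  have bdd: "bdd_below ((\<lambda>v. Re (E v v)) ` S)"
    using energy_nonneg by (intro bdd_belowI[of _ 0]) (auto simp: S_def)
  have low: "\<kappa> \<le> Re (E v v)" if "v \<in> S" for v
    unfolding \<kappa>_def using bdd that by (rule cINF_lower)
  have normalize: "\<exists>r. 0 < r \<and> cscale (of_real r) v \<in> S \<and> r\<^sup>2 * Re (P v v) = 1"
    if v: "v \<in> D" "v \<noteq> 0" "\<forall>b\<in>B. P v b = 0" for v
  proof -
    define r where "r = 1 / sqrt (Re (P v v))"
    have p: "0 < Re (P v v)" using inner_pos v by auto
    have r: "0 < r" "r\<^sup>2 * Re (P v v) = 1" using p by (auto simp: r_def power_divide)
    have "Re (P (cscale (of_real r) v) (cscale (of_real r) v)) = 1"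
      using r by (simp only: P.quadratic_scale[OF v(1)]) simp
    then have "cscale (of_real r) v \<in> S"
      using v B by (auto simp: S_def P.scale_mem P.scale_left subset_iff)
    then show ?thesis using r by blast
  qed
  have low': "\<kappa> * Re (P v v) \<le> Re (E v v)" if v: "v \<in> D" "\<forall>b\<in>B. P v b = 0" for v
  proof (cases "v = 0")
    case True
    then show ?thesis using E.zero_left P.zero_left E.zero_mem by simp
  next
    case False
    then obtain r where r: "0 < r" "cscale (of_real r) v \<in> S" "r\<^sup>2 * Re (P v v) = 1" using normalize v by blast
    have p: "0 < Re (P v v)" using inner_pos v False by auto
    have "\<kappa> \<le> r\<^sup>2 * Re (E v v)" using low[OF r(2)] v r by (simp add: E.quadratic_scale)
    then have "\<kappa> * Re (P v v) \<le> r\<^sup>2 * Re (E v v) * Re (P v v)" using p by (intro mult_right_mono) auto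
    also have "\<dots> = (r\<^sup>2 * Re (P v v)) * Re (E v v)" by simp
    finally show ?thesis using r by simp
  qed
  have ne: "S \<noteq> {}" using normalize u0 by blast
  have "\<kappa> \<le> t"
  proof -
    have "\<kappa> * Re (P u0 u0) \<le> t * Re (P u0 u0)" using low'[of u0] u0 by linarith
    then show ?thesis using inner_pos[OF u0(1,2)] by simp
  qed
  have "\<exists>v\<in>S. Re (E v v) < \<kappa> + inverse (real (Suc n))" for n
    using cInf_lessD[of "(\<lambda>v. Re (E v v)) ` S" "\<kappa> + inverse (real (Suc n))"] ne by (auto simp: \<kappa>_def)
  then obtain f where f: "\<And>n. f n \<in> S" "\<And>n. Re (E (f n) (f n)) < \<kappa> + inverse (real (Suc n))" by metis
  have lim: "(\<lambda>n. Re (E (f n) (f n))) \<longlonglongrightarrow> \<kappa>"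
  proof (rule tendsto_sandwich)
    show "\<forall>\<^sub>F n in sequentially. \<kappa> \<le> Re (E (f n) (f n))" using low f by auto
    show "\<forall>\<^sub>F n in sequentially. Re (E (f n) (f n)) \<le> \<kappa> + inverse (real (Suc n))"
      using f(2) less_imp_le by (intro always_eventually allI) blast
    show "(\<lambda>n. \<kappa> + inverse (real (Suc n))) \<longlonglongrightarrow> \<kappa>"
      using tendsto_add[OF tendsto_const[of \<kappa>] LIMSEQ_inverse_real_of_nat] by simp
  qed (rule tendsto_const)
  have "Re (E (f n) (f n)) \<le> \<kappa> + 1" for n
    using f(2)[of n] by (smt (verit) inverse_le_1_iff of_nat_Suc of_nat_0_le_iff)
  with compactness[of f "\<kappa> + 1"] f(1) obtain u r where u: "u \<in> D" "Re (P u u) = 1" "strict_mono r"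
    "\<forall>v\<in>D. (\<lambda>n. P (f (r n)) v) \<longlonglongrightarrow> P u v" "\<forall>L. (\<lambda>n. Re (E (f n) (f n))) \<longlonglongrightarrow> L \<longrightarrow> Re (E u u) \<le> L"
    unfolding S_def by blast
  have orth: "\<forall>b\<in>B. P u b = 0"
  proof
    fix b assume b: "b \<in> B"
    have "(\<lambda>n. P (f (r n)) b) \<longlonglongrightarrow> P u b" using u b B by auto
    moreover have "(\<lambda>n. P (f (r n)) b) = (\<lambda>n. 0)" using f(1) b by (auto simp: S_def)
    ultimately show "P u b = 0" by (simp add: LIMSEQ_const_iff)
  qed
  have "Re (E u u) = \<kappa>" using u(5) lim low'[OF u(1) orth] u(2) by auto
  moreover have "u \<noteq> 0" using u(2) P.zero_left P.zero_mem by auto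
  ultimately show ?thesis using that[of u \<kappa>] u orth low' \<open>\<kappa> \<le> t\<close> by auto
qed

lemma eigenfamily_insert:
  assumes B: "eigenfamily t B" and u: "u \<in> eig s" "s \<le> t" "u \<noteq> 0" "\<forall>b\<in>B. P u b = 0"
  shows "eigenfamily t (insert u B) \<and> u \<notin> B"
proof
  have uD: "u \<in> D" using u by (auto simp: eig_def)
  show "u \<notin> B" using u inner_pos[OF uD] by auto
  have "P b u = 0" if "b \<in> B" for b using that u P.sym[of u b] uD B by (auto simp: eigenfamily_def)
  then show "eigenfamily t (insert u B)" using B u uD by (auto simp: eigenfamily_def)
qed

lemma orthogonal_projection:
  assumes B: "finite B" "B \<subseteq> D - {0}" "\<forall>b\<in>B. \<forall>b'\<in>B. b \<noteq> b' \<longrightarrow> P b b' = 0" and v: "v \<in> D"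
  obtains c where "\<forall>b\<in>B. P (v - lincomb c B) b = 0"
proof -
  define c where "c b = P v b / P b b" for b
  have "P (v - lincomb c B) b = 0" if b: "b \<in> B" for b
  proof -
    have bD: "b \<in> D" "b \<noteq> 0" using b B by auto
    have ne: "P b b \<noteq> 0" using inner_pos[OF bD] by auto
    have BD: "B \<subseteq> D" using B by auto
    have "P (lincomb c B) b = (\<Sum>b'\<in>B. c b' * P b' b)" using B BD bD by (intro P.lincomb_left) auto
    also have "\<dots> = (\<Sum>b'\<in>{b}. c b' * P b' b)" using B b by (intro sum.mono_neutral_right) auto
    also have "\<dots> = P v b" using ne by (simp add: c_def)
    finally show ?thesis using P.diff_left[of v "lincomb c B" b] P.lincomb_mem[OF BD] v bD by simp
  qed
  then show ?thesis using that by blast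
qed

text \<open>A vector orthogonal to \<open>B\<close> with quotient at most \<open>t\<close> would
  yield a minimizer, and the minimizer is an eigenvector that enlarges \<open>B\<close>.\<close>

lemma maximal_eigenfamily_cut:
  assumes B: "eigenfamily t B" and max: "\<And>B'. eigenfamily t B' \<Longrightarrow> card B' \<le> card B"
  shows "spectral_cut D E P t B"
proof -
  have fam: "finite B" "B \<subseteq> D - {0}" "\<forall>b\<in>B. \<forall>b'\<in>B. b \<noteq> b' \<longrightarrow> P b b' = 0" and BD: "B \<subseteq> D"
    using B by (auto simp: eigenfamily_def)
  have "t * Re (P u0 u0) < Re (E u0 u0)" if u0: "u0 \<in> D" "u0 \<noteq> 0" "\<forall>b\<in>B. P u0 b = 0" for u0
  proof (rule ccontr)
    assume "\<not> ?thesis"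
    then have "Re (E u0 u0) \<le> t * Re (P u0 u0)" by simp
    from minimizer_exists[OF BD u0 this] obtain u \<kappa> where u: "u \<in> D" "u \<noteq> 0" "\<forall>b\<in>B. P u b = 0" "\<kappa> \<le> t"
      "Re (E u u) = \<kappa> * Re (P u u)" "\<And>v. v \<in> D \<Longrightarrow> \<forall>b\<in>B. P v b = 0 \<Longrightarrow> \<kappa> * Re (P v v) \<le> Re (E v v)"
      by metis
    define Q where "Q u v = E u v - of_real \<kappa> * P u v" for u v
    interpret Q: hermitian_form D Q
      unfolding Q_def by (intro hermitian_form_diff E.hermitian_form_axioms P.hermitian_form_axioms)
    define D' where "D' = {v \<in> D. \<forall>b\<in>B. P v b = 0}"
    have sub: "cfun.subspace D'" unfolding D'_def using BD
      by (intro cfun.subspaceI) (auto simp: E.zero_mem P.zero_left E.add_mem E.scale_mem P.add_left P.scale_left subset_iff)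
    \<comment> \<open>On the complement of \<open>B\<close> the form \<open>E - \<kappa> P\<close>
      is nonnegative and vanishes at \<open>u\<close>, so \<open>u\<close> is a null vector
      there.\<close>
    have Q0: "Q u v = 0" if "v \<in> D'" for v
      using u that by (intro Q.null_vector_of_nonneg_form[OF sub]) (auto simp: D'_def Q_def)
    \<comment> \<open>The members of \<open>B\<close> are eigenvectors orthogonal to
      \<open>u\<close>, so the eigenvalue equation for \<open>u\<close> also holds against them, and
      then by projection against all of \<open>D\<close>.\<close>
    have QB: "Q u b = 0" if b: "b \<in> B" for b
    proof -
      obtain s where "b \<in> eig s" using b B by (auto simp: eigenfamily_def)
      then have "E b u = of_real s * P b u" using u by (auto simp: eig_def)
      moreover have "P b u = 0" using P.sym[of u b] u b BD by auto
      ultimately show ?thesis using E.sym[of b u] P.sym[of b u] u b BD by (auto simp: Q_def)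
    qed
    have "u \<in> eig \<kappa>"
      unfolding eig_def
    proof (intro CollectI conjI ballI)
      fix v assume v: "v \<in> D"
      obtain c where c: "\<forall>b\<in>B. P (v - lincomb c B) b = 0" using orthogonal_projection[OF fam v] by blast
      have lD: "lincomb c B \<in> D" using P.lincomb_mem BD by blast
      have "Q u v = Q u ((v - lincomb c B) + lincomb c B)" by simp
      also have "\<dots> = Q u (v - lincomb c B) + Q u (lincomb c B)"
        using u v lD Q.add_right Q.diff_mem by blast
      also have "Q u (v - lincomb c B) = 0" using Q0 c v lD Q.diff_mem by (auto simp: D'_def)
      also have "Q u (lincomb c B) = 0" using QB fam BD u by (subst Q.lincomb_right) auto
      finally show "E u v = of_real \<kappa> * P u v" by (simp add: Q_def)
    qed fact
    then have "eigenfamily t (insert u B)" "u \<notin> B" using eigenfamily_insert[OF B] u by auto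
    with max[of "insert u B"] fam show False by simp
  qed
  then show ?thesis unfolding spectral_cut_def using fam eigenfamily_bound[OF B] by (intro conjI ballI allI impI) auto
qed

text \<open>Maximality forces the family to span every eigenspace up to \<open>t\<close>, and
  different eigenspaces meet the family in disjoint sets; so its size is the sum of the
  dimensions.\<close>

theorem spectral_cut_exists:
  obtains B where "spectral_cut D E P t B" "card B = (\<Sum>s | s \<le> t \<and> eig s \<noteq> {0}. cfun.dim (eig s))"
proof -
  obtain K where K: "\<And>B. eigenfamily t B \<Longrightarrow> card B \<le> K" using eigenfamily_card_bounded by blast
  have "eigenfamily t {}" by (auto simp: eigenfamily_def)
  then obtain B where B: "eigenfamily t B" and max: "\<And>B'. eigenfamily t B' \<Longrightarrow> card B' \<le> card B"
    using ex_has_greatest_nat[of "eigenfamily t" "{}" card "Suc K"] K by (metis le_imp_less_Suc)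
  have fam: "finite B" "B \<subseteq> D - {0}" "\<forall>b\<in>B. \<forall>b'\<in>B. b \<noteq> b' \<longrightarrow> P b b' = 0"
    using B by (auto simp: eigenfamily_def)
  have eigs: "\<exists>s\<le>t. b \<in> eig s" if "b \<in> B" for b
    using B that by (simp add: eigenfamily_def)
  have span: "eig s \<subseteq> cfun.span (B \<inter> eig s)" if s: "s \<le> t" for s
  proof
    \<comment> \<open>The part of \<open>u\<close> orthogonal to \<open>B \<inter> eig s\<close> is
      orthogonal to the rest of \<open>B\<close> as well, since eigenvectors of different
      eigenvalues are orthogonal; were it nonzero, it could be added to \<open>B\<close>.\<close>
    fix u assume u: "u \<in> eig s"
    have fam': "finite (B \<inter> eig s)" "B \<inter> eig s \<subseteq> D - {0}"
      "\<forall>b\<in>B \<inter> eig s. \<forall>b'\<in>B \<inter> eig s. b \<noteq> b' \<longrightarrow> P b b' = 0" using fam by auto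
    have "u \<in> D" using u by (auto simp: eig_def)
    then obtain c where c: "\<forall>b\<in>B \<inter> eig s. P (u - lincomb c (B \<inter> eig s)) b = 0"
      using orthogonal_projection[OF fam'] by blast
    let ?w = "u - lincomb c (B \<inter> eig s)"
    have l: "lincomb c (B \<inter> eig s) \<in> eig s"
      unfolding lincomb_def by (intro cfun.subspace_sum subspace_eig) (auto intro: cfun.subspace_scale subspace_eig)
    have w: "?w \<in> eig s" using u l subspace_eig cfun.subspace_diff by blast
    have "P ?w b = 0" if "b \<in> B" for b
    proof (cases "b \<in> eig s")
      case False
      obtain s' where s': "b \<in> eig s'" using eigs[OF \<open>b \<in> B\<close>] by blast
      with False have "s \<noteq> s'" by auto
      then show ?thesis by (rule eig_orthogonal[OF w s'])
    qed (use c that in auto)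
    then have orth: "\<forall>b\<in>B. P ?w b = 0" by blast
    have "?w = 0"
    proof (rule ccontr)
      assume "?w \<noteq> 0"
      then have "eigenfamily t (insert ?w B)" "?w \<notin> B" using eigenfamily_insert[OF B w s _ orth] by auto
      with max[of "insert ?w B"] fam(1) show False by simp
    qed
    then have "u = lincomb c (B \<inter> eig s)" by (simp only: right_minus_eq)
    then show "u \<in> cfun.span (B \<inter> eig s)" using lincomb_in_span[of c "B \<inter> eig s"] by (simp only:)
  qed
  have indep: "\<not> cfun.dependent (B \<inter> eig s)" for s
  proof
    assume dep: "cfun.dependent (B \<inter> eig s)"
    have fin: "finite (B \<inter> eig s)" using fam by auto
    obtain c where "\<exists>b\<in>B \<inter> eig s. c b \<noteq> 0" "(\<Sum>b\<in>B \<inter> eig s. cscale (c b) b) = 0"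
      using dep unfolding cfun.dependent_finite[OF fin] by auto
    then show False using orthogonal_lincomb_nonzero[of "B \<inter> eig s" c] fam by (auto simp: lincomb_def)
  qed
  have dim: "cfun.dim (eig s) = card (B \<inter> eig s)" if "s \<le> t" for s
    using cfun.basis_card_eq_dim[of "B \<inter> eig s" "eig s"] span[OF that] indep by auto
  define S where "S = {s. s \<le> t \<and> eig s \<noteq> {0}}"
  have meet: "\<exists>b\<in>B. b \<in> eig s" if "s \<in> S" for s
  proof (rule ccontr)
    assume "\<not> ?thesis"
    then have "B \<inter> eig s = {}" by auto
    moreover have "0 \<in> eig s" using subspace_eig cfun.subspace_0 by blast
    ultimately have "eig s = {0}" using span[of s] that by (auto simp: S_def cfun.span_empty)
    then show False using that by (auto simp: S_def)
  qed
  have uniq: "s = s'" if "b \<in> B" "b \<in> eig s" "b \<in> eig s'" for b s s'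
  proof (rule ccontr)
    assume "s \<noteq> s'"
    then have "P b b = 0" using that eig_orthogonal by blast
    moreover have "0 < Re (P b b)" using that fam inner_pos by auto
    ultimately show False by simp
  qed
  \<comment> \<open>Choosing one member of \<open>B\<close> for each eigenvalue is injective, which
    makes the set of eigenvalues up to \<open>t\<close> finite.\<close>
  obtain g where g: "\<And>s. s \<in> S \<Longrightarrow> g s \<in> B \<and> g s \<in> eig s" using meet by metis
  have "inj_on g S" by (rule inj_onI) (metis g uniq)
  then have finS: "finite S" using g fam(1) by (metis (no_types, lifting) finite_imageD finite_subset image_subsetI)
  have Beq: "B = (\<Union>s\<in>S. B \<inter> eig s)"
  proof -
    have "\<exists>s\<in>S. b \<in> eig s" if "b \<in> B" for b
    proof -
      obtain s where "s \<le> t" "b \<in> eig s" using eigs[OF \<open>b \<in> B\<close>] by blast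
      moreover have "b \<noteq> 0" using that fam by auto
      ultimately show ?thesis unfolding S_def by auto
    qed
    then show ?thesis by auto
  qed
  have "card B = card (\<Union>s\<in>S. B \<inter> eig s)" using Beq by simp
  also have "\<dots> = (\<Sum>s\<in>S. card (B \<inter> eig s))"
    using finS fam uniq by (intro card_UN_disjoint) auto
  also have "\<dots> = (\<Sum>s\<in>S. cfun.dim (eig s))" using dim by (intro sum.cong) (auto simp: S_def)
  finally have card: "card B = (\<Sum>s\<in>S. cfun.dim (eig s))" .
  show ?thesis using maximal_eigenfamily_cut[OF B max] card that unfolding S_def by blast
qed

end

text \<open>If \<open>B\<close> were larger, its span would contain a nonzero \<open>u\<close>
  vanishing on \<open>Z\<close> with \<open>T u\<close> orthogonal to \<open>B'\<close>. The
  transformation keeps the quotient at most \<open>t\<close>, whereas orthogonality to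
  \<open>B'\<close> forces it above \<open>t\<close>.\<close>

lemma (in compact_form) spectral_cut_transplant:
  assumes B: "spectral_cut D E P t B" and B': "spectral_cut D' E P t B'"
    and Z: "finite Z"
    and lin: "\<And>c b'. b' \<in> B' \<Longrightarrow> P (T (lincomb c B)) b' = (\<Sum>b\<in>B. c b * P (T b) b')"
    and T: "\<And>u. u \<in> D \<Longrightarrow> u \<noteq> 0 \<Longrightarrow> \<forall>z\<in>Z. u z = 0 \<Longrightarrow> Re (E u u) \<le> t * Re (P u u) \<Longrightarrow>
      T u \<in> D' \<and> T u \<noteq> 0 \<and> Re (E (T u) (T u)) \<le> t * Re (P (T u) (T u))"
  shows "card B \<le> card B' + card Z"
proof (rule ccontr)
  assume less: "\<not> ?thesis"
  have fam: "finite B" "B \<subseteq> D - {0}" "\<forall>b\<in>B. \<forall>b'\<in>B. b \<noteq> b' \<longrightarrow> P b b' = 0" and fin: "finite B'"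
    using B B' by (auto simp: spectral_cut_def)
  have "card (Z <+> B') < card B" using less fin Z by (simp add: card_Plus)
  note less = this
  have finI: "finite (Z <+> B')" using Z fin by simp
  obtain c where ne: "lincomb c B \<noteq> 0" and c: "\<And>i. i \<in> Z <+> B' \<Longrightarrow>
      (case i of Inl z \<Rightarrow> lincomb c B z | Inr b' \<Rightarrow> P (T (lincomb c B)) b') = 0"
    by (rule lincomb_with_zeros[OF fam finI less, of "\<lambda>i u. case i of Inl z \<Rightarrow> u z | Inr b' \<Rightarrow> P (T u) b'"])
      (auto simp: lincomb_apply lin split: sum.splits)
  let ?u = "lincomb c B"
  have "?u \<in> D" using fam by (intro P.lincomb_mem) auto
  moreover have "\<forall>z\<in>Z. ?u z = 0" using c by force
  moreover have "Re (E ?u ?u) \<le> t * Re (P ?u ?u)" using B by (simp add: spectral_cut_def)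
  ultimately have Tu: "T ?u \<in> D'" "T ?u \<noteq> 0" "Re (E (T ?u) (T ?u)) \<le> t * Re (P (T ?u) (T ?u))"
    using T[OF _ ne] by auto
  have "\<forall>b'\<in>B'. P (T ?u) b' = 0" using c by force
  then have "t * Re (P (T ?u) (T ?u)) < Re (E (T ?u) (T ?u))"
    using B' Tu by (simp add: spectral_cut_def)
  then show False using Tu by simp
qed

text \<open>Both inequalities compare \<open>B\<close> with \<open>B1 \<union> B2\<close> by the
  same count: a combination of the larger family orthogonal to the smaller one would have a quotient
  at most \<open>t\<close> and, as both forms split along \<open>D1\<close> and \<open>D2\<close>,
  also above \<open>t\<close>.\<close>

lemma (in compact_form) spectral_cut_orthogonal_sum:
  assumes B: "spectral_cut D E P t B"
    and B1: "spectral_cut D1 E P t B1" and B2: "spectral_cut D2 E P t B2"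
    and sub: "D1 \<subseteq> D" "D2 \<subseteq> D" "cfun.subspace D1" "cfun.subspace D2"
    and orth: "\<And>u v. u \<in> D1 \<Longrightarrow> v \<in> D2 \<Longrightarrow> E u v = 0" "\<And>u v. u \<in> D1 \<Longrightarrow> v \<in> D2 \<Longrightarrow> P u v = 0"
    and dec: "\<And>u. u \<in> D \<Longrightarrow> \<exists>u1\<in>D1. \<exists>u2\<in>D2. u = u1 + u2"
  shows "card B = card B1 + card B2"
proof -
  have fam: "finite B" "B \<subseteq> D - {0}" "\<forall>b\<in>B. \<forall>b'\<in>B. b \<noteq> b' \<longrightarrow> P b b' = 0"
    using B by (auto simp: spectral_cut_def)
  have fam1: "finite B1" "B1 \<subseteq> D1 - {0}" "\<forall>b\<in>B1. \<forall>b'\<in>B1. b \<noteq> b' \<longrightarrow> P b b' = 0"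
    using B1 by (auto simp: spectral_cut_def)
  have fam2: "finite B2" "B2 \<subseteq> D2 - {0}" "\<forall>b\<in>B2. \<forall>b'\<in>B2. b \<noteq> b' \<longrightarrow> P b b' = 0"
    using B2 by (auto simp: spectral_cut_def)
  have mem: "u \<in> D1 \<Longrightarrow> u \<in> D" "u \<in> D2 \<Longrightarrow> u \<in> D" for u using sub by auto
  have orth': "P v u = 0" if "u \<in> D1" "v \<in> D2" for u v
    using P.sym[of u v] orth(2)[OF that] mem that by auto
  have E_add: "Re (E (u1 + u2) (u1 + u2)) = Re (E u1 u1) + Re (E u2 u2)"
    and P_add: "Re (P (u1 + u2) (u1 + u2)) = Re (P u1 u1) + Re (P u2 u2)" if "u1 \<in> D1" "u2 \<in> D2" for u1 u2
    using that orth mem by (auto simp: E.quadratic_add P.quadratic_add)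
  have disj: "B1 \<inter> B2 = {}"
  proof (rule ccontr)
    assume "B1 \<inter> B2 \<noteq> {}"
    then obtain b where b: "b \<in> B1" "b \<in> B2" by auto
    then have "P b b = 0" "b \<in> D" "b \<noteq> 0" using fam1 fam2 orth(2)[of b b] mem by auto
    then show False using inner_pos[of b] by simp
  qed
  have fam12: "finite (B1 \<union> B2)" "B1 \<union> B2 \<subseteq> D - {0}"
    "\<forall>b\<in>B1 \<union> B2. \<forall>b'\<in>B1 \<union> B2. b \<noteq> b' \<longrightarrow> P b b' = 0"
    using fam1 fam2 orth orth' mem by (auto simp: subset_iff)
  have "card B \<le> card (B1 \<union> B2)"
  proof (rule ccontr)
    assume "\<not> ?thesis"
    then have less: "card (B1 \<union> B2) < card B" by simp
    obtain c where ne: "lincomb c B \<noteq> 0" and c: "\<And>b. b \<in> B1 \<union> B2 \<Longrightarrow> P (lincomb c B) b = 0"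
      by (rule lincomb_with_zeros[OF fam fam12(1) less, of "\<lambda>b u. P u b"])
        (use fam fam12(2) in \<open>auto intro!: P.lincomb_left\<close>)
    let ?u = "lincomb c B"
    have u: "?u \<in> D" using fam by (intro P.lincomb_mem) auto
    obtain u1 u2 where u12: "u1 \<in> D1" "u2 \<in> D2" "?u = u1 + u2" using dec[OF u] by blast
    have "P u1 b = 0" if "b \<in> B1" for b
      using c[of b] that u12 P.add_left[of u1 u2 b] orth'[of b u2] mem fam1 by auto
    then have 1: "u1 \<noteq> 0 \<Longrightarrow> t * Re (P u1 u1) < Re (E u1 u1)" using B1 u12 by (auto simp: spectral_cut_def)
    have "P u2 b = 0" if "b \<in> B2" for b
      using c[of b] that u12 P.add_left[of u1 u2 b] orth(2)[of u1 b] mem fam2 by auto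
    then have 2: "u2 \<noteq> 0 \<Longrightarrow> t * Re (P u2 u2) < Re (E u2 u2)" using B2 u12 by (auto simp: spectral_cut_def)
    have 0: "P 0 0 = 0" "E 0 0 = 0" using E.zero_left P.zero_left P.zero_mem by auto
    have "u1 \<noteq> 0 \<or> u2 \<noteq> 0" using ne u12 by auto
    moreover have "t * Re (P u1 u1) \<le> Re (E u1 u1)" using 1 0 by (cases "u1 = 0") auto
    moreover have "t * Re (P u2 u2) \<le> Re (E u2 u2)" using 2 0 by (cases "u2 = 0") auto
    ultimately have "t * (Re (P u1 u1) + Re (P u2 u2)) < Re (E u1 u1) + Re (E u2 u2)"
      using 1 2 by (auto simp: algebra_simps intro: add_less_le_mono add_le_less_mono)
    moreover have "Re (E ?u ?u) \<le> t * Re (P ?u ?u)" using B by (simp add: spectral_cut_def)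
    ultimately show False using E_add[OF u12(1,2)] P_add[OF u12(1,2)] u12(3) by simp
  qed
  moreover have "card (B1 \<union> B2) \<le> card B"
  proof (rule ccontr)
    assume "\<not> ?thesis"
    then have less: "card B < card (B1 \<union> B2)" by simp
    obtain c where ne: "lincomb c (B1 \<union> B2) \<noteq> 0" and c: "\<And>b. b \<in> B \<Longrightarrow> P (lincomb c (B1 \<union> B2)) b = 0"
      by (rule lincomb_with_zeros[OF fam12 fam(1) less, of "\<lambda>b u. P u b"])
        (use fam fam12(2) in \<open>auto intro!: P.lincomb_left[OF fam12(1)] simp del: finite_Un\<close>)
    let ?u = "lincomb c (B1 \<union> B2)"
    have u: "?u \<in> D" using fam12 by (intro P.lincomb_mem) auto
    have eq: "?u = lincomb c B1 + lincomb c B2"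
      unfolding lincomb_def using fam1 fam2 disj by (intro sum.union_disjoint) auto
    have u12: "lincomb c B1 \<in> D1" "lincomb c B2 \<in> D2"
      unfolding lincomb_def using fam1 fam2 sub(3,4) by (auto intro!: cfun.subspace_sum cfun.subspace_scale)
    have "t * Re (P ?u ?u) < Re (E ?u ?u)" using B u ne c by (auto simp: spectral_cut_def)
    moreover have "Re (E (lincomb c B1) (lincomb c B1)) \<le> t * Re (P (lincomb c B1) (lincomb c B1))"
      "Re (E (lincomb c B2) (lincomb c B2)) \<le> t * Re (P (lincomb c B2) (lincomb c B2))"
      using B1 B2 by (auto simp: spectral_cut_def)
    ultimately show False unfolding eq E_add[OF u12] P_add[OF u12] by (simp add: algebra_simps)
  qed
  ultimately show ?thesis using fam1 fam2 disj by (simp add: card_Un_disjoint)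
qed

section \<open>Geometry of the gasket\<close>

lemma lessThan_3: "{..<3::nat} = {0, 1, 2}"
  by auto

lemma less_3_cases: "i < 3 \<Longrightarrow> (i = 0 \<Longrightarrow> R) \<Longrightarrow> (i = 1 \<Longrightarrow> R) \<Longrightarrow> (i = 2 \<Longrightarrow> R) \<Longrightarrow> R" for i :: nat
  by linarith

lemma all_less_3: "(\<forall>i<3. R i) \<longleftrightarrow> R 0 \<and> R 1 \<and> R (2::nat)"
  by (auto elim: less_3_cases)

lemma sum_less_3: "(\<Sum>i<3. f i) = f 0 + f 1 + f (2::nat)"
  by (simp add: lessThan_3 add.assoc)

lemma q_values: "q 0 = 1" "q 1 = Complex (-1/2) (sqrt 3 / 2)" "q 2 = Complex (-1/2) (- sqrt 3 / 2)"
proof -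
  show "q 0 = 1" by (simp add: q_def)
  have "cos (2 * pi / 3) = - 1/2" "sin (2 * pi / 3) = sqrt 3 / 2"
    using cos_120 sin_120 by auto
  then show "q 1 = Complex (-1/2) (sqrt 3 / 2)" by (simp add: q_def complex_eq_iff)
  have "2 * pi * 2 / 3 = 2 * pi - 2 * pi / 3" by (simp add: field_simps)
  then have "cos (2 * pi * 2 / 3) = - 1/2" "sin (2 * pi * 2 / 3) = - sqrt 3 / 2"
    using cos_120 sin_120 by (simp_all only: cos_diff sin_diff) simp_all
  then show "q 2 = Complex (-1/2) (- sqrt 3 / 2)" by (simp add: q_def complex_eq_iff)
qed

lemmas q_simps = q_values q_values(2)[unfolded One_nat_def]

text \<open>Barycentric coordinate at the vertex \<open>q i\<close>: the vertices are unit vectors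
  with sum zero, so it is an affine function of the inner product with \<open>q i\<close>.\<close>

definition bary :: "nat \<Rightarrow> complex \<Rightarrow> real" where
  "bary i x = (1 + 2 * (Re x * Re (q i) + Im x * Im (q i))) / 3"

lemma bary_values:
  "bary 0 x = (1 + 2 * Re x) / 3" "bary 1 x = (1 - Re x + sqrt 3 * Im x) / 3"
  "bary 2 x = (1 - Re x - sqrt 3 * Im x) / 3"
  unfolding bary_def q_simps by (auto simp: algebra_simps)

lemmas bary_simps = bary_values bary_values(2)[unfolded One_nat_def]

lemma bary_sum: "bary 0 x + bary 1 x + bary 2 x = 1"
  by (simp add: bary_simps field_simps)

lemma bary_eqI: "(\<And>i. i < 3 \<Longrightarrow> bary i x = bary i y) \<Longrightarrow> x = y"
  using bary_simps[of x] bary_simps[of y] by (force simp: complex_eq_iff)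

lemma bary_F: "i < 3 \<Longrightarrow> j < 3 \<Longrightarrow> bary i (F j x) = bary i x / 2 + (if i = j then 1 / 2 else 0)"
  by (elim less_3_cases) (simp_all add: bary_simps F_def q_simps field_simps)

lemma bary_q: "i < 3 \<Longrightarrow> j < 3 \<Longrightarrow> bary i (q j) = (if i = j then 1 else 0)"
  by (elim less_3_cases) (simp_all add: bary_simps q_simps field_simps)

lemma F_q_commute: "F i (q j) = F j (q i)"
  by (simp add: F_def)

lemma F_q [simp]: "F i (q i) = q i"
  by (simp add: F_def)

lemma F_eq_iff [simp]: "F i x = F i y \<longleftrightarrow> x = y"
  by (simp add: F_def)

lemma dist_F: "dist (F i x) (F i y) = dist x y / 2"
proof -
  have eq: "F i x - F i y = (x - y) / 2" by (simp add: F_def field_simps)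
  show ?thesis unfolding dist_norm eq by (simp add: norm_divide)
qed

lemma continuous_on_F: "continuous_on S (F i)"
  unfolding F_def by (intro continuous_intros) auto

definition big_triangle :: "complex set" where
  "big_triangle = {x. \<forall>i<3. 0 \<le> bary i x}"

lemma norm_q: "norm (q i) = 1"
  by (simp add: q_def)

lemma triangle_norm: "x \<in> big_triangle \<Longrightarrow> norm x \<le> 1"
proof -
  assume x: "x \<in> big_triangle"
  have "x = of_real (bary 0 x) * q 0 + of_real (bary 1 x) * q 1 + of_real (bary 2 x) * q 2"
    by (simp add: bary_simps q_simps complex_eq_iff field_simps)
  then have "norm x \<le> norm (of_real (bary 0 x) * q 0) + norm (of_real (bary 1 x) * q 1) + norm (of_real (bary 2 x) * q 2)"
    by (metis norm_triangle_le norm_triangle_ineq add_right_mono)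
  also have "\<dots> = 1" using x bary_sum[of x] unfolding norm_mult norm_q
    by (auto simp: big_triangle_def all_less_3)
  finally show ?thesis .
qed

lemma compact_triangle: "compact big_triangle"
proof -
  have "closed {x. 0 \<le> bary i x}" for i
    unfolding bary_def by (intro closed_Collect_le continuous_intros) auto
  moreover have "big_triangle = (\<Inter>i\<in>{..<3}. {x. 0 \<le> bary i x})" by (auto simp: big_triangle_def)
  ultimately have "closed big_triangle" by (metis (no_types, lifting) closed_INT)
  moreover have "bounded big_triangle" using triangle_norm by (auto simp: bounded_iff)
  ultimately show ?thesis by (simp add: compact_eq_bounded_closed)
qed

lemma F_triangle: "i < 3 \<Longrightarrow> x \<in> big_triangle \<Longrightarrow> F i x \<in> big_triangle"
  by (auto simp: big_triangle_def bary_F)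

section \<open>The attractor of the three contractions\<close>

definition hutchinson :: "complex set \<Rightarrow> complex set" where
  "hutchinson A = (\<Union>i<3. F i ` A)"

text \<open>Following \<open>A \<subseteq> hutchinson A\<close> back n times writes a point of
  \<open>A\<close> as an n-fold image of a point of \<open>A\<close>; exchanging that point for a
  point of \<open>L\<close> moves the image by at most C / 2 ^ n and lands in \<open>L\<close>. This
  serves for the uniqueness of the gasket, its symmetries, and the inclusion of vertices and coded
  points.\<close>

lemma subset_of_contraction:
  assumes A: "bounded A" "A \<subseteq> hutchinson A" and L: "closed L" "L \<noteq> {}" "hutchinson L \<subseteq> L"
  shows "A \<subseteq> L"
proof
  fix x assume "x \<in> A"
  obtain l where l: "l \<in> L" using L by auto
  obtain C where C: "\<And>y. y \<in> A \<Longrightarrow> dist y l \<le> C" using A(1) by (metis bounded_any_center dist_commute)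
  have approx: "\<exists>y\<in>L. dist x y \<le> C / 2 ^ n" if "x \<in> A" for x n
    using that
  proof (induction n arbitrary: x)
    case 0
    then show ?case using C l by auto
  next
    case (Suc n)
    then obtain i x' where i: "i < 3" "x' \<in> A" "x = F i x'" using A(2) by (auto simp: hutchinson_def)
    obtain y where y: "y \<in> L" "dist x' y \<le> C / 2 ^ n" using Suc.IH i by blast
    have "F i y \<in> L" using L(3) y i by (auto simp: hutchinson_def)
    moreover have "dist x (F i y) \<le> C / 2 ^ Suc n" using y i by (simp add: dist_F)
    ultimately show ?case by blast
  qed
  have "\<exists>y\<in>L. dist y x < e" if "0 < e" for e
  proof -
    have "(\<lambda>n. C / 2 ^ n) \<longlonglongrightarrow> 0"
      by (rule LIMSEQ_divide_realpow_zero) simp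
    then have "\<forall>\<^sub>F n in sequentially. C / 2 ^ n < e" using that by (rule order_tendstoD)
    then obtain n where "C / 2 ^ n < e" by (auto simp: eventually_sequentially)
    then show ?thesis using approx[OF \<open>x \<in> A\<close>, of n] by (metis dist_commute le_less_trans)
  qed
  then show "x \<in> L" using L(1) closed_approachable by blast
qed

text \<open>Iterating \<open>hutchinson\<close> on the triangle gives a decreasing sequence of
  nonempty compact sets; their intersection is the fixed set.\<close>

lemma gasket_exists:
  "\<exists>K. compact K \<and> K \<noteq> {} \<and> K = hutchinson K \<and> K \<subseteq> big_triangle"
proof -
  define K where "K n = (hutchinson ^^ n) big_triangle" for n
  have K_Suc: "K (Suc n) = hutchinson (K n)" for n by (simp add: K_def)
  have mono: "A \<subseteq> B \<Longrightarrow> hutchinson A \<subseteq> hutchinson B" for A B by (auto simp: hutchinson_def)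
  have compact_h: "compact (hutchinson A)" if "compact A" for A
    unfolding hutchinson_def using that
    by (intro compact_UN compact_continuous_image continuous_on_F) auto
  have comp: "compact (K n)" for n
    by (induction n) (auto simp: K_def compact_triangle compact_h)
  have dec_Suc: "K (Suc n) \<subseteq> K n" for n
  proof (induction n)
    case 0
    show ?case using F_triangle by (auto simp: K_def hutchinson_def)
  next
    case (Suc n)
    then show ?case unfolding K_Suc[of "Suc n"] K_Suc[of n] by (intro mono)
  qed
  have dec: "m \<le> n \<Longrightarrow> K n \<subseteq> K m" for m n
    using decseq_SucI[of K] dec_Suc by (auto simp: decseq_def)
  have "0 \<in> big_triangle" by (auto simp: big_triangle_def bary_def)
  then have ne: "K n \<noteq> {}" for n
    by (induction n) (auto simp: K_def hutchinson_def lessThan_3)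
  define L where "L = (\<Inter>n. K n)"
  have "compact L" unfolding L_def using comp by (intro compact_Inter) auto
  moreover have "L \<noteq> {}" unfolding L_def
    by (rule compact_nest[OF comp ne]) (use dec in auto)
  moreover have "L \<subseteq> big_triangle" unfolding L_def K_def by (rule INF_lower2[of 0]) auto
  moreover have "hutchinson L \<subseteq> L"
  proof -
    have "hutchinson L \<subseteq> K n" for n
    proof (cases n)
      case 0
      have "L \<subseteq> K 0" by (auto simp: L_def)
      then show ?thesis using mono[of L "K 0"] dec_Suc[of 0] 0 by (simp add: K_Suc)
    next
      case (Suc m)
      have "L \<subseteq> K m" by (auto simp: L_def)
      then show ?thesis using mono Suc by (simp add: K_Suc)
    qed
    then show ?thesis by (auto simp: L_def)
  qed
  moreover have "L \<subseteq> hutchinson L"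
  proof
    fix x assume x: "x \<in> L"
    show "x \<in> hutchinson L"
    proof (rule ccontr)
      assume no: "x \<notin> hutchinson L"
      \<comment> \<open>The maps are injective: if \<open>x\<close> lay in the i-th image at every
        level, its single preimage would lie in all \<open>K n\<close>. So each of the three maps
        loses \<open>x\<close> at some level, and the largest of these levels gives the
        contradiction.\<close>
      have "\<exists>n. x \<notin> F i ` K n" if "i < 3" for i
      proof (rule ccontr)
        assume "\<not> ?thesis"
        then have all: "\<And>n. x \<in> F i ` K n" by blast
        then obtain y where y: "x = F i y" "y \<in> K 0" by blast
        have "y \<in> K n" for n using all[of n] y by auto
        then show False using no y that by (auto simp: L_def hutchinson_def)
      qed
      then obtain n where n: "\<And>i. i < 3 \<Longrightarrow> x \<notin> F i ` K (n i)" by metis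
      define m where "m = Max (n ` {..<3})"
      have "x \<in> K (Suc m)" using x by (auto simp: L_def)
      then obtain i where i: "i < 3" "x \<in> F i ` K m" by (auto simp: K_Suc hutchinson_def)
      have "n i \<le> m" unfolding m_def using i by (intro Max_ge) auto
      then show False using dec n i by blast
    qed
  qed
  ultimately show ?thesis by blast
qed

lemma SG_props: "compact SG \<and> SG \<noteq> {} \<and> SG = hutchinson SG" and SG_subset_triangle: "SG \<subseteq> big_triangle"
proof -
  obtain K where K: "compact K" "K \<noteq> {}" "K = hutchinson K" "K \<subseteq> big_triangle"
    using gasket_exists by blast
  have "SG = K"
    unfolding SG_def
  proof (rule the_equality)
    show "compact K \<and> K \<noteq> {} \<and> K = (\<Union>i<3. F i ` K)"
      using K by (simp add: hutchinson_def)
    fix L assume "compact L \<and> L \<noteq> {} \<and> L = (\<Union>i<3. F i ` L)"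
    then have L: "compact L" "L \<noteq> {}" "L = hutchinson L" by (auto simp: hutchinson_def)
    show "L = K"
      using subset_of_contraction[of L K] subset_of_contraction[of K L] L K
      by (simp add: compact_imp_bounded compact_imp_closed subset_antisym)
  qed
  then show "compact SG \<and> SG \<noteq> {} \<and> SG = hutchinson SG" "SG \<subseteq> big_triangle" using K by auto
qed

lemma compact_SG: "compact SG" and SG_nonempty: "SG \<noteq> {}" and SG_hutchinson: "hutchinson SG = SG"
  using SG_props by auto

lemma SG_cases: "x \<in> SG \<Longrightarrow> (\<And>i y. i < 3 \<Longrightarrow> y \<in> SG \<Longrightarrow> x = F i y \<Longrightarrow> R) \<Longrightarrow> R"
  using SG_hutchinson unfolding hutchinson_def by blast

lemma F_SG: "i < 3 \<Longrightarrow> x \<in> SG \<Longrightarrow> F i x \<in> SG"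
  using SG_hutchinson by (auto simp: hutchinson_def)

lemma bary_nonneg: "x \<in> SG \<Longrightarrow> i < 3 \<Longrightarrow> 0 \<le> bary i x"
  using SG_subset_triangle by (auto simp: big_triangle_def)

lemma V0_eq: "V0 = {q 0, q 1, q 2}"
  by (simp add: V0_def lessThan_3)

lemma V0_subset_SG: "V0 \<subseteq> SG"
proof (rule subset_of_contraction)
  show "V0 \<subseteq> hutchinson V0"
  proof
    fix x assume "x \<in> V0"
    then obtain i where i: "i < 3" "x = q i" by (auto simp: V0_def)
    then have "F i (q i) \<in> F i ` V0" by (intro imageI) (auto simp: V0_def)
    then show "x \<in> hutchinson V0" using i by (auto simp: hutchinson_def)
  qed
qed (use SG_nonempty SG_hutchinson in \<open>auto simp: V0_eq compact_imp_closed compact_SG\<close>)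

lemma q_SG: "i < 3 \<Longrightarrow> q i \<in> SG"
  using V0_subset_SG by (auto simp: V0_def)

lemma q_eq_iff: "i < 3 \<Longrightarrow> j < 3 \<Longrightarrow> q i = q j \<longleftrightarrow> i = j"
  using bary_q[of i i] bary_q[of i j] by (auto split: if_splits)

text \<open>In the image of \<open>F k\<close> the coordinate \<open>bary k\<close> is at least 1/2.
  Two such coordinates of one point must both equal 1/2, and the third is then 0.\<close>

lemma F_image_Int:
  assumes "i < 3" "j < 3" "i \<noteq> j" "x \<in> F i ` SG" "x \<in> F j ` SG"
  shows "x = F i (q j)"
proof (rule bary_eqI)
  have x: "x \<in> SG" using assms F_SG by auto
  have half: "1 / 2 \<le> bary k x" if "k < 3" "x \<in> F k ` SG" for k
    using that bary_nonneg by (auto simp: bary_F)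
  have nn: "0 \<le> bary 0 x" "0 \<le> bary 1 x" "0 \<le> bary 2 x" using bary_nonneg x by auto
  fix k :: nat assume "k < 3"
  then show "bary k x = bary k (F i (q j))"
    using assms(1-3) half[OF assms(1,4)] half[OF assms(2,5)] nn bary_sum[of x] by (elim less_3_cases) (auto simp: bary_F bary_q)
qed

subsection \<open>Vertices and edges\<close>

primrec V :: "nat \<Rightarrow> complex set" where
  "V 0 = V0"
| "V (Suc m) = (\<Union>i<3. F i ` V m)"

lemma finite_V: "finite (V m)"
  by (induction m) (auto simp: V0_def)

lemma V_subset_SG: "V m \<subseteq> SG"
  using V0_subset_SG F_SG by (induction m) auto

lemma edges_V: "(x, y) \<in> edges m \<Longrightarrow> x \<in> V m \<and> y \<in> V m \<and> x \<noteq> y"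
  by (induction m arbitrary: x y) (fastforce simp: map_prod_def)+

lemma finite_edges: "finite (edges m)"
  by (rule finite_subset[of _ "V m \<times> V m"]) (use edges_V finite_V in auto)

text \<open>The diagonal of \<open>energy_approx\<close> as a real number, so that monotonicity in
  the level can be stated as an inequality and for arbitrary functions.\<close>

definition en :: "nat \<Rightarrow> (complex \<Rightarrow> complex) \<Rightarrow> real" where
  "en m u = (5 / 3) ^ m / 2 * (\<Sum>(x, y)\<in>edges m. (cmod (u x - u y))\<^sup>2)"

text \<open>No edge is counted twice: two cells share a single point, whereas an edge has two
  distinct endpoints.\<close>

lemma sum_edges_Suc:
  "(\<Sum>e\<in>edges (Suc m). f e) = (\<Sum>i<3. \<Sum>(x, y)\<in>edges m. f (F i x, F i y))"
proof -
  have "(\<Sum>e\<in>edges (Suc m). f e) = (\<Sum>i<3. \<Sum>e\<in>map_prod (F i) (F i) ` edges m. f e)"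
    unfolding edges.simps
  proof (rule sum.UNION_disjoint)
    show "\<forall>i\<in>{..<3}. \<forall>j\<in>{..<3}. i \<noteq> j \<longrightarrow>
      map_prod (F i) (F i) ` edges m \<inter> map_prod (F j) (F j) ` edges m = {}"
    proof (intro ballI impI)
      fix i j :: nat assume ij: "i \<in> {..<3}" "j \<in> {..<3}" "i \<noteq> j"
      show "map_prod (F i) (F i) ` edges m \<inter> map_prod (F j) (F j) ` edges m = {}"
      proof (rule ccontr)
        assume "\<not> ?thesis"
        then obtain x y x' y' where xy: "(x, y) \<in> edges m" "(x', y') \<in> edges m" "F i x = F j x'" "F i y = F j y'"
          by auto
        have "{x, y, x', y'} \<subseteq> SG" "x \<noteq> y" using edges_V[OF xy(1)] edges_V[OF xy(2)] V_subset_SG by auto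
        then have "F i x \<in> F i ` SG" "F i x \<in> F j ` SG" "F i y \<in> F i ` SG" "F i y \<in> F j ` SG"
          using xy(3,4) by (metis imageI insert_subset)+
        then have "F i x = F i (q j)" "F i y = F i (q j)" using F_image_Int[of i j] ij unfolding lessThan_iff by metis+
        then show False using \<open>x \<noteq> y\<close> by simp
      qed
    qed
  qed (auto simp: finite_edges)
  also have "\<dots> = (\<Sum>i<3. \<Sum>(x, y)\<in>edges m. f (F i x, F i y))"
  proof (rule sum.cong[OF refl])
    fix i
    have "inj_on (map_prod (F i) (F i)) (edges m)" by (auto simp: inj_on_def)
    then show "(\<Sum>e\<in>map_prod (F i) (F i) ` edges m. f e) = (\<Sum>(x, y)\<in>edges m. f (F i x, F i y))"
      by (simp add: sum.reindex case_prod_unfold map_prod_def)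
  qed
  finally show ?thesis .
qed

lemma en_Suc: "en (Suc m) u = 5 / 3 * (\<Sum>i<3. en m (u \<circ> F i))"
  unfolding en_def sum_edges_Suc by (simp add: sum_distrib_left mult.assoc)

lemma en_nonneg: "0 \<le> en m u"
  unfolding en_def by (intro mult_nonneg_nonneg sum_nonneg) auto

lemma edges_0: "edges 0 = {(q 0, q 1), (q 1, q 0), (q 0, q 2), (q 2, q 0), (q 1, q 2), (q 2, q 1)}"
  using q_eq_iff[of 0 1] q_eq_iff[of 0 2] q_eq_iff[of 1 2] by (auto simp: V0_eq)

lemma en_0: "en 0 u = (cmod (u (q 0) - u (q 1)))\<^sup>2 + (cmod (u (q 0) - u (q 2)))\<^sup>2 + (cmod (u (q 1) - u (q 2)))\<^sup>2"
  using q_eq_iff[of 0 1] q_eq_iff[of 0 2] q_eq_iff[of 1 2]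
  unfolding en_def edges_0 by (simp add: norm_minus_commute)

text \<open>The sum over the nine small edges is least at the harmonic extension, where the value at the
  midpoint of the edge from a to b is (2a+2b+c)/5.\<close>

lemma harmonic_extension_real:
  fixes a b c x y z :: real
  shows "(a-b)\<^sup>2 + (a-c)\<^sup>2 + (b-c)\<^sup>2 \<le> 5/3 * (((a-x)\<^sup>2 + (a-y)\<^sup>2 + (x-y)\<^sup>2) + ((x-b)\<^sup>2 + (x-z)\<^sup>2 + (b-z)\<^sup>2) + ((y-z)\<^sup>2 + (y-c)\<^sup>2 + (z-c)\<^sup>2))"
proof -
  define X where "X = x - (2*a+2*b+c)/5"
  define Y where "Y = y - (2*a+2*c+b)/5"
  define Z where "Z = z - (2*b+2*c+a)/5"
  have "5/3 * (((a-x)\<^sup>2 + (a-y)\<^sup>2 + (x-y)\<^sup>2) + ((x-b)\<^sup>2 + (x-z)\<^sup>2 + (b-z)\<^sup>2) + ((y-z)\<^sup>2 + (y-c)\<^sup>2 + (z-c)\<^sup>2))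
    = ((a-b)\<^sup>2 + (a-c)\<^sup>2 + (b-c)\<^sup>2) + 5/3 * ((X-Y)\<^sup>2 + (X-Z)\<^sup>2 + (Y-Z)\<^sup>2 + 2*X\<^sup>2 + 2*Y\<^sup>2 + 2*Z\<^sup>2)"
    unfolding X_def Y_def Z_def by (simp add: power2_eq_square field_simps)
  then show ?thesis by simp
qed

lemma harmonic_extension:
  fixes a b c x y z :: complex
  shows "(cmod (a-b))\<^sup>2 + (cmod (a-c))\<^sup>2 + (cmod (b-c))\<^sup>2 \<le> 5/3 * (((cmod (a-x))\<^sup>2 + (cmod (a-y))\<^sup>2 + (cmod (x-y))\<^sup>2) + ((cmod (x-b))\<^sup>2 + (cmod (x-z))\<^sup>2 + (cmod (b-z))\<^sup>2) + ((cmod (y-z))\<^sup>2 + (cmod (y-c))\<^sup>2 + (cmod (z-c))\<^sup>2))"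
  using harmonic_extension_real[of "Re a" "Re b" "Re c" "Re x" "Re y" "Re z"]
    harmonic_extension_real[of "Im a" "Im b" "Im c" "Im x" "Im y" "Im z"]
  unfolding cmod_power2 minus_complex.simps distrib_left by linarith

text \<open>At level 0 this is \<open>harmonic_extension\<close> with the three midpoints as new
  vertices; self-similarity carries it to every level. Hence bounded energies converge.\<close>

lemma en_le_Suc: "en m u \<le> en (Suc m) u"
proof (induction m arbitrary: u)
  case 0
  have "en 0 u \<le> 5 / 3 * (\<Sum>i<3. en 0 (u \<circ> F i))"
    using harmonic_extension[of "u (q 0)" "u (q 1)" "u (q 2)" "u (F 0 (q 1))" "u (F 0 (q 2))" "u (F 1 (q 2))"]
    unfolding sum_less_3 en_0 o_def F_q F_q_commute[of 1 0] F_q_commute[of 2 0] F_q_commute[of 2 1] .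
  then show ?case by (simp only: en_Suc)
next
  case (Suc m)
  have "en (Suc m) u \<le> 5 / 3 * (\<Sum>i<3. en (Suc m) (u \<circ> F i))"
    unfolding en_Suc[of m u] using Suc by (intro mult_left_mono sum_mono) auto
  then show ?case by (simp only: en_Suc[of "Suc m"])
qed

lemma en_mono: "m \<le> n \<Longrightarrow> en m u \<le> en n u"
  using lift_Suc_mono_le[of "\<lambda>m. en m u"] en_le_Suc by blast

section \<open>Oscillation of functions of finite energy\<close>

lemma en_comp_F_le:
  assumes "\<And>k. en k u \<le> B" "i < 3" shows "en k (u \<circ> F i) \<le> 3 / 5 * B"
proof -
  have "en k (u \<circ> F i) \<le> (\<Sum>i<3. en k (u \<circ> F i))"
    using assms(2) by (intro member_le_sum) (auto simp: en_nonneg)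
  also have "\<dots> = 3 / 5 * en (Suc k) u" by (simp add: en_Suc)
  finally show ?thesis using assms(1)[of "Suc k"] by simp
qed

lemma edge_0_le:
  assumes "\<And>k. en k u \<le> B" "i < 3" "j < 3" shows "cmod (u (q i) - u (q j)) \<le> sqrt B"
proof -
  have "(cmod (u (q i) - u (q j)))\<^sup>2 \<le> en 0 u"
    using assms(2,3) by (elim less_3_cases) (simp_all add: en_0 norm_minus_commute)
  then show ?thesis using assms(1)[of 0] by (intro real_le_rsqrt) linarith
qed

text \<open>A vertex of level m + 1 is joined to \<open>q j\<close> through the vertex
  \<open>q i\<close> of its cell, in which the energy bound is smaller by 3/5. The constant 5
  reproduces itself because sqrt (3/5) \<le> 4/5 and 5 * 4/5 + 1 = 5.\<close>

lemma vertex_oscillation: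
  assumes "\<And>k. en k u \<le> B" "x \<in> V m" "j < 3"
  shows "cmod (u x - u (q j)) \<le> 5 * sqrt B"
  using assms
proof (induction m arbitrary: u B x j)
  case 0
  then obtain i where i: "i < 3" "x = q i" by (auto simp: V0_def)
  have "cmod (u x - u (q j)) \<le> sqrt B" unfolding i by (rule edge_0_le) (use 0 i in auto)
  also have "\<dots> \<le> 5 * sqrt B"
    using order_trans[OF en_nonneg 0(1)] by simp
  finally show ?case .
next
  case (Suc m)
  then obtain i y where i: "i < 3" "y \<in> V m" "x = F i y" by auto
  have B: "0 \<le> B" using order_trans[OF en_nonneg Suc.prems(1)] .
  have "cmod ((u \<circ> F i) y - (u \<circ> F i) (q i)) \<le> 5 * sqrt (3 / 5 * B)"
    using i by (intro Suc.IH en_comp_F_le Suc.prems(1)) auto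
  then have 1: "cmod (u x - u (q i)) \<le> 5 * sqrt (3 / 5 * B)" using i by simp
  have 2: "cmod (u (q i) - u (q j)) \<le> sqrt B" by (rule edge_0_le) (use Suc.prems i in auto)
  have "cmod (u x - u (q j)) \<le> 5 * sqrt (3 / 5 * B) + sqrt B"
    using norm_triangle_ineq[of "u x - u (q i)" "u (q i) - u (q j)"] 1 2 by simp
  also have "sqrt (3 / 5 * B) \<le> sqrt ((4 / 5)\<^sup>2 * B)" using B by (simp add: power2_eq_square)
  also have "sqrt ((4 / 5)\<^sup>2 * B) = 4 / 5 * sqrt B" by (simp add: real_sqrt_mult)
  finally show ?case by simp
qed

lemma vertex_dense: "x \<in> SG \<Longrightarrow> \<exists>y\<in>V n. dist x y \<le> 2 / 2 ^ n"
proof (induction n arbitrary: x)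
  case 0
  have "norm x \<le> 1" using 0 SG_subset_triangle triangle_norm by blast
  then have "dist x (q 0) \<le> 2" using norm_triangle_ineq4[of x "q 0"] by (simp add: dist_norm norm_q)
  then show ?case by (auto simp: V0_eq)
next
  case (Suc n)
  obtain i y where i: "i < 3" "y \<in> SG" "x = F i y" using Suc.prems by (rule SG_cases)
  obtain z where z: "z \<in> V n" "dist y z \<le> 2 / 2 ^ n" using Suc.IH i by blast
  have "F i z \<in> V (Suc n)" using z i by auto
  moreover have "dist x (F i z) \<le> 2 / 2 ^ Suc n" using z i by (simp add: dist_F)
  ultimately show ?case by blast
qed

lemma oscillation_q:
  assumes u: "continuous_on SG u" and B: "\<And>k. en k u \<le> B" and x: "x \<in> SG" and j: "j < 3"
  shows "cmod (u x - u (q j)) \<le> 5 * sqrt B"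
proof -
  obtain y where y: "\<And>n. y n \<in> V n" "\<And>n. dist x (y n) \<le> 2 / 2 ^ n" using vertex_dense[OF x] by metis
  have "(\<lambda>n. dist (y n) x) \<longlonglongrightarrow> 0"
  proof (rule tendsto_sandwich)
    show "\<forall>\<^sub>F n in sequentially. dist (y n) x \<le> 2 / 2 ^ n"
      using y(2) by (intro always_eventually allI) (simp add: dist_commute)
    show "\<forall>\<^sub>F n in sequentially. 0 \<le> dist (y n) x" by simp
    show "(\<lambda>n. 2 / 2 ^ n) \<longlonglongrightarrow> (0::real)" by (rule LIMSEQ_divide_realpow_zero) simp
  qed (rule tendsto_const)
  then have "y \<longlonglongrightarrow> x" by (rule tendsto_dist_iff[THEN iffD2])
  moreover have "\<forall>\<^sub>F n in sequentially. y n \<in> SG"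
    using y(1) V_subset_SG by (intro always_eventually allI) blast
  ultimately have "(\<lambda>n. u (y n)) \<longlonglongrightarrow> u x"
    by (rule continuous_on_tendsto_compose[OF u _ x])
  then have "(\<lambda>n. cmod (u (y n) - u (q j))) \<longlonglongrightarrow> cmod (u x - u (q j))" by (intro tendsto_intros)
  then show ?thesis
    by (rule LIMSEQ_le_const2) (use vertex_oscillation[OF B y(1) j] in auto)
qed

lemma continuous_comp_F: "continuous_on SG u \<Longrightarrow> i < 3 \<Longrightarrow> continuous_on SG (u \<circ> F i)"
  by (rule continuous_on_compose[OF continuous_on_F])
    (auto intro: continuous_on_subset F_SG)

lemma cell_Nil [simp]: "cell [] = SG" and cell_Cons [simp]: "cell (i # w) = F i ` cell w"
  by (auto simp: cell_def)

text \<open>Each letter of the word gains a factor 3/5 in energy; 10 is twice the constant 5, as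
  both points are compared with \<open>q 0\<close>.\<close>

lemma cell_oscillation:
  assumes "continuous_on SG u" "\<And>k. en k u \<le> B" "set w \<subseteq> {..<3}" "x \<in> cell w" "y \<in> cell w"
  shows "cmod (u x - u y) \<le> 10 * sqrt ((3 / 5) ^ length w * B)"
  using assms
proof (induction w arbitrary: u B x y)
  case Nil
  have "cmod (u x - u (q 0)) \<le> 5 * sqrt B" "cmod (u y - u (q 0)) \<le> 5 * sqrt B"
    using Nil(3-5) by (auto intro!: oscillation_q[OF Nil(1,2)])
  then show ?case using norm_triangle_ineq4[of "u x - u (q 0)" "u y - u (q 0)"] by simp
next
  case (Cons i w)
  then obtain x' y' where x': "x' \<in> cell w" "y' \<in> cell w" "x = F i x'" "y = F i y'" by auto
  have "cmod ((u \<circ> F i) x' - (u \<circ> F i) y') \<le> 10 * sqrt ((3 / 5) ^ length w * (3 / 5 * B))"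
    using Cons.prems x' by (intro Cons.IH continuous_comp_F en_comp_F_le) auto
  then show ?case using x' by (simp add: mult_ac)
qed

section \<open>Words and cells\<close>

definition words :: "nat \<Rightarrow> nat list set" where
  "words m = {w. set w \<subseteq> {..<3} \<and> length w = m}"

lemma finite_words: "finite (words m)" and card_words: "card (words m) = 3 ^ m"
  unfolding words_def using finite_lists_length_eq[of "{..<3::nat}"] card_lists_length_eq[of "{..<3::nat}"] by auto

lemma words_0: "words 0 = {[]}"
  by (auto simp: words_def)

lemma words_Suc: "words (Suc m) = (\<Union>i<3. (#) i ` words m)"
  by (auto simp: words_def length_Suc_conv)

lemma compact_cell: "compact (cell w)"
  by (induction w) (auto intro: compact_SG compact_continuous_image continuous_on_F)

lemma cell_subset_SG: "set w \<subseteq> {..<3} \<Longrightarrow> cell w \<subseteq> SG"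
  using F_SG by (induction w) auto

lemma SG_cells: "(\<Union>w\<in>words m. cell w) = SG"
proof (induction m)
  case (Suc m)
  have "(\<Union>w\<in>words (Suc m). cell w) = (\<Union>i<3. F i ` (\<Union>w\<in>words m. cell w))"
    by (auto simp: words_Suc)
  then show ?case using Suc SG_hutchinson by (simp add: hutchinson_def)
qed (auto simp: words_0)

lemma cell_diameter: "x \<in> cell w \<Longrightarrow> y \<in> cell w \<Longrightarrow> dist x y \<le> 2 / 2 ^ length w"
proof (induction w arbitrary: x y)
  case Nil
  then have "norm x \<le> 1" "norm y \<le> 1" using SG_subset_triangle triangle_norm by auto
  then show ?case using norm_triangle_ineq4[of x y] by (simp add: dist_norm)
next
  case (Cons i w)
  then obtain x' y' where x': "x' \<in> cell w" "y' \<in> cell w" "x = F i x'" "y = F i y'" by auto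
  then show ?case using Cons.IH[OF x'(1,2)] by (simp add: dist_F)
qed

lemma small_cells:
  fixes e :: real assumes "0 < e" shows "\<exists>n. 2 / 2 ^ n < e"
proof -
  obtain n where "2 / e < 2 ^ n" using real_arch_pow[of 2 "2 / e"] by auto
  then show ?thesis using assms by (auto simp: field_simps)
qed

text \<open>Cells are closed and a junction point belongs to several of them, so the ball is chosen
  to avoid the finitely many cells of level m that do not contain \<open>x\<close>.\<close>

lemma cells_near:
  assumes x: "x \<in> SG"
  obtains d where "0 < d" "\<And>y. y \<in> SG \<Longrightarrow> dist x y < d \<Longrightarrow> \<exists>w\<in>words m. x \<in> cell w \<and> y \<in> cell w"
proof -
  let ?C = "\<Union>w\<in>{w \<in> words m. x \<notin> cell w}. cell w"
  have "closed ?C" using finite_words compact_cell by (intro closed_UN) (auto intro: compact_imp_closed)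
  then have "open (- ?C)" by (simp only: open_Compl)
  moreover have "x \<in> - ?C" by auto
  ultimately obtain d where d: "0 < d" "ball x d \<subseteq> - ?C"
    unfolding open_contains_ball by blast
  show ?thesis
  proof (rule that[OF d(1)])
    fix y assume y: "y \<in> SG" "dist x y < d"
    then obtain w where "w \<in> words m" "y \<in> cell w" using SG_cells[of m] by blast
    then show "\<exists>w\<in>words m. x \<in> cell w \<and> y \<in> cell w" using d(2) y by (auto simp: subset_iff)
  qed
qed

section \<open>The self-similar measure\<close>

text \<open>The point reached by the infinite composition of \<open>F (s 0)\<close>,
  \<open>F (s 1)\<close> and so on: a binary expansion with vertices as digits. Independent uniform
  digits then realise the self-similar measure.\<close>

definition coding :: "(nat \<Rightarrow> nat) \<Rightarrow> complex" where
  "coding s = (\<Sum>n. q (s n) / 2 ^ Suc n)"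

lemma summable_coding: "summable (\<lambda>n. q (s n) / 2 ^ Suc n)"
proof (rule summable_comparison_test')
  have "summable (\<lambda>n. (1 / 2 :: real) ^ n)" by (simp add: summable_geometric_iff)
  then show "summable (\<lambda>n. (1 / 2 :: real) ^ Suc n)" by (rule summable_Suc_iff[THEN iffD2])
  show "norm (q (s n) / 2 ^ Suc n) \<le> (1 / 2) ^ Suc n" for n
    by (simp only: norm_divide norm_q norm_power norm_numeral power_one_over)
qed

lemma coding_case_nat: "coding (case_nat i s) = F i (coding s)"
proof -
  have "coding (case_nat i s) = q i / 2 + (\<Sum>n. q (s n) / 2 ^ Suc n / 2)"
    unfolding coding_def using suminf_split_head[OF summable_coding[of "case_nat i s"]]
    by (simp add: algebra_simps)
  also have "\<dots> = q i / 2 + coding s / 2"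
    unfolding coding_def suminf_divide[OF summable_coding] ..
  finally show ?thesis by (simp add: F_def)
qed

lemma coding_bounded: "norm (coding s) \<le> 1"
proof -
  have half: "(\<lambda>n. (1 / 2 :: real) ^ Suc n) sums 1" by (rule power_half_series)
  have "norm (coding s) \<le> (\<Sum>n. (1 / 2 :: real) ^ Suc n)"
    unfolding coding_def
    by (rule norm_suminf_le)
      (use half in \<open>auto simp: sums_iff norm_divide norm_q norm_power power_one_over\<close>)
  then show ?thesis using half by (simp add: sums_iff)
qed

lemma coding_SG: "(\<And>n. s n < 3) \<Longrightarrow> coding s \<in> SG"
proof -
  assume s: "\<And>n. s n < 3"
  have "coding ` {s. \<forall>n. s n < 3} \<subseteq> SG"
  proof (rule subset_of_contraction)
    show "bounded (coding ` {s. \<forall>n. s n < 3})" using coding_bounded by (auto simp: bounded_iff)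
    show "coding ` {s. \<forall>n. s n < 3} \<subseteq> hutchinson (coding ` {s. \<forall>n. s n < 3})"
    proof
      fix x assume "x \<in> coding ` {s. \<forall>n. s n < 3}"
      then obtain s where s: "\<forall>n. s n < 3" "x = coding s" by auto
      have "s = case_nat (s 0) (\<lambda>n. s (Suc n))" by (auto split: nat.split)
      then have "x = F (s 0) (coding (\<lambda>n. s (Suc n)))" using coding_case_nat s by metis
      then show "x \<in> hutchinson (coding ` {s. \<forall>n. s n < 3})" using s by (auto simp: hutchinson_def)
    qed
  qed (use SG_nonempty SG_hutchinson compact_SG in \<open>auto intro: compact_imp_closed\<close>)
  then show ?thesis using s by auto
qed

abbreviation digit :: "nat measure" where "digit \<equiv> uniform_count_measure {..<3}"

interpretation digit: prob_space digit
  by (rule prob_space_uniform_count_measure) (auto simp: lessThan_3)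

interpretation digits: sequence_space digit
  by unfold_locales

lemma space_digits: "s \<in> space digits.S \<Longrightarrow> s n < 3"
  by (auto simp: space_PiM space_uniform_count_measure PiE_iff)

lemma measurable_coding [measurable]: "coding \<in> borel_measurable digits.S"
proof -
  have [measurable]: "q \<in> borel_measurable digit"
    by (auto simp: measurable_def space_uniform_count_measure sets_uniform_count_measure)
  show ?thesis unfolding coding_def by measurable
qed

definition coding_measure :: "complex measure" where
  "coding_measure = distr digits.S borel coding"

lemma sets_coding_measure: "sets coding_measure = sets borel"
  by (simp add: coding_measure_def)

interpretation coding_measure: prob_space coding_measure
  unfolding coding_measure_def by (rule digits.prob_space_distr) measurable

lemma measurable_F [measurable]: "F i \<in> borel_measurable borel"
  unfolding F_def by measurable

text \<open>The first digit is split off: it is uniform and independent of the remaining ones, which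
  again have the law of the whole sequence.\<close>

lemma nn_integral_coding_measure_selfsimilar:
  assumes [measurable]: "f \<in> borel_measurable borel"
  shows "(\<integral>\<^sup>+x. f x \<partial>coding_measure) = (\<Sum>i<3. (1/3) * (\<integral>\<^sup>+x. f (F i x) \<partial>coding_measure))"
proof -
  have push: "(\<integral>\<^sup>+s. f (F i (coding s)) \<partial>digits.S) = (\<integral>\<^sup>+x. f (F i x) \<partial>coding_measure)" for i
    unfolding coding_measure_def by (rule nn_integral_distr[symmetric]) measurable
  have "(\<integral>\<^sup>+x. f x \<partial>coding_measure) = (\<integral>\<^sup>+s. f (coding s) \<partial>digits.S)"
    unfolding coding_measure_def by (rule nn_integral_distr) measurable
  also have "\<dots> = (\<integral>\<^sup>+s. f (coding s) \<partial>distr (digit \<Otimes>\<^sub>M digits.S) digits.S (\<lambda>(i, s). case_nat i s))"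
    by (simp only: digits.PiM_iter)
  also have "\<dots> = (\<integral>\<^sup>+z. f (coding (case z of (i, s) \<Rightarrow> case_nat i s)) \<partial>(digit \<Otimes>\<^sub>M digits.S))"
    by (rule nn_integral_distr) measurable
  also have "\<dots> = (\<integral>\<^sup>+i. \<integral>\<^sup>+s. f (coding (case_nat i s)) \<partial>digits.S \<partial>digit)"
    by (subst digits.nn_integral_fst[symmetric]) auto
  also have "\<dots> = (\<integral>\<^sup>+i. \<integral>\<^sup>+s. f (F i (coding s)) \<partial>digits.S \<partial>digit)"
    by (simp only: coding_case_nat)
  also have "\<dots> = (\<Sum>i<3. ennreal (1/3) * (\<integral>\<^sup>+s. f (F i (coding s)) \<partial>digits.S))"
    unfolding uniform_count_measure_def by (subst nn_integral_point_measure_finite) auto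
  also have "ennreal (1/3) = 1/3"
    by (metis ennreal_1 ennreal_divide_numeral zero_le_one)
  finally show ?thesis unfolding push .
qed

lemma ennreal_third: "(1 / 3 :: ennreal) = ennreal (1/3)"
  by (metis ennreal_1 ennreal_divide_numeral zero_le_one)

lemma measure_coding_measure_selfsimilar:
  assumes [measurable]: "A \<in> sets borel"
  shows "measure coding_measure A = (\<Sum>i<3. measure coding_measure (F i -` A)) / 3"
proof -
  have m: "F i -` A \<in> sets borel" for i
    using measurable_sets[OF measurable_F[of i] assms] by simp
  have "emeasure coding_measure A = (\<integral>\<^sup>+x. indicator A x \<partial>coding_measure)"
    using assms by (simp add: sets_coding_measure)
  also have "\<dots> = (\<Sum>i<3. (1/3) * (\<integral>\<^sup>+x. indicator A (F i x) \<partial>coding_measure))"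
    by (rule nn_integral_coding_measure_selfsimilar) measurable
  also have "\<dots> = (\<Sum>i<3. (1/3) * (\<integral>\<^sup>+x. indicator (F i -` A) x \<partial>coding_measure))"
    by (simp add: indicator_def)
  also have "\<dots> = (\<Sum>i<3. (1/3) * emeasure coding_measure (F i -` A))"
    using m by (simp add: sets_coding_measure)
  also have "\<dots> = (\<Sum>i<3. ennreal (1/3 * measure coding_measure (F i -` A)))"
    unfolding coding_measure.emeasure_eq_measure ennreal_third
    by (intro sum.cong refl ennreal_mult'[symmetric]) simp
  also have "\<dots> = ennreal (\<Sum>i<3. 1/3 * measure coding_measure (F i -` A))"
    by (rule sum_ennreal) simp
  finally show ?thesis
    by (simp add: coding_measure.emeasure_eq_measure sum_nonneg sum_divide_distrib)
qed

lemma borel_SG [measurable]: "SG \<in> sets borel" and borel_cell [measurable]: "cell w \<in> sets borel"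
  using compact_SG compact_cell by (auto intro: borel_closed compact_imp_closed)

lemma measure_coding_measure_SG: "measure coding_measure SG = 1"
proof -
  have "measure coding_measure SG = measure digits.S (coding -` SG \<inter> space digits.S)"
    unfolding coding_measure_def by (rule measure_distr) measurable
  also have "coding -` SG \<inter> space digits.S = space digits.S"
    using coding_SG space_digits by auto
  finally show ?thesis
    using prob_space.prob_space[OF prob_space_PiM[of UNIV "\<lambda>_. digit"]] digit.prob_space_axioms by simp
qed

lemma coding_measure_outside:
  assumes "A \<in> sets borel" "A \<inter> SG = {}" shows "measure coding_measure A = 0"
proof -
  have "measure coding_measure (A \<union> SG) = measure coding_measure A + measure coding_measure SG"
    using assms by (intro coding_measure.finite_measure_Union) (auto simp: sets_coding_measure)
  then show ?thesis using coding_measure.prob_le_1[of "A \<union> SG"] measure_coding_measure_SG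
    by (simp add: measure_le_0_iff)
qed

lemma vimage_F_singleton: "F i -` {x} = {2 * x - q i}"
  by (auto simp: F_def field_simps)

text \<open>Let \<open>a\<close> be the supremum of the point masses. No point lies in all three
  cells, so at least one of its three preimages is outside the gasket and carries no mass;
  self-similarity then bounds every point mass by 2/3 of \<open>a\<close>, whence
  \<open>a = 0\<close>.\<close>

lemma measure_coding_measure_singleton: "measure coding_measure {x} = 0"
proof -
  define a where "a = (SUP x. measure coding_measure {x})"
  have bdd: "bdd_above (range (\<lambda>x. measure coding_measure {x}))"
    by (intro bdd_aboveI[of _ 1]) auto
  have up: "measure coding_measure {x} \<le> a" for x
    unfolding a_def using bdd by (intro cSUP_upper) auto
  have a: "0 \<le> a" using order_trans[OF measure_nonneg up] .
  have "measure coding_measure {x} \<le> 2 / 3 * a" for x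
  proof -
    have "\<exists>i<3. 2 * x - q i \<notin> SG"
    proof (rule ccontr)
      assume "\<not> ?thesis"
      then have "2 * x - q i \<in> SG" if "i < 3" for i using that by blast
      moreover have "F i (2 * x - q i) = x" for i by (simp add: F_def field_simps)
      ultimately have x: "x \<in> F i ` SG" if "i < 3" for i by (metis imageI that)
      have "x = F 0 (q 1)" "x = F 0 (q 2)"
        using F_image_Int[of 0 1 x] F_image_Int[of 0 2 x] x by auto
      then show False using q_eq_iff[of 1 2] by simp
    qed
    then obtain i where i: "i < 3" "2 * x - q i \<notin> SG" by blast
    have "measure coding_measure {x} = (\<Sum>j<3. measure coding_measure {2 * x - q j}) / 3"
      using measure_coding_measure_selfsimilar[of "{x}"] by (simp add: vimage_F_singleton)
    also have "(\<Sum>j<3. measure coding_measure {2 * x - q j}) = (\<Sum>j\<in>{..<3} - {i}. measure coding_measure {2 * x - q j})"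
      using i coding_measure_outside[of "{2 * x - q i}"] by (subst sum.remove[of _ i]) auto
    also have "\<dots> \<le> (\<Sum>j\<in>{..<3} - {i}. a)" using up by (intro sum_mono) auto
    also have "\<dots> = 2 * a" using i by simp
    finally show ?thesis by simp
  qed
  then have "a \<le> 2 / 3 * a" unfolding a_def[symmetric] by (subst a_def, intro cSUP_least) auto
  then have "a = 0" using a by simp
  then show ?thesis using up[of x] by (simp add: measure_le_0_iff)
qed

lemma measure_coding_measure_cell:
  assumes "set w \<subseteq> {..<3}" shows "measure coding_measure (cell w) = (1 / 3) ^ length w"
  using assms
proof (induction w)
  case Nil
  then show ?case using measure_coding_measure_SG by simp
next
  case (Cons i w)
  \<comment> \<open>The preimage of the cell under another map meets the gasket at most in the
    junction point \<open>q i\<close>, and points have measure zero.\<close>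
  have other: "measure coding_measure (F j -` cell (i # w)) = 0" if j: "j < 3" "j \<noteq> i" for j
  proof -
    let ?A = "F j -` cell (i # w)"
    have m: "?A \<in> sets borel"
      using measurable_sets[OF measurable_F[of j] borel_cell[of "i # w"]] by simp
    have "?A \<inter> SG \<subseteq> {q i}"
    proof
      fix y assume y: "y \<in> ?A \<inter> SG"
      have "F j y \<in> F i ` SG" using y cell_subset_SG[of w] Cons.prems by auto
      then have "F j y = F j (q i)" using F_image_Int[of j i "F j y"] y j Cons.prems by auto
      then show "y \<in> {q i}" by simp
    qed
    then have "measure coding_measure (?A \<inter> SG) \<le> measure coding_measure {q i}"
      by (intro coding_measure.finite_measure_mono) (auto simp: sets_coding_measure)
    then have "measure coding_measure (?A \<inter> SG) = 0"
      by (simp add: measure_coding_measure_singleton measure_le_0_iff)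
    moreover have "measure coding_measure (?A - SG) = 0"
      using m by (intro coding_measure_outside) auto
    moreover have "measure coding_measure ?A \<le> measure coding_measure ((?A \<inter> SG) \<union> (?A - SG))"
      using m by (intro coding_measure.finite_measure_mono) (auto simp: sets_coding_measure)
    moreover have "\<dots> \<le> measure coding_measure (?A \<inter> SG) + measure coding_measure (?A - SG)"
      using m by (intro measure_Un_le) (auto simp: sets_coding_measure)
    ultimately show ?thesis by (simp add: measure_le_0_iff)
  qed
  have "F i -` cell (i # w) = cell w" by auto
  then have "(\<Sum>j<3. measure coding_measure (F j -` cell (i # w))) = measure coding_measure (cell w)"
    using Cons.prems other by (subst sum.remove[of _ i]) auto
  then show ?case using measure_coding_measure_selfsimilar[OF borel_cell[of "i # w"]] Cons by simp
qed

section \<open>Uniqueness of the measure\<close>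

definition gasket_measure :: "complex measure \<Rightarrow> bool" where
  "gasket_measure M \<longleftrightarrow> sets M = sets borel \<and> prob_space M \<and>
    (\<forall>w. set w \<subseteq> {..<3} \<longrightarrow> measure M (cell w) = (1 / 3) ^ length w)"

lemma cell_snoc: "cell w = (\<Union>i<3. cell (w @ [i]))"
  by (induction w) (use SG_hutchinson in \<open>auto simp: hutchinson_def\<close>)

text \<open>The cells of one level overlap, but the upper bounds for \<open>J\<close> and for its
  complement add up to the total mass 1; so both are attained, without any knowledge of the
  overlaps.\<close>

lemma gasket_measure_cells:
  assumes M: "gasket_measure M" and J: "J \<subseteq> words m"
  shows "measure M (\<Union>w\<in>J. cell w) = real (card J) / 3 ^ m"
proof -
  interpret prob_space M using M by (simp add: gasket_measure_def)
  have mc: "measure M (cell w) = (1/3) ^ m" if "w \<in> words m" for w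
    using M that by (auto simp: gasket_measure_def words_def)
  have sM: "sets M = sets borel" using M by (simp add: gasket_measure_def)
  have fin: "finite J" using J finite_words finite_subset by blast
  have upper: "measure M (\<Union>w\<in>J'. cell w) \<le> real (card J') / 3 ^ m" if "J' \<subseteq> words m" for J'
  proof -
    have "finite J'" using that finite_words finite_subset by blast
    then have "measure M (\<Union>w\<in>J'. cell w) \<le> (\<Sum>w\<in>J'. measure M (cell w))"
      by (intro finite_measure_subadditive_finite) (auto simp: sM)
    also have "\<dots> = (\<Sum>w\<in>J'. (1/3) ^ m)" using that mc by (intro sum.cong) auto
    finally show ?thesis by (simp add: power_one_over)
  qed
  have "1 = measure M SG" using M by (auto simp: gasket_measure_def dest: spec[of _ "[]"])
  also have "SG = (\<Union>w\<in>J. cell w) \<union> (\<Union>w\<in>words m - J. cell w)" using SG_cells[of m] J by blast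
  also have "measure M \<dots> \<le> measure M (\<Union>w\<in>J. cell w) + measure M (\<Union>w\<in>words m - J. cell w)"
    using fin finite_words by (intro measure_Un_le) (auto simp: sM intro!: sets.finite_UN)
  also have "measure M (\<Union>w\<in>words m - J. cell w) \<le> real (card (words m - J)) / 3 ^ m"
    by (rule upper) auto
  also have "real (card (words m - J)) = 3 ^ m - real (card J)"
    using J fin card_mono[OF finite_words J] by (simp add: card_Diff_subset card_words of_nat_diff)
  finally have "real (card J) / 3 ^ m \<le> measure M (\<Union>w\<in>J. cell w)" by (simp add: diff_divide_distrib)
  then show ?thesis using upper[OF J] by simp
qed

text \<open>Within the gasket an open set is the increasing union of the cells it contains, so the
  prescribed cell masses determine the measure of every open set, and open sets generate.\<close>

lemma gasket_measure_unique:
  assumes M: "gasket_measure M" and N: "gasket_measure N"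
  shows "M = N"
proof -
  have open_eq: "measure M U = measure N U" if U: "open U" for U
  proof -
    define J where "J m = {w \<in> words m. cell w \<subseteq> U}" for m
    define A where "A m = (\<Union>w\<in>J m. cell w)" for m
    have inc: "incseq A"
    proof (rule incseq_SucI, rule subsetI)
      fix m x assume "x \<in> A m"
      then obtain w where w: "w \<in> words m" "cell w \<subseteq> U" "x \<in> cell w" by (auto simp: A_def J_def)
      then obtain i where i: "i < 3" "x \<in> cell (w @ [i])" using cell_snoc[of w] by auto
      have "w @ [i] \<in> words (Suc m)" using w i by (auto simp: words_def)
      moreover have "cell (w @ [i]) \<subseteq> U" using w i cell_snoc[of w] by auto
      ultimately show "x \<in> A (Suc m)" using i by (auto simp: A_def J_def)
    qed
    have UN: "(\<Union>m. A m) = U \<inter> SG"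
    proof
      show "(\<Union>m. A m) \<subseteq> U \<inter> SG"
        using cell_subset_SG by (fastforce simp: A_def J_def words_def)
      show "U \<inter> SG \<subseteq> (\<Union>m. A m)"
      proof
        fix x assume x: "x \<in> U \<inter> SG"
        then obtain e where e: "0 < e" "ball x e \<subseteq> U" using U open_contains_ball by blast
        obtain m where m: "2 / 2 ^ m < e" using small_cells[OF e(1)] by blast
        obtain w where w: "w \<in> words m" "x \<in> cell w" using x SG_cells[of m] by blast
        have "cell w \<subseteq> ball x e"
          using cell_diameter[OF w(2)] m w(1) by (fastforce simp: words_def)
        then show "x \<in> (\<Union>m. A m)" using w e by (auto simp: A_def J_def)
      qed
    qed
    have lim: "measure K U = lim (\<lambda>m. real (card (J m)) / 3 ^ m)" if K: "gasket_measure K" for K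
    proof -
      interpret K: prob_space K using K by (simp add: gasket_measure_def)
      have sK: "sets K = sets borel" using K by (simp add: gasket_measure_def)
      have Um: "U \<in> sets K" using U sK by simp
      have "A m \<in> sets K" for m
        unfolding A_def J_def sK using finite_words by (intro sets.finite_UN) auto
      then have "(\<lambda>m. measure K (A m)) \<longlonglongrightarrow> measure K (U \<inter> SG)"
        using K.finite_Lim_measure_incseq[OF _ inc] UN by auto
      moreover have "measure K (A m) = real (card (J m)) / 3 ^ m" for m
        unfolding A_def by (rule gasket_measure_cells[OF K]) (auto simp: J_def)
      moreover have "measure K (U \<inter> SG) = measure K U"
      proof -
        have "measure K SG = 1" using K by (auto simp: gasket_measure_def dest: spec[of _ "[]"])
        then have "AE x in K. x \<in> SG" using sK by (subst K.AE_in_set_eq_1) auto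
        then show ?thesis using Um sK by (intro measure_eq_AE) auto
      qed
      ultimately show ?thesis by (simp add: limI)
    qed
    show ?thesis using lim[OF M] lim[OF N] by simp
  qed
  interpret M: prob_space M using M by (simp add: gasket_measure_def)
  interpret N: prob_space N using N by (simp add: gasket_measure_def)
  show ?thesis
  proof (rule measure_eqI_generator_eq[where \<Omega> = UNIV and E = "{S. open S}" and A = "\<lambda>_. UNIV"])
    show "sets M = sigma_sets UNIV {S. open S}" "sets N = sigma_sets UNIV {S. open S}"
      using M N by (auto simp: gasket_measure_def sets_borel)
    show "emeasure M X = emeasure N X" if "X \<in> {S. open S}" for X
      using open_eq that by (simp add: M.emeasure_eq_measure N.emeasure_eq_measure)
  qed (auto simp: Int_stable_def)
qed

lemma gasket_measure_coding_measure: "gasket_measure coding_measure"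
  using measure_coding_measure_cell sets_coding_measure coding_measure.prob_space_axioms
  by (simp add: gasket_measure_def)

lemma \<mu>_eq: "\<mu> = coding_measure"
  unfolding \<mu>_def
proof (rule the_equality)
  fix M assume "sets M = sets borel \<and> prob_space M \<and> (\<forall>w. set w \<subseteq> {..<3} \<longrightarrow> measure M (cell w) = (1 / 3) ^ length w)"
  then show "M = coding_measure"
    by (intro gasket_measure_unique gasket_measure_coding_measure) (simp add: gasket_measure_def)
qed (use gasket_measure_coding_measure in \<open>simp add: gasket_measure_def\<close>)

lemma gasket_measure_\<mu>: "gasket_measure \<mu>"
  unfolding \<mu>_eq by (rule gasket_measure_coding_measure)

lemma sets_\<mu> [simp, measurable_cong]: "sets \<mu> = sets borel"
  unfolding \<mu>_eq by (rule sets_coding_measure)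

lemma space_\<mu> [simp]: "space \<mu> = UNIV"
  using sets_eq_imp_space_eq[OF sets_\<mu>] by simp

interpretation \<mu>: prob_space \<mu>
  using gasket_measure_\<mu> by (simp add: gasket_measure_def)

lemma measure_\<mu>_cell: "set w \<subseteq> {..<3} \<Longrightarrow> measure \<mu> (cell w) = (1 / 3) ^ length w"
  using gasket_measure_\<mu> by (simp add: gasket_measure_def)

lemma AE_SG: "AE x in \<mu>. x \<in> SG"
  using measure_\<mu>_cell[of "[]"] by (subst \<mu>.AE_in_set_eq_1) auto

lemma nn_integral_\<mu>_selfsimilar:
  "f \<in> borel_measurable borel \<Longrightarrow> (\<integral>\<^sup>+x. f x \<partial>\<mu>) = (\<Sum>i<3. (1/3) * (\<integral>\<^sup>+x. f (F i x) \<partial>\<mu>))"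
  unfolding \<mu>_eq by (rule nn_integral_coding_measure_selfsimilar)

section \<open>The energy form\<close>

lemma energy_approx_en: "energy_approx m u u = of_real (en m u)"
proof -
  have "(\<Sum>(x, y)\<in>edges m. (u x - u y) * cnj (u x - u y)) = of_real (\<Sum>(x, y)\<in>edges m. (cmod (u x - u y))\<^sup>2)"
    unfolding of_real_sum by (intro sum.cong refl) (auto simp only: complex_norm_square)
  then show ?thesis by (simp add: energy_approx_def en_def)
qed

lemma en_convergent_iff: "convergent (\<lambda>m. en m u) \<longleftrightarrow> (\<exists>B. \<forall>m. en m u \<le> B)"
proof
  assume "convergent (\<lambda>m. en m u)"
  then have "Bseq (\<lambda>m. en m u)" by (rule convergent_imp_Bseq)
  then obtain B where "\<And>m. norm (en m u) \<le> B" by (auto simp: Bseq_def)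
  then have "\<forall>m. en m u \<le> B" by (metis abs_le_D1 real_norm_def)
  then show "\<exists>B. \<forall>m. en m u \<le> B" by blast
next
  assume "\<exists>B. \<forall>m. en m u \<le> B"
  then obtain B where "\<And>m. en m u \<le> B" by blast
  moreover have "incseq (\<lambda>m. en m u)" by (simp add: incseq_def en_mono)
  ultimately obtain L where "(\<lambda>m. en m u) \<longlonglongrightarrow> L" using incseq_convergent[of "\<lambda>m. en m u" B] by metis
  then show "convergent (\<lambda>m. en m u)" by (rule convergentI)
qed

lemma energy_approx_convergent_iff: "convergent (\<lambda>m. energy_approx m u u) \<longleftrightarrow> (\<exists>B. \<forall>m. en m u \<le> B)"
proof -
  have "convergent (\<lambda>m. energy_approx m u u) \<longleftrightarrow> convergent (\<lambda>m. en m u)"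
    unfolding energy_approx_en
  proof
    assume "convergent (\<lambda>m. complex_of_real (en m u))"
    then obtain L where "(\<lambda>m. complex_of_real (en m u)) \<longlonglongrightarrow> L" by (auto simp: convergent_def)
    then have "(\<lambda>m. Re (complex_of_real (en m u))) \<longlonglongrightarrow> Re L" by (rule tendsto_Re)
    then show "convergent (\<lambda>m. en m u)" by (auto simp: convergent_def)
  qed (auto simp: convergent_def intro: tendsto_of_real)
  then show ?thesis by (simp add: en_convergent_iff)
qed

text \<open>Continuity together with vanishing off the gasket makes the inner product definite on
  functions themselves, without passing to classes.\<close>

definition gasket_functions :: "(complex \<Rightarrow> complex) set" where
  "gasket_functions = {u. continuous_on SG u \<and> (\<forall>x. x \<notin> SG \<longrightarrow> u x = 0)}"

lemma form_domain_iff: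
  "u \<in> form_domain bc \<longleftrightarrow> u \<in> gasket_functions \<and> (\<exists>B. \<forall>m. en m u \<le> B) \<and> (bc = Dirichlet \<longrightarrow> (\<forall>x\<in>V0. u x = 0))"
  by (auto simp: form_domain_def gasket_functions_def energy_approx_convergent_iff)

lemma form_domain_gasket: "u \<in> form_domain bc \<Longrightarrow> u \<in> gasket_functions"
  by (simp add: form_domain_iff)

lemma gasket_functions_subspace: "cfun.subspace gasket_functions"
  by (rule cfun.subspaceI)
    (auto simp: gasket_functions_def cscale_def plus_fun_def zero_fun_def intro!: continuous_intros)

lemma cmod_add_squared_le: "(cmod (a + b))\<^sup>2 \<le> 2 * (cmod a)\<^sup>2 + 2 * (cmod b)\<^sup>2"
proof -
  have "(cmod (a + b))\<^sup>2 \<le> (cmod a + cmod b)\<^sup>2" by (intro power_mono norm_triangle_ineq) auto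
  also have "\<dots> \<le> 2 * (cmod a)\<^sup>2 + 2 * (cmod b)\<^sup>2"
    using zero_le_power2[of "cmod a - cmod b"] by (simp add: power2_eq_square algebra_simps)
  finally show ?thesis .
qed

lemma en_add_le: "en m (u + v) \<le> 2 * en m u + 2 * en m v"
proof -
  have "(\<Sum>(x, y)\<in>edges m. (cmod ((u + v) x - (u + v) y))\<^sup>2)
      \<le> (\<Sum>(x, y)\<in>edges m. 2 * (cmod (u x - u y))\<^sup>2 + 2 * (cmod (v x - v y))\<^sup>2)"
  proof (rule sum_mono)
    fix e assume "e \<in> edges m"
    show "(case e of (x, y) \<Rightarrow> (cmod ((u + v) x - (u + v) y))\<^sup>2)
      \<le> (case e of (x, y) \<Rightarrow> 2 * (cmod (u x - u y))\<^sup>2 + 2 * (cmod (v x - v y))\<^sup>2)"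
      using cmod_add_squared_le[of "u (fst e) - u (snd e)" "v (fst e) - v (snd e)"]
      by (simp add: case_prod_unfold algebra_simps)
  qed
  also have "\<dots> = 2 * (\<Sum>(x, y)\<in>edges m. (cmod (u x - u y))\<^sup>2) + 2 * (\<Sum>(x, y)\<in>edges m. (cmod (v x - v y))\<^sup>2)"
    by (simp add: case_prod_unfold sum.distrib sum_distrib_left)
  finally have "(5 / 3) ^ m / 2 * (\<Sum>(x, y)\<in>edges m. (cmod ((u + v) x - (u + v) y))\<^sup>2)
    \<le> (5 / 3) ^ m / 2 * (2 * (\<Sum>(x, y)\<in>edges m. (cmod (u x - u y))\<^sup>2) + 2 * (\<Sum>(x, y)\<in>edges m. (cmod (v x - v y))\<^sup>2))"
    by (intro mult_left_mono) auto
  then show ?thesis by (simp add: en_def algebra_simps)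
qed

lemma en_cscale: "en m (cscale c u) = (cmod c)\<^sup>2 * en m u"
proof -
  have "(\<Sum>(x, y)\<in>edges m. (cmod (c * u x - c * u y))\<^sup>2) = (cmod c)\<^sup>2 * (\<Sum>(x, y)\<in>edges m. (cmod (u x - u y))\<^sup>2)"
    unfolding sum_distrib_left right_diff_distrib[symmetric] norm_mult power_mult_distrib
    by (intro sum.cong) auto
  then show ?thesis by (simp add: en_def cscale_def)
qed

lemma form_domain_subspace: "cfun.subspace (form_domain bc)"
proof (rule cfun.subspaceI)
  show "0 \<in> form_domain bc"
    using cfun.subspace_0[OF gasket_functions_subspace]
    by (auto simp: form_domain_iff en_def zero_fun_def case_prod_unfold)
  fix u v c assume u: "u \<in> form_domain bc" and v: "v \<in> form_domain bc"
  obtain B B' where B: "\<And>m. en m u \<le> B" "\<And>m. en m v \<le> B'" using u v by (auto simp: form_domain_iff)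
  have "en m (u + v) \<le> 2 * B + 2 * B'" for m
    using en_add_le[of m u v] B[of m] by linarith
  then show "u + v \<in> form_domain bc"
    using u v by (auto simp: form_domain_iff intro: cfun.subspace_add[OF gasket_functions_subspace])
  have "en m (cscale c u) \<le> (cmod c)\<^sup>2 * B" for m
    unfolding en_cscale using B(1) by (intro mult_left_mono) auto
  then show "cscale c u \<in> form_domain bc"
    using u by (auto simp: form_domain_iff cscale_def intro: cfun.subspace_scale[OF gasket_functions_subspace, unfolded cscale_def])
qed

lemma polarization:
  "a * cnj b = (of_real ((cmod (a + b))\<^sup>2) - of_real ((cmod (a - b))\<^sup>2)
    + \<i> * of_real ((cmod (a + \<i> * b))\<^sup>2) - \<i> * of_real ((cmod (a - \<i> * b))\<^sup>2)) / 4"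
  unfolding cmod_power2 by (simp add: complex_eq_iff power2_eq_square algebra_simps)

text \<open>The mixed energy becomes a combination of four diagonal energies, each of which
  converges on the form domain.\<close>

lemma energy_approx_polarization:
  "energy_approx m u v = (of_real (en m (u + v)) - of_real (en m (u - v))
    + \<i> * of_real (en m (u + cscale \<i> v)) - \<i> * of_real (en m (u - cscale \<i> v))) / 4"
proof -
  have "(\<Sum>(x, y)\<in>edges m. (u x - u y) * cnj (v x - v y)) =
    (\<Sum>(x, y)\<in>edges m. (of_real ((cmod ((u + v) x - (u + v) y))\<^sup>2) - of_real ((cmod ((u - v) x - (u - v) y))\<^sup>2)
    + \<i> * of_real ((cmod ((u + cscale \<i> v) x - (u + cscale \<i> v) y))\<^sup>2)
    - \<i> * of_real ((cmod ((u - cscale \<i> v) x - (u - cscale \<i> v) y))\<^sup>2)) / 4)"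
    (is "_ = (\<Sum>(x, y)\<in>_. ?f x y)")
  proof (intro sum.cong refl, clarify)
    fix x y
    have "u x + v x - (u y + v y) = (u x - u y) + (v x - v y)"
      "u x - v x - (u y - v y) = (u x - u y) - (v x - v y)"
      "u x + \<i> * v x - (u y + \<i> * v y) = (u x - u y) + \<i> * (v x - v y)"
      "u x - \<i> * v x - (u y - \<i> * v y) = (u x - u y) - \<i> * (v x - v y)"
      by (auto simp: algebra_simps)
    then show "(u x - u y) * cnj (v x - v y) = ?f x y"
      using polarization[of "u x - u y" "v x - v y"] by (simp only: plus_fun_apply minus_apply cscale_def)
  qed
  also have "\<dots> = (of_real (\<Sum>(x, y)\<in>edges m. (cmod ((u + v) x - (u + v) y))\<^sup>2)
    - of_real (\<Sum>(x, y)\<in>edges m. (cmod ((u - v) x - (u - v) y))\<^sup>2)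
    + \<i> * of_real (\<Sum>(x, y)\<in>edges m. (cmod ((u + cscale \<i> v) x - (u + cscale \<i> v) y))\<^sup>2)
    - \<i> * of_real (\<Sum>(x, y)\<in>edges m. (cmod ((u - cscale \<i> v) x - (u - cscale \<i> v) y))\<^sup>2)) / 4"
    unfolding case_prod_unfold of_real_sum
    by (simp only: sum_divide_distrib[symmetric] sum_subtractf sum.distrib sum_distrib_left)
  finally have eq: "(\<Sum>(x, y)\<in>edges m. (u x - u y) * cnj (v x - v y)) = \<dots>" .
  have distrib: "c * (1 / 2) * ((s1 - s2 + \<i> * s3 - \<i> * s4) / 4)
    = (c / 2 * s1 - c / 2 * s2 + \<i> * (c / 2 * s3) - \<i> * (c / 2 * s4)) / 4" for c s1 s2 s3 s4
    by (simp add: field_simps)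
  show ?thesis
    unfolding energy_approx_def en_def eq of_real_mult of_real_divide of_real_power of_real_numeral by (rule distrib)
qed

lemma en_tendsto:
  assumes "u \<in> form_domain bc" shows "(\<lambda>m. en m u) \<longlonglongrightarrow> Re (energy u u)"
proof -
  have "convergent (\<lambda>m. energy_approx m u u)" using assms by (simp add: form_domain_def)
  then have "(\<lambda>m. energy_approx m u u) \<longlonglongrightarrow> energy u u" unfolding energy_def by (simp add: convergent_LIMSEQ_iff)
  then have "(\<lambda>m. Re (energy_approx m u u)) \<longlonglongrightarrow> Re (energy u u)" by (rule tendsto_Re)
  then show ?thesis by (simp add: energy_approx_en)
qed

lemma en_le_energy: "u \<in> form_domain bc \<Longrightarrow> en m u \<le> Re (energy u u)"
  by (rule incseq_le[OF _ en_tendsto]) (auto simp: incseq_def en_mono)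

lemma energy_approx_tendsto:
  assumes u: "u \<in> form_domain bc" and v: "v \<in> form_domain bc"
  shows "(\<lambda>m. energy_approx m u v) \<longlonglongrightarrow> energy u v"
proof -
  have conv: "\<exists>L. (\<lambda>m. en m w) \<longlonglongrightarrow> L" if "w \<in> form_domain bc" for w using en_tendsto[OF that] by blast
  note sub = cfun.subspace_add[OF form_domain_subspace u] cfun.subspace_diff[OF form_domain_subspace u]
    cfun.subspace_scale[OF form_domain_subspace v]
  obtain L1 L2 L3 L4 where "(\<lambda>m. en m (u + v)) \<longlonglongrightarrow> L1" "(\<lambda>m. en m (u - v)) \<longlonglongrightarrow> L2"
    "(\<lambda>m. en m (u + cscale \<i> v)) \<longlonglongrightarrow> L3" "(\<lambda>m. en m (u - cscale \<i> v)) \<longlonglongrightarrow> L4"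
    using conv sub v by metis
  then have "(\<lambda>m. energy_approx m u v) \<longlonglongrightarrow> (of_real L1 - of_real L2 + \<i> * of_real L3 - \<i> * of_real L4) / 4"
    unfolding energy_approx_polarization by (intro tendsto_intros) auto
  then show ?thesis unfolding energy_def by (metis limI)
qed

lemma hermitian_energy: "hermitian_form (form_domain bc) energy"
proof
  show "cfun.subspace (form_domain bc)" by (rule form_domain_subspace)
  fix u v w c assume u: "u \<in> form_domain bc" and v: "v \<in> form_domain bc"
  show "energy v u = cnj (energy u v)"
  proof (rule LIMSEQ_unique[OF energy_approx_tendsto[OF v u]])
    have "energy_approx m v u = cnj (energy_approx m u v)" for m
      by (simp add: energy_approx_def case_prod_unfold mult.commute)
    then show "(\<lambda>m. energy_approx m v u) \<longlonglongrightarrow> cnj (energy u v)"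
      using tendsto_cnj[OF energy_approx_tendsto[OF u v]] by simp
  qed
  show "energy (cscale c u) v = c * energy u v"
  proof (rule LIMSEQ_unique[OF energy_approx_tendsto[OF _ v]])
    show "cscale c u \<in> form_domain bc" using u by (rule cfun.subspace_scale[OF form_domain_subspace])
    have "energy_approx m (cscale c u) v = c * energy_approx m u v" for m
      unfolding energy_approx_def cscale_def
      by (simp add: case_prod_unfold sum_distrib_left right_diff_distrib[symmetric] mult_ac)
    then show "(\<lambda>m. energy_approx m (cscale c u) v) \<longlonglongrightarrow> c * energy u v"
      using tendsto_mult_left[OF energy_approx_tendsto[OF u v]] by simp
  qed
  assume w: "w \<in> form_domain bc"
  show "energy (u + v) w = energy u w + energy v w"
  proof (rule LIMSEQ_unique[OF energy_approx_tendsto[OF _ w]])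
    show "u + v \<in> form_domain bc" using u v by (rule cfun.subspace_add[OF form_domain_subspace])
    have "energy_approx m (u + v) w = energy_approx m u w + energy_approx m v w" for m
      unfolding energy_approx_def distrib_left[symmetric]
      by (simp add: case_prod_unfold sum.distrib[symmetric] algebra_simps)
    then show "(\<lambda>m. energy_approx m (u + v) w) \<longlonglongrightarrow> energy u w + energy v w"
      using tendsto_add[OF energy_approx_tendsto[OF u w] energy_approx_tendsto[OF v w]] by simp
  qed
qed

section \<open>The inner product\<close>

definition inner_\<mu> :: "(complex \<Rightarrow> complex) \<Rightarrow> (complex \<Rightarrow> complex) \<Rightarrow> complex" where
  "inner_\<mu> u v = (LINT x|\<mu>. u x * cnj (v x))"

lemma gasket_functions_measurable [measurable_dest]:
  assumes "u \<in> gasket_functions" shows "u \<in> borel_measurable borel"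
proof -
  have "(\<lambda>x. if x \<in> SG then u x else 0) \<in> borel_measurable borel"
    using assms borel_SG by (intro borel_measurable_continuous_on_if) (auto simp: gasket_functions_def)
  moreover have "(\<lambda>x. if x \<in> SG then u x else 0) = u" using assms by (auto simp: gasket_functions_def)
  ultimately show ?thesis by simp
qed

lemma gasket_functions_bounded:
  assumes "u \<in> gasket_functions" obtains M where "0 \<le> M" "\<And>x. cmod (u x) \<le> M"
proof -
  have "compact (u ` SG)" using assms compact_SG by (intro compact_continuous_image) (auto simp: gasket_functions_def)
  then have "bounded (u ` SG)" by (rule compact_imp_bounded)
  then obtain M where M: "\<And>x. x \<in> SG \<Longrightarrow> cmod (u x) \<le> M" by (auto simp: bounded_iff)
  have "cmod (u x) \<le> max M 0" for x
    using M[of x] assms by (cases "x \<in> SG") (auto simp: gasket_functions_def)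
  then show ?thesis using that[of "max M 0"] by simp
qed

lemma measurable_cnj: "cnj \<in> borel_measurable borel"
  by (intro borel_measurable_continuous_onI continuous_intros)

lemma integrable_mult_gasket:
  assumes u: "u \<in> gasket_functions" and v: "v \<in> gasket_functions"
  shows "integrable \<mu> (\<lambda>x. u x * cnj (v x))"
proof -
  obtain M M' where M: "0 \<le> M" "\<And>x. cmod (u x) \<le> M" "0 \<le> M'" "\<And>x. cmod (v x) \<le> M'"
    using gasket_functions_bounded u v by metis
  have [measurable]: "u \<in> borel_measurable borel" "v \<in> borel_measurable borel"
    using gasket_functions_measurable u v by auto
  show ?thesis
  proof (rule \<mu>.integrable_const_bound[of _ "M * M'"])
    show "AE x in \<mu>. cmod (u x * cnj (v x)) \<le> M * M'"
      using M by (auto simp: norm_mult intro!: mult_mono)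
    have "(\<lambda>x. cnj (v x)) \<in> borel_measurable \<mu>"
      by (rule measurable_compose[OF _ measurable_cnj]) measurable
    then show "(\<lambda>x. u x * cnj (v x)) \<in> borel_measurable \<mu>" by measurable
  qed
qed

lemma inner_diagonal: "inner_\<mu> u u = of_real (LINT x|\<mu>. (cmod (u x))\<^sup>2)"
  unfolding inner_\<mu>_def by (simp add: complex_norm_square[symmetric] del: of_real_power)

lemma integrable_square_gasket: "u \<in> gasket_functions \<Longrightarrow> integrable \<mu> (\<lambda>x. (cmod (u x))\<^sup>2)"
  using integrable_mult_gasket[of u u]
  by (simp add: complex_norm_square[symmetric] complex_of_real_integrable_eq del: of_real_power)

lemma hermitian_inner: "hermitian_form gasket_functions inner_\<mu>"
proof
  show "cfun.subspace gasket_functions" by (rule gasket_functions_subspace)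
  fix u v w c assume u: "u \<in> gasket_functions" and v: "v \<in> gasket_functions"
  show "inner_\<mu> v u = cnj (inner_\<mu> u v)"
    unfolding inner_\<mu>_def by (subst Bochner_Integration.integral_cnj[symmetric]) (simp add: mult.commute del: Bochner_Integration.integral_cnj)
  show "inner_\<mu> (cscale c u) v = c * inner_\<mu> u v"
    unfolding inner_\<mu>_def cscale_def mult.assoc by simp
  assume w: "w \<in> gasket_functions"
  show "inner_\<mu> (u + v) w = inner_\<mu> u w + inner_\<mu> v w"
    unfolding inner_\<mu>_def using integrable_mult_gasket[OF u w] integrable_mult_gasket[OF v w]
    by (simp add: distrib_right)
qed

text \<open>By continuity \<open>u\<close> stays away from zero on a whole small cell, and cells
  have positive measure.\<close>

lemma inner_pos:
  assumes u: "u \<in> gasket_functions" "u \<noteq> 0" shows "0 < Re (inner_\<mu> u u)"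
proof -
  obtain x where x: "u x \<noteq> 0" using u(2) by (auto simp: fun_eq_iff)
  have xSG: "x \<in> SG" using x u(1) by (auto simp: gasket_functions_def)
  have cont: "continuous_on SG u" using u(1) by (simp add: gasket_functions_def)
  define \<delta> where "\<delta> = cmod (u x) / 2"
  have \<delta>: "0 < \<delta>" using x by (simp add: \<delta>_def)
  obtain d where d: "0 < d" "\<And>y. y \<in> SG \<Longrightarrow> dist y x < d \<Longrightarrow> dist (u y) (u x) < \<delta>"
    using cont xSG \<delta> unfolding continuous_on_iff by metis
  obtain m where m: "2 / 2 ^ m < d" using small_cells[OF d(1)] by blast
  obtain w where w: "w \<in> words m" "x \<in> cell w" using xSG SG_cells[of m] by blast
  have wl: "length w = m" "set w \<subseteq> {..<3}" using w by (auto simp: words_def)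
  have low: "\<delta>\<^sup>2 * indicator (cell w) y \<le> (cmod (u y))\<^sup>2" for y
  proof (cases "y \<in> cell w")
    case True
    have "dist y x < d" using cell_diameter[OF True w(2)] m wl by simp
    then have "cmod (u y - u x) < \<delta>" using d(2) True cell_subset_SG wl by (auto simp: dist_norm)
    then have "\<delta> \<le> cmod (u y)" using norm_triangle_ineq2[of "u x" "u y"] by (simp add: \<delta>_def norm_minus_commute)
    then show ?thesis using True \<delta> by (simp add: power_mono)
  qed auto
  have "0 < \<delta>\<^sup>2 * measure \<mu> (cell w)" using \<delta> wl measure_\<mu>_cell[of w] by simp
  also have "\<dots> = (LINT y|\<mu>. \<delta>\<^sup>2 * indicator (cell w) y)" by simp
  also have "\<dots> \<le> (LINT y|\<mu>. (cmod (u y))\<^sup>2)"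
    using low integrable_square_gasket[OF u(1)] \<mu>.emeasure_finite
    by (intro integral_mono) (auto simp: less_top[symmetric])
  finally show ?thesis by (simp add: inner_diagonal)
qed

text \<open>Going down one level multiplies mass by 1/3 and energy by 3/5, which gives the factor
  1/5; the start is the oscillation bound from a zero at \<open>q 0\<close>, squared. The limit
  \<open>B\<close> stands in for \<open>energy\<close> because \<open>u \<circ> F i\<close> need not
  vanish off the gasket and so may leave the form domain.\<close>

lemma nn_integral_Poincare:
  assumes "continuous_on SG u" "u \<in> borel_measurable borel" "\<And>x. x \<in> V m \<Longrightarrow> u x = 0" "(\<lambda>k. en k u) \<longlonglongrightarrow> B"
  shows "(\<integral>\<^sup>+x. ennreal ((cmod (u x))\<^sup>2) \<partial>\<mu>) \<le> ennreal (25 * B / 5 ^ m)"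
  using assms
proof (induction m arbitrary: u B)
  case 0
  have le: "en k u \<le> B" for k using 0(4) by (intro incseq_le) (auto simp: incseq_def en_mono)
  have B: "0 \<le> B" using order_trans[OF en_nonneg le] .
  have "u (q 0) = 0" using 0(3) by (auto simp: V0_eq)
  then have "cmod (u x) \<le> 5 * sqrt B" if "x \<in> SG" for x
    using oscillation_q[OF 0(1) le that, of 0] by simp
  then have "(cmod (u x))\<^sup>2 \<le> 25 * B" if "x \<in> SG" for x
    using power_mono[of "cmod (u x)" "5 * sqrt B" 2] that B by (simp add: power_mult_distrib)
  then have "(\<integral>\<^sup>+x. ennreal ((cmod (u x))\<^sup>2) \<partial>\<mu>) \<le> (\<integral>\<^sup>+x. ennreal (25 * B) \<partial>\<mu>)"
    using AE_SG by (intro nn_integral_mono_AE) (auto intro: ennreal_leI)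
  then show ?case using \<mu>.emeasure_space_1 by simp
next
  case (Suc m)
  have le: "en k u \<le> B" for k using Suc.prems(4) by (intro incseq_le) (auto simp: incseq_def en_mono)
  have "\<exists>L. (\<lambda>k. en k (u \<circ> F i)) \<longlonglongrightarrow> L" if "i < 3" for i
    using en_convergent_iff[of "u \<circ> F i"] en_comp_F_le[OF le that] unfolding convergent_def by blast
  then obtain b where b: "\<And>i. i < 3 \<Longrightarrow> (\<lambda>k. en k (u \<circ> F i)) \<longlonglongrightarrow> b i" by metis
  have "(\<lambda>k. 5 / 3 * (\<Sum>i<3. en k (u \<circ> F i))) \<longlonglongrightarrow> 5 / 3 * (\<Sum>i<3. b i)"
    using b by (intro tendsto_intros) auto
  moreover have "(\<lambda>k. en (Suc k) u) \<longlonglongrightarrow> B" using Suc.prems(4) by (rule LIMSEQ_Suc)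
  ultimately have sum_b: "B = 5 / 3 * (\<Sum>i<3. b i)" unfolding en_Suc by (rule LIMSEQ_unique[symmetric])
  have b_nn: "0 \<le> b i" if "i < 3" for i
    by (rule LIMSEQ_le_const[OF b[OF that]]) (auto simp: en_nonneg)
  have [measurable]: "u \<in> borel_measurable borel" by fact
  have IH: "(\<integral>\<^sup>+x. ennreal ((cmod (u (F i x)))\<^sup>2) \<partial>\<mu>) \<le> ennreal (25 * b i / 5 ^ m)" if i: "i < 3" for i
    using Suc.IH[of "u \<circ> F i" "b i"] continuous_comp_F[OF Suc.prems(1) i] b[OF i] Suc.prems(3) i
    by (auto simp: comp_def)
  have "(\<integral>\<^sup>+x. ennreal ((cmod (u x))\<^sup>2) \<partial>\<mu>) = (\<Sum>i<3. (1/3) * (\<integral>\<^sup>+x. ennreal ((cmod (u (F i x)))\<^sup>2) \<partial>\<mu>))"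
    by (rule nn_integral_\<mu>_selfsimilar) measurable
  also have "\<dots> \<le> (\<Sum>i<3. ennreal (1/3) * ennreal (25 * b i / 5 ^ m))"
    unfolding ennreal_third using IH by (intro sum_mono mult_left_mono) auto
  also have "\<dots> = (\<Sum>i<3. ennreal (1/3 * (25 * b i / 5 ^ m)))"
    by (intro sum.cong refl ennreal_mult'[symmetric]) simp
  also have "\<dots> = ennreal (\<Sum>i<3. 1/3 * (25 * b i / 5 ^ m))"
    using b_nn by (intro sum_ennreal) auto
  also have "(\<Sum>i<3. 1/3 * (25 * b i / 5 ^ m)) = 25 * B / 5 ^ Suc m"
    unfolding sum_b by (simp add: sum_distrib_left sum_divide_distrib mult_ac)
  finally show ?case .
qed

lemma Poincare:
  assumes u: "u \<in> form_domain bc" and zero: "\<And>x. x \<in> V m \<Longrightarrow> u x = 0"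
  shows "5 ^ m * Re (inner_\<mu> u u) \<le> 25 * Re (energy u u)"
proof -
  have g: "u \<in> gasket_functions" using u by (rule form_domain_gasket)
  have E: "0 \<le> Re (energy u u)" using order_trans[OF en_nonneg en_le_energy[OF u]] .
  have "ennreal (LINT x|\<mu>. (cmod (u x))\<^sup>2) = (\<integral>\<^sup>+x. ennreal ((cmod (u x))\<^sup>2) \<partial>\<mu>)"
    using integrable_square_gasket[OF g] by (intro nn_integral_eq_integral[symmetric]) auto
  also have "\<dots> \<le> ennreal (25 * Re (energy u u) / 5 ^ m)"
    using g gasket_functions_measurable[OF g] zero en_tendsto[OF u]
    by (intro nn_integral_Poincare) (auto simp: gasket_functions_def)
  finally have "(LINT x|\<mu>. (cmod (u x))\<^sup>2) \<le> 25 * Re (energy u u) / 5 ^ m"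
    using E by (simp add: ennreal_le_iff)
  then show ?thesis by (simp add: inner_diagonal field_simps)
qed

lemma Poincare_strict:
  assumes "u \<in> form_domain bc" "u \<noteq> 0" "\<And>x. x \<in> V m \<Longrightarrow> u x = 0" "25 * t < 5 ^ m"
  shows "t * Re (inner_\<mu> u u) < Re (energy u u)"
proof -
  have "25 * t * Re (inner_\<mu> u u) < 5 ^ m * Re (inner_\<mu> u u)"
    using assms inner_pos form_domain_gasket by (intro mult_strict_right_mono) auto
  then show ?thesis using Poincare[of u bc m] assms(1,3) by simp
qed

section \<open>Compactness\<close>

lemma gasket_oscillation:
  assumes "u \<in> form_domain bc" "x \<in> SG" "y \<in> SG"
  shows "cmod (u x - u y) \<le> 10 * sqrt (Re (energy u u))"
  using cell_oscillation[of u "Re (energy u u)" "[]" x y] assms en_le_energy[OF assms(1)]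
  by (auto simp: form_domain_iff gasket_functions_def)

text \<open>Compare \<open>u x\<close> with \<open>u y\<close> and average over \<open>y\<close>:
  the square of the oscillation bound 10 gives 100, doubled by the squared triangle inequality, and
  twice the average of |u y|^2 is 2.\<close>

lemma sup_bound:
  assumes u: "u \<in> form_domain bc" and norm: "Re (inner_\<mu> u u) = 1" and E: "Re (energy u u) \<le> C" and x: "x \<in> SG"
  shows "cmod (u x) \<le> sqrt (2 + 200 * C)"
proof -
  have g: "u \<in> gasket_functions" using u by (rule form_domain_gasket)
  have E0: "0 \<le> Re (energy u u)" using order_trans[OF en_nonneg en_le_energy[OF u]] .
  have le: "(cmod (u x))\<^sup>2 \<le> 2 * (cmod (u y))\<^sup>2 + 200 * C" if y: "y \<in> SG" for y
  proof -
    have "(cmod (u x - u y))\<^sup>2 \<le> (10 * sqrt (Re (energy u u)))\<^sup>2"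
      by (intro power_mono gasket_oscillation[OF u x y]) auto
    also have "\<dots> \<le> 100 * C" using E E0 by (simp add: power_mult_distrib)
    finally show ?thesis using cmod_add_squared_le[of "u y" "u x - u y"] by simp
  qed
  have "(cmod (u x))\<^sup>2 = (LINT y|\<mu>. (cmod (u x))\<^sup>2)" using \<mu>.prob_space by simp
  also have "\<dots> \<le> (LINT y|\<mu>. 2 * (cmod (u y))\<^sup>2 + 200 * C)"
    using integrable_square_gasket[OF g] AE_SG le by (intro integral_mono_AE) auto
  also have "\<dots> = 2 * (LINT y|\<mu>. (cmod (u y))\<^sup>2) + 200 * C"
    using integrable_square_gasket[OF g] \<mu>.prob_space by simp
  also have "(LINT y|\<mu>. (cmod (u y))\<^sup>2) = 1" using norm by (simp add: inner_diagonal)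
  finally show ?thesis by (intro real_le_rsqrt) simp
qed

text \<open>The level m is chosen so that every cell of this level has oscillation below
  \<open>e\<close>; it depends on the energy bound only, so one radius at \<open>x\<close> serves
  all functions.\<close>

lemma equicontinuous_energy:
  assumes x: "x \<in> SG" and e: "0 < e"
  shows "\<exists>d>0. \<forall>u y. u \<in> form_domain bc \<and> Re (energy u u) \<le> C \<and> y \<in> SG \<and> norm (x - y) < d \<longrightarrow> norm (u x - u y) < e"
proof -
  have "(\<lambda>m. 10 * sqrt ((3 / 5) ^ m * C)) \<longlonglongrightarrow> 10 * sqrt (0 * C)"
    by (intro tendsto_intros LIMSEQ_realpow_zero) auto
  then have "\<forall>\<^sub>F m in sequentially. 10 * sqrt ((3 / 5) ^ m * C) < e"
    by (rule order_tendstoD) (use e in simp)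
  then obtain m where m: "10 * sqrt ((3 / 5) ^ m * C) < e" by (auto simp: eventually_sequentially)
  obtain d where d: "0 < d" "\<And>y. y \<in> SG \<Longrightarrow> dist x y < d \<Longrightarrow> \<exists>w\<in>words m. x \<in> cell w \<and> y \<in> cell w"
    using cells_near[OF x] by blast
  show ?thesis
  proof (intro exI[of _ d] conjI d(1) allI impI, elim conjE)
    fix u y assume u: "u \<in> form_domain bc" "Re (energy u u) \<le> C" and y: "y \<in> SG" "norm (x - y) < d"
    obtain w where w: "w \<in> words m" "x \<in> cell w" "y \<in> cell w" using d(2)[of y] y by (auto simp: dist_norm)
    have "en k u \<le> C" for k using en_le_energy[OF u(1), of k] u(2) by linarith
    then have "cmod (u x - u y) \<le> 10 * sqrt ((3 / 5) ^ length w * C)"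
      using u w by (intro cell_oscillation) (auto simp: form_domain_iff gasket_functions_def words_def)
    then show "norm (u x - u y) < e" using m w by (simp add: words_def)
  qed
qed

lemma en_pointwise_tendsto:
  assumes "\<And>x. (\<lambda>n. f n x) \<longlonglongrightarrow> u x" shows "(\<lambda>n. en m (f n)) \<longlonglongrightarrow> en m u"
  unfolding en_def case_prod_unfold using assms by (intro tendsto_intros)

text \<open>Finite energy controls the modulus of continuity, so the Arzela-Ascoli theorem takes the
  place of a compact embedding. Closedness under pointwise limits is the property to be checked for
  each symmetry type.\<close>

lemma compact_form_gasket:
  assumes sub: "cfun.subspace D" and D: "D \<subseteq> form_domain bc"
    and closed: "\<And>f u. (\<And>n::nat. f n \<in> D) \<Longrightarrow> (\<And>x. (\<lambda>n. f n x) \<longlonglongrightarrow> u x) \<Longrightarrow> u \<in> form_domain bc \<Longrightarrow> u \<in> D"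
  shows "compact_form D energy inner_\<mu>"
proof -
  have DG: "D \<subseteq> gasket_functions" using D form_domain_gasket by blast
  interpret E: hermitian_form D energy by (rule hermitian_form_subset[OF hermitian_energy sub D])
  interpret P: hermitian_form D inner_\<mu> by (rule hermitian_form_subset[OF hermitian_inner sub DG])
  show ?thesis
  proof unfold_locales
    fix u assume u: "u \<in> D"
    show "0 \<le> Re (energy u u)" using order_trans[OF en_nonneg en_le_energy[of u bc]] D u by blast
    show "u \<noteq> 0 \<Longrightarrow> 0 < Re (inner_\<mu> u u)" using inner_pos DG u by blast
  next
    fix t :: real
    obtain m where "25 * t < 5 ^ m" using real_arch_pow[of 5 "25 * t"] by auto
    then have "\<forall>u\<in>D. u \<noteq> 0 \<longrightarrow> (\<forall>z\<in>V m. u z = 0) \<longrightarrow> t * Re (inner_\<mu> u u) < Re (energy u u)"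
      using Poincare_strict D by blast
    then show "\<exists>Z. finite Z \<and> (\<forall>u\<in>D. u \<noteq> 0 \<longrightarrow> (\<forall>z\<in>Z. u z = 0) \<longrightarrow> t * Re (inner_\<mu> u u) < Re (energy u u))"
      using finite_V by blast
  next
    fix f :: "nat \<Rightarrow> complex \<Rightarrow> complex" and C
    assume f: "\<And>n. f n \<in> D" "\<And>n. Re (inner_\<mu> (f n) (f n)) = 1" "\<And>n. Re (energy (f n) (f n)) \<le> C"
    have fd: "f n \<in> form_domain bc" and fg: "f n \<in> gasket_functions" for n using f(1) D DG by auto
    define M where "M = sqrt (2 + 200 * C)"
    have bound: "norm (f n x) \<le> M" if "x \<in> SG" for n x
      unfolding M_def by (rule sup_bound[OF fd f(2,3) that])
    have equi: "\<exists>d>0. \<forall>n y. y \<in> SG \<and> norm (x - y) < d \<longrightarrow> norm (f n x - f n y) < e" if "x \<in> SG" "0 < e" for x e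
      using equicontinuous_energy[OF that, of bc C] fd f(3) by blast
    obtain g r where g: "continuous_on SG g" "strict_mono (r :: nat \<Rightarrow> nat)"
      "\<And>e. 0 < e \<Longrightarrow> \<exists>N. \<forall>n x. n \<ge> N \<and> x \<in> SG \<longrightarrow> norm (f (r n) x - g x) < e"
      using Arzela_Ascoli[of SG f M] compact_SG bound equi by metis
    \<comment> \<open>The limit supplied by Arzela-Ascoli is determined on the gasket only.\<close>
    define u where "u x = (if x \<in> SG then g x else 0)" for x
    have lim: "(\<lambda>n. f (r n) x) \<longlonglongrightarrow> u x" for x
    proof (cases "x \<in> SG")
      case True
      show ?thesis
      proof (rule LIMSEQ_I)
        fix e :: real assume "0 < e"
        then obtain N where "\<forall>n x. n \<ge> N \<and> x \<in> SG \<longrightarrow> norm (f (r n) x - g x) < e" using g(3) by blast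
        then show "\<exists>N. \<forall>n\<ge>N. norm (f (r n) x - u x) < e" using True by (auto simp: u_def)
      qed
    next
      case False
      then show ?thesis using fg by (simp add: u_def gasket_functions_def)
    qed
    have ug: "u \<in> gasket_functions"
      using g(1) by (auto simp: gasket_functions_def u_def cong: continuous_on_cong_simp)
    \<comment> \<open>Lower semicontinuity: each \<open>en m\<close> is continuous under pointwise
      convergence and bounded by the energy, and the level m tends to infinity only
      afterwards.\<close>
    have en_u: "en m u \<le> L" if L: "(\<lambda>n. Re (energy (f n) (f n))) \<longlonglongrightarrow> L" for m L
    proof (rule LIMSEQ_le[OF en_pointwise_tendsto[OF lim]])
      show "(\<lambda>n. Re (energy (f (r n)) (f (r n)))) \<longlonglongrightarrow> L"
        using LIMSEQ_subseq_LIMSEQ[OF L g(2)] by (simp add: comp_def)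
      show "\<exists>N. \<forall>n\<ge>N. en m (f (r n)) \<le> Re (energy (f (r n)) (f (r n)))"
        using en_le_energy[OF fd] by blast
    qed
    have "en m u \<le> C" for m
      by (rule LIMSEQ_le_const2[OF en_pointwise_tendsto[OF lim]]) (use en_le_energy[OF fd] f(3) order_trans in blast)
    moreover have "u x = 0" if "bc = Dirichlet" "x \<in> V0" for x
    proof -
      have "(\<lambda>n. f (r n) x) = (\<lambda>n. 0)" using fd that by (auto simp: form_domain_iff)
      then show ?thesis using lim[of x] by (simp add: LIMSEQ_const_iff)
    qed
    ultimately have ufd: "u \<in> form_domain bc" using ug by (auto simp: form_domain_iff)
    have uD: "u \<in> D" by (rule closed[OF _ lim ufd]) (rule f(1))
    have M0: "0 \<le> M" using order_trans[OF norm_ge_zero bound[OF q_SG[of 0], of 0]] by simp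
    have bound': "norm (f n x) \<le> M" for n x
      using bound[of x n] M0 fg[of n] by (cases "x \<in> SG") (auto simp: gasket_functions_def)
    have [measurable]: "u \<in> borel_measurable borel" "\<And>n. f n \<in> borel_measurable borel" "cnj \<in> borel_measurable borel"
      using gasket_functions_measurable ug fg measurable_cnj by auto
    have inner_lim: "(\<lambda>n. inner_\<mu> (f (r n)) v) \<longlonglongrightarrow> inner_\<mu> u v" if v: "v \<in> D" for v
    proof -
      have [measurable]: "v \<in> borel_measurable borel" using gasket_functions_measurable v DG by auto
      obtain M' where M': "0 \<le> M'" "\<And>x. cmod (v x) \<le> M'" using gasket_functions_bounded v DG by (metis subsetD)
      show ?thesis unfolding inner_\<mu>_def
      proof (rule integral_dominated_convergence[where w = "\<lambda>_. M * M'"])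
        show "AE x in \<mu>. norm (f (r n) x * cnj (v x)) \<le> M * M'" for n
          using bound' M' M0 by (auto simp: norm_mult intro!: mult_mono)
        show "AE x in \<mu>. (\<lambda>n. f (r n) x * cnj (v x)) \<longlonglongrightarrow> u x * cnj (v x)"
          using lim by (intro always_eventually allI tendsto_intros)
      qed measurable
    qed
    have "(\<lambda>n. inner_\<mu> (f (r n)) (f (r n))) \<longlonglongrightarrow> inner_\<mu> u u"
      unfolding inner_\<mu>_def
    proof (rule integral_dominated_convergence[where w = "\<lambda>_. M * M"])
      show "AE x in \<mu>. norm (f (r n) x * cnj (f (r n) x)) \<le> M * M" for n
        using bound' M0 by (auto simp: norm_mult intro!: mult_mono)
      show "AE x in \<mu>. (\<lambda>n. f (r n) x * cnj (f (r n) x)) \<longlonglongrightarrow> u x * cnj (u x)"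
        using lim by (intro always_eventually allI tendsto_intros)
    qed measurable
    then have "(\<lambda>n. Re (inner_\<mu> (f (r n)) (f (r n)))) \<longlonglongrightarrow> Re (inner_\<mu> u u)" by (rule tendsto_Re)
    then have norm_u: "Re (inner_\<mu> u u) = 1" unfolding f(2) by (simp add: LIMSEQ_const_iff)
    have E_le: "Re (energy u u) \<le> L" if "(\<lambda>n. Re (energy (f n) (f n))) \<longlonglongrightarrow> L" for L
      by (rule LIMSEQ_le_const2[OF en_tendsto[OF ufd]]) (use en_u[OF that] in blast)
    show "\<exists>u\<in>D. Re (inner_\<mu> u u) = 1 \<and>
        (\<exists>r. strict_mono (r :: nat \<Rightarrow> nat) \<and> (\<forall>v\<in>D. (\<lambda>n. inner_\<mu> (f (r n)) v) \<longlonglongrightarrow> inner_\<mu> u v)) \<and>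
        (\<forall>L. (\<lambda>n. Re (energy (f n) (f n))) \<longlonglongrightarrow> L \<longrightarrow> Re (energy u u) \<le> L)"
      using uD norm_u g(2) inner_lim E_le by blast
  qed
qed

section \<open>Symmetries\<close>

text \<open>Commutation with the contractions, up to a permutation of the indices, is what
  inductions over the level use; the elements of \<open>D3\<close> are listed explicitly only
  later.\<close>

locale gasket_symmetry =
  fixes g :: "complex \<Rightarrow> complex" and p :: "nat \<Rightarrow> nat"
  assumes perm: "bij_betw p {..<3} {..<3}"
    and F_commute: "\<And>i x. i < 3 \<Longrightarrow> g (F i x) = F (p i) (g x)"
    and vertex: "\<And>i. i < 3 \<Longrightarrow> g (q i) = q (p i)"
    and continuous: "continuous_on UNIV g"
    and inj: "inj g"
begin

lemma g_eq_iff [simp]: "g x = g y \<longleftrightarrow> x = y"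
  using inj by (auto simp: inj_def)

lemma UN_perm: "(\<Union>i<3. A (p i)) = (\<Union>i<3. A i)"
  using perm by (metis bij_betw_imp_surj_on image_image)

text \<open>The image is again a nonempty compact set fixed by \<open>hutchinson\<close>.\<close>

lemma image_SG: "g ` SG = SG"
proof -
  have inv: "hutchinson (g ` SG) = g ` SG"
  proof -
    have "g ` SG = g ` (\<Union>i<3. F i ` SG)" using SG_hutchinson by (simp add: hutchinson_def)
    also have "\<dots> = (\<Union>i<3. F (p i) ` g ` SG)" by (auto simp: image_UN image_image F_commute)
    also have "\<dots> = hutchinson (g ` SG)" unfolding hutchinson_def by (rule UN_perm)
    finally show ?thesis ..
  qed
  have "compact (g ` SG)" using compact_SG continuous continuous_on_subset by (intro compact_continuous_image) auto
  then have "SG \<subseteq> g ` SG" "g ` SG \<subseteq> SG"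
    using subset_of_contraction[of SG "g ` SG"] subset_of_contraction[of "g ` SG" SG] inv SG_hutchinson
    by (simp_all add: compact_SG SG_nonempty compact_imp_closed compact_imp_bounded)
  then show ?thesis by (rule subset_antisym[rotated])
qed

lemma SG_iff: "g x \<in> SG \<longleftrightarrow> x \<in> SG"
  using image_SG inj by (metis inj_image_mem_iff)

lemma image_V0: "g ` V0 = V0"
proof -
  have "g ` V0 = q ` p ` {..<3}" unfolding V0_def image_image by (intro image_cong) (auto simp: vertex)
  then show ?thesis using perm by (simp add: V0_def bij_betw_imp_surj_on)
qed

lemma image_edges: "map_prod g g ` edges m = edges m"
proof (induction m)
  case 0
  show ?case
  proof
    show "map_prod g g ` edges 0 \<subseteq> edges 0" using image_V0 by auto
    show "edges 0 \<subseteq> map_prod g g ` edges 0"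
    proof
      fix e assume "e \<in> edges 0"
      then obtain x y where e: "e = (x, y)" "x \<in> g ` V0" "y \<in> g ` V0" "x \<noteq> y" unfolding image_V0 by auto
      then obtain x' y' where "x' \<in> V0" "y' \<in> V0" "x = g x'" "y = g y'" by auto
      then show "e \<in> map_prod g g ` edges 0" using e by (auto intro!: image_eqI[of _ _ "(x', y')"])
    qed
  qed
next
  case (Suc m)
  have "map_prod g g ` edges (Suc m) = (\<Union>i<3. map_prod (F (p i)) (F (p i)) ` map_prod g g ` edges m)"
    unfolding edges.simps image_UN image_image
    by (intro SUP_cong refl image_cong) (auto simp: F_commute)
  also have "\<dots> = edges (Suc m)" unfolding Suc edges.simps by (rule UN_perm)
  finally show ?case .
qed

lemma energy_approx_comp: "energy_approx m (u \<circ> g) (v \<circ> g) = energy_approx m u v"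
proof -
  have "(\<Sum>(x, y)\<in>edges m. (u x - u y) * cnj (v x - v y))
    = (\<Sum>(x, y)\<in>map_prod g g ` edges m. (u x - u y) * cnj (v x - v y))" by (simp only: image_edges)
  also have "\<dots> = (\<Sum>(x, y)\<in>edges m. ((u \<circ> g) x - (u \<circ> g) y) * cnj ((v \<circ> g) x - (v \<circ> g) y))"
    by (subst sum.reindex) (auto simp: inj_on_def case_prod_unfold)
  finally show ?thesis by (simp add: energy_approx_def)
qed

lemma energy_comp: "energy (u \<circ> g) (v \<circ> g) = energy u v"
  unfolding energy_def energy_approx_comp ..

lemma comp_gasket_functions:
  assumes "u \<in> gasket_functions" shows "u \<circ> g \<in> gasket_functions"
proof -
  have "continuous_on SG (u \<circ> g)"
    using assms continuous_on_subset[OF continuous, of SG]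
    by (intro continuous_on_compose) (auto simp: image_SG gasket_functions_def)
  then show ?thesis using assms SG_iff by (auto simp: gasket_functions_def)
qed

lemma comp_form_domain:
  assumes "u \<in> form_domain bc" shows "u \<circ> g \<in> form_domain bc"
proof -
  have "u (g x) = 0" if "bc = Dirichlet" "x \<in> V0" for x
    using that assms image_V0 by (auto simp: form_domain_def)
  then show ?thesis
    using assms comp_gasket_functions[of u] energy_approx_comp[of _ u u]
    by (auto simp: form_domain_def gasket_functions_def)
qed

lemma measurable_g [measurable]: "g \<in> borel_measurable borel"
  using continuous by (rule borel_measurable_continuous_onI)

lemma image_cell: "set w \<subseteq> {..<3} \<Longrightarrow> g ` cell w = cell (map p w)"
proof (induction w)
  case (Cons i w)
  then have IH: "g ` cell w = cell (map p w)" and i: "i < 3" by auto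
  have "g ` cell (i # w) = F (p i) ` (g ` cell w)" using i by (simp add: image_image F_commute)
  then show ?case unfolding IH by simp
qed (simp add: image_SG)

text \<open>The image measure gives every cell the mass of its preimage, a cell of the same level;
  uniqueness of the measure does the rest.\<close>

lemma distr_\<mu>: "distr \<mu> borel g = \<mu>"
proof (rule gasket_measure_unique[OF _ gasket_measure_\<mu>])
  have "measure (distr \<mu> borel g) (cell w) = (1 / 3) ^ length w" if w: "set w \<subseteq> {..<3}" for w
  proof -
    define w' where "w' = map (inv_into {..<3} p) w"
    have w': "set w' \<subseteq> {..<3}" "map p w' = w"
      using w bij_betwE[OF bij_betw_inv_into[OF perm]] bij_betw_inv_into_right[OF perm]
      by (auto simp: w'_def map_idI subset_iff)
    have "g -` cell w = cell w'"
      using image_cell[OF w'(1)] w'(2) inj by (metis inj_vimage_image_eq)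
    then show ?thesis using measure_\<mu>_cell[OF w'(1)] by (simp add: measure_distr w'_def)
  qed
  then show "gasket_measure (distr \<mu> borel g)"
    by (auto simp: gasket_measure_def intro!: \<mu>.prob_space_distr)
qed

lemma integral_comp:
  fixes f :: "complex \<Rightarrow> 'b::{banach, second_countable_topology}"
  assumes "f \<in> borel_measurable borel" shows "(LINT x|\<mu>. f (g x)) = (LINT x|\<mu>. f x)"
proof -
  have "(LINT x|\<mu>. f x) = (LINT x|distr \<mu> borel g. f x)" by (simp only: distr_\<mu>)
  also have "\<dots> = (LINT x|\<mu>. f (g x))" using assms by (intro integral_distr) auto
  finally show ?thesis ..
qed

lemma integrable_comp:
  fixes f :: "complex \<Rightarrow> 'b::{banach, second_countable_topology}"
  assumes "integrable \<mu> f" shows "integrable \<mu> (\<lambda>x. f (g x))"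
  using integrable_distr[of g \<mu> borel f] assms by (simp add: distr_\<mu>)

lemma AE_comp: "AE x in \<mu>. Q x \<Longrightarrow> AE x in \<mu>. Q (g x)"
proof -
  assume Q: "AE x in \<mu>. Q x"
  then obtain N where N: "{x \<in> space \<mu>. \<not> Q x} \<subseteq> N" "N \<in> null_sets \<mu>" by (auto simp: eventually_ae_filter)
  have "g -` N \<inter> space \<mu> \<in> null_sets \<mu>"
    using null_sets_distr_iff[of g \<mu> borel N] N(2) by (simp add: distr_\<mu>)
  moreover have "{x \<in> space \<mu>. \<not> Q (g x)} \<subseteq> g -` N \<inter> space \<mu>" using N(1) by auto
  ultimately show ?thesis by (auto simp: eventually_ae_filter)
qed

lemma inner_comp:
  assumes "u \<in> gasket_functions" "v \<in> gasket_functions"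
  shows "inner_\<mu> (u \<circ> g) (v \<circ> g) = inner_\<mu> u v"
proof -
  have [measurable]: "u \<in> borel_measurable borel" "v \<in> borel_measurable borel" "cnj \<in> borel_measurable borel"
    using gasket_functions_measurable assms measurable_cnj by auto
  have "(\<lambda>x. u x * cnj (v x)) \<in> borel_measurable borel" by measurable
  from integral_comp[OF this] show ?thesis by (simp add: inner_\<mu>_def)
qed

end

section \<open>Symmetry types\<close>

lemma q1_facts: "q 1 * q 1 = q 2" "q 1 * q 2 = 1" "1 + q 1 + q 2 = 0" "q 1 \<noteq> 1" "q 2 \<noteq> 1" "q 1 * cnj (q 2) = q 2" "cnj (q 1) = q 2"
  by (auto simp: q_simps complex_eq_iff)

interpretation rotation: gasket_symmetry "\<lambda>x. q 1 * x" "\<lambda>i. (i + 1) mod 3"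
proof
  show "bij_betw (\<lambda>i. (i + 1) mod 3) {..<3} {..<3::nat}"
    by (auto simp: bij_betw_def inj_on_def lessThan_3)
  show vertex: "q 1 * q i = q ((i + 1) mod 3)" if "i < 3" for i
    using that by (elim less_3_cases) (use q1_facts q_values(1) in \<open>auto simp: numeral_2_eq_2\<close>)
  show "q 1 * F i x = F ((i + 1) mod 3) (q 1 * x)" if "i < 3" for i x
    using vertex[OF that] by (simp add: F_def algebra_simps)
  show "continuous_on UNIV (\<lambda>x. q 1 * x)" by (intro continuous_intros)
  show "inj (\<lambda>x. q 1 * x)" using norm_q[of 1] by (auto simp: inj_def)
qed

definition swap12 :: "nat \<Rightarrow> nat" where
  "swap12 i = (if i = 1 then 2 else if i = 2 then 1 else i)"

interpretation reflection: gasket_symmetry cnj swap12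
proof
  show "bij_betw swap12 {..<3} {..<3}"
    by (auto simp: bij_betw_def inj_on_def lessThan_3 swap12_def)
  show vertex: "cnj (q i) = q (swap12 i)" if "i < 3" for i
    using that by (elim less_3_cases) (auto simp: swap12_def q_simps complex_eq_iff)
  show "cnj (F i x) = F (swap12 i) (cnj x)" if "i < 3" for i x
    using vertex[OF that] by (simp add: F_def)
  show "continuous_on UNIV cnj" by (intro continuous_intros)
  show "inj cnj" by (auto simp: inj_def)
qed

text \<open>The identity is asked on the whole plane; off the gasket both sides vanish. When
  \<open>z\<close> is a cube root of unity this is the space of a rotation character.\<close>

definition rot_type :: "boundary_condition \<Rightarrow> complex \<Rightarrow> (complex \<Rightarrow> complex) set" where
  "rot_type bc z = {u \<in> form_domain bc. \<forall>x. u (q 1 * x) = z * u x}"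

text \<open>The trivial representation for \<open>s = 1\<close> and the alternating one for
  \<open>s = -1\<close>.\<close>

definition parity_type :: "boundary_condition \<Rightarrow> complex \<Rightarrow> (complex \<Rightarrow> complex) set" where
  "parity_type bc s = {u \<in> rot_type bc 1. \<forall>x. u (cnj x) = s * u x}"

text \<open>The kernel of the average over the rotations. It collects both nontrivial rotation
  characters and belongs to the two-dimensional representation.\<close>

definition standard_type :: "boundary_condition \<Rightarrow> (complex \<Rightarrow> complex) set" where
  "standard_type bc = {u \<in> form_domain bc. \<forall>x. u x + u (q 1 * x) + u (q 2 * x) = 0}"

lemma compact_form_domain: "compact_form (form_domain bc) energy inner_\<mu>"
  by (rule compact_form_gasket[OF form_domain_subspace order_refl])

lemma rot_type_subspace: "cfun.subspace (rot_type bc z)"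
proof (rule cfun.subspaceI)
  fix u v c assume "u \<in> rot_type bc z" "v \<in> rot_type bc z"
  then show "u + v \<in> rot_type bc z" "cscale c u \<in> rot_type bc z"
    using cfun.subspace_add[OF form_domain_subspace, of u bc v] cfun.subspace_scale[OF form_domain_subspace, of u bc c]
    unfolding rot_type_def by (simp_all add: algebra_simps) (simp add: cscale_def)
qed (simp add: rot_type_def cfun.subspace_0[OF form_domain_subspace])

lemma parity_type_subspace: "cfun.subspace (parity_type bc s)"
proof (rule cfun.subspaceI)
  fix u v c assume "u \<in> parity_type bc s" "v \<in> parity_type bc s"
  then show "u + v \<in> parity_type bc s" "cscale c u \<in> parity_type bc s"
    using cfun.subspace_add[OF rot_type_subspace, of u bc 1 v] cfun.subspace_scale[OF rot_type_subspace, of u bc 1 c]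
    unfolding parity_type_def by (simp_all add: algebra_simps) (simp add: cscale_def)
qed (simp add: parity_type_def cfun.subspace_0[OF rot_type_subspace])

lemma standard_type_subspace: "cfun.subspace (standard_type bc)"
proof (rule cfun.subspaceI)
  show "0 \<in> standard_type bc"
    by (simp add: standard_type_def cfun.subspace_0[OF form_domain_subspace])
  fix u v c assume u: "u \<in> standard_type bc" and v: "v \<in> standard_type bc"
  have eq: "c * u x + c * u (q 1 * x) + c * u (q 2 * x) = 0" for x
    unfolding distrib_left[symmetric] using u by (simp add: standard_type_def)
  have "(u x + v x) + (u (q 1 * x) + v (q 1 * x)) + (u (q 2 * x) + v (q 2 * x))
    = (u x + u (q 1 * x) + u (q 2 * x)) + (v x + v (q 1 * x) + v (q 2 * x))" for x by (simp add: algebra_simps)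
  then have "(u x + v x) + (u (q 1 * x) + v (q 1 * x)) + (u (q 2 * x) + v (q 2 * x)) = 0" for x
    using u v by (simp only: standard_type_def mem_Collect_eq) simp
  then show "u + v \<in> standard_type bc" using u v
    by (simp add: standard_type_def cfun.subspace_add[OF form_domain_subspace])
  have "cscale c u \<in> form_domain bc"
    using u by (intro cfun.subspace_scale form_domain_subspace) (simp add: standard_type_def)
  then show "cscale c u \<in> standard_type bc" using eq by (simp add: standard_type_def) (simp add: cscale_def)
qed

lemma rot_type_domain: "rot_type bc z \<subseteq> form_domain bc"
  and parity_type_rot: "parity_type bc s \<subseteq> rot_type bc 1"
  and standard_type_domain: "standard_type bc \<subseteq> form_domain bc"
  by (auto simp: rot_type_def parity_type_def standard_type_def)

lemma compact_form_rot_type: "compact_form (rot_type bc z) energy inner_\<mu>"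
proof (rule compact_form_gasket[OF rot_type_subspace rot_type_domain])
  fix f u assume f: "\<And>n::nat. f n \<in> rot_type bc z" and lim: "\<And>x. (\<lambda>n. f n x) \<longlonglongrightarrow> u x" and u: "u \<in> form_domain bc"
  have "u (q 1 * x) = z * u x" for x
  proof (rule LIMSEQ_unique[OF lim])
    have "(\<lambda>n. f n (q 1 * x)) = (\<lambda>n. z * f n x)" using f by (simp add: rot_type_def)
    then show "(\<lambda>n. f n (q 1 * x)) \<longlonglongrightarrow> z * u x" using tendsto_mult_left[OF lim[of x], of z] by simp
  qed
  then show "u \<in> rot_type bc z" using u by (simp add: rot_type_def)
qed

lemma compact_form_parity_type: "compact_form (parity_type bc s) energy inner_\<mu>"
proof (rule compact_form_gasket[OF parity_type_subspace])
  show "parity_type bc s \<subseteq> form_domain bc" using parity_type_rot rot_type_domain by blast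
  fix f u assume f: "\<And>n::nat. f n \<in> parity_type bc s" and lim: "\<And>x. (\<lambda>n. f n x) \<longlonglongrightarrow> u x" and u: "u \<in> form_domain bc"
  have "u (q 1 * x) = u x" for x
  proof (rule LIMSEQ_unique[OF lim])
    have "(\<lambda>n. f n (q 1 * x)) = (\<lambda>n. f n x)" using f by (simp add: rot_type_def parity_type_def)
    then show "(\<lambda>n. f n (q 1 * x)) \<longlonglongrightarrow> u x" using lim[of x] by simp
  qed
  moreover have "u (cnj x) = s * u x" for x
  proof (rule LIMSEQ_unique[OF lim])
    have "(\<lambda>n. f n (cnj x)) = (\<lambda>n. s * f n x)" using f by (simp add: parity_type_def)
    then show "(\<lambda>n. f n (cnj x)) \<longlonglongrightarrow> s * u x" using tendsto_mult_left[OF lim[of x], of s] by simp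
  qed
  ultimately show "u \<in> parity_type bc s" using u by (simp add: parity_type_def rot_type_def)
qed

lemma compact_form_standard_type: "compact_form (standard_type bc) energy inner_\<mu>"
proof (rule compact_form_gasket[OF standard_type_subspace standard_type_domain])
  fix f u assume f: "\<And>n::nat. f n \<in> standard_type bc" and lim: "\<And>x. (\<lambda>n. f n x) \<longlonglongrightarrow> u x" and u: "u \<in> form_domain bc"
  have "u x + u (q 1 * x) + u (q 2 * x) = 0" for x
  proof (rule LIMSEQ_unique)
    show "(\<lambda>n. f n x + f n (q 1 * x) + f n (q 2 * x)) \<longlonglongrightarrow> u x + u (q 1 * x) + u (q 2 * x)"
      using lim by (intro tendsto_intros)
    show "(\<lambda>n. f n x + f n (q 1 * x) + f n (q 2 * x)) \<longlonglongrightarrow> 0" using f by (simp add: standard_type_def)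
  qed
  then show "u \<in> standard_type bc" using u by (simp add: standard_type_def)
qed

text \<open>Energy and inner product are both instances, so each orthogonality relation is proved
  once.\<close>

locale invariant_form = hermitian_form "form_domain bc" Q for bc Q +
  assumes rot: "\<And>u v. u \<in> form_domain bc \<Longrightarrow> v \<in> form_domain bc \<Longrightarrow> Q (u \<circ> (\<lambda>x. q 1 * x)) (v \<circ> (\<lambda>x. q 1 * x)) = Q u v"
    and refl: "\<And>u v. u \<in> form_domain bc \<Longrightarrow> v \<in> form_domain bc \<Longrightarrow> Q (u \<circ> cnj) (v \<circ> cnj) = Q u v"
begin

text \<open>Rotating both arguments multiplies the value by \<open>z * cnj z'\<close> and leaves it
  unchanged.\<close>

lemma rot_types_orthogonal:
  assumes u: "u \<in> rot_type bc z" and v: "v \<in> rot_type bc z'" and z: "z * cnj z' \<noteq> 1"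
  shows "Q u v = 0"
proof -
  have D: "u \<in> form_domain bc" "v \<in> form_domain bc" using u v by (auto simp: rot_type_def)
  have "u \<circ> (\<lambda>x. q 1 * x) = cscale z u" "v \<circ> (\<lambda>x. q 1 * x) = cscale z' v"
    using u v by (auto simp: rot_type_def cscale_def)
  then have "Q u v = z * cnj z' * Q u v"
    using rot[OF D] D by (simp add: scale_left scale_right scale_mem mult_ac)
  then show ?thesis using z by (simp add: mult_ac)
qed

lemma parity_types_orthogonal:
  assumes u: "u \<in> parity_type bc 1" and v: "v \<in> parity_type bc (-1)"
  shows "Q u v = 0"
proof -
  have D: "u \<in> form_domain bc" "v \<in> form_domain bc" using u v by (auto simp: parity_type_def rot_type_def)
  have "u \<circ> cnj = u" "v \<circ> cnj = cscale (-1) v"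
    using u v by (auto simp: parity_type_def cscale_def)
  then have "Q u v = - Q u v" using refl[OF D] scale_right[OF D(2,1), of "-1"] by simp
  then show ?thesis by simp
qed

text \<open>\<open>Q u\<close> takes the same value on the three rotates of \<open>v\<close>, and
  these add up to zero.\<close>

lemma invariant_standard_orthogonal:
  assumes u: "u \<in> rot_type bc 1" and v: "v \<in> standard_type bc"
  shows "Q u v = 0"
proof -
  have D: "u \<in> form_domain bc" "v \<in> form_domain bc" using u v by (auto simp: rot_type_def standard_type_def)
  let ?\<rho> = "\<lambda>x. q 1 * x"
  have u\<rho>: "u \<circ> ?\<rho> = u" using u by (auto simp: rot_type_def)
  have D': "v \<circ> ?\<rho> \<in> form_domain bc" "v \<circ> ?\<rho> \<circ> ?\<rho> \<in> form_domain bc"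
    using D rotation.comp_form_domain by auto
  have 1: "Q u (v \<circ> ?\<rho>) = Q u v" using rot[OF D] u\<rho> by simp
  have 2: "Q u (v \<circ> ?\<rho> \<circ> ?\<rho>) = Q u v" using rot[OF D(1) D'(1)] u\<rho> 1 by simp
  have "v + (v \<circ> ?\<rho>) + (v \<circ> ?\<rho> \<circ> ?\<rho>) = 0"
    using v q1_facts(1) by (auto simp: standard_type_def fun_eq_iff mult.assoc[symmetric])
  then have "Q u (v + (v \<circ> ?\<rho>) + (v \<circ> ?\<rho> \<circ> ?\<rho>)) = 0" using zero_right D by simp
  then have "Q u v + Q u v + Q u v = 0"
    using D D' 1 2 by (simp add: add_right add_mem)
  then show ?thesis by simp
qed

end

lemma invariant_energy: "invariant_form bc energy"
proof -
  interpret hermitian_form "form_domain bc" energy by (rule hermitian_energy)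
  show ?thesis by unfold_locales (rule rotation.energy_comp reflection.energy_comp)+
qed

lemma invariant_inner: "invariant_form bc inner_\<mu>"
proof -
  have "form_domain bc \<subseteq> gasket_functions" using form_domain_gasket by blast
  then interpret hermitian_form "form_domain bc" inner_\<mu>
    by (rule hermitian_form_subset[OF hermitian_inner form_domain_subspace])
  show ?thesis
    by unfold_locales (rule rotation.inner_comp reflection.inner_comp; erule form_domain_gasket)+
qed

section \<open>Decomposition into symmetry types\<close>

lemma q_mult: "q 1 * (q 1 * x) = q 2 * x" "q 2 * (q 1 * x) = x" "q 1 * (q 2 * x) = x" "q 2 * (q 2 * x) = q 1 * x"
  using q1_facts by (metis mult.assoc mult.commute mult_1)+

lemma invariant_standard_decomposition:
  assumes u: "u \<in> form_domain bc" shows "\<exists>u1\<in>rot_type bc 1. \<exists>u2\<in>standard_type bc. u = u1 + u2"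
proof -
  let ?\<rho> = "\<lambda>x. q 1 * x"
  have D: "u \<circ> ?\<rho> \<in> form_domain bc" "u \<circ> ?\<rho> \<circ> ?\<rho> \<in> form_domain bc" using u rotation.comp_form_domain by auto
  define u1 where "u1 = cscale (1/3) (u + (u \<circ> ?\<rho>) + (u \<circ> ?\<rho> \<circ> ?\<rho>))"
  have u1_apply: "u1 x = (u x + u (q 1 * x) + u (q 2 * x)) / 3" for x
    by (simp add: u1_def cscale_def mult.assoc[symmetric] q1_facts[unfolded One_nat_def])
  have u1D: "u1 \<in> form_domain bc" unfolding u1_def using u D
    by (intro cfun.subspace_scale cfun.subspace_add form_domain_subspace)
  have u1: "u1 \<in> rot_type bc 1" using u1D by (auto simp: rot_type_def u1_apply q_mult[unfolded One_nat_def] add_ac)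
  moreover have "u - u1 \<in> standard_type bc"
  proof -
    have "u x - u1 x + (u (q 1 * x) - u1 (q 1 * x)) + (u (q 2 * x) - u1 (q 2 * x)) = 0" for x
      unfolding u1_apply q_mult by (simp add: field_simps)
    then show ?thesis using u u1D by (simp add: standard_type_def cfun.subspace_diff[OF form_domain_subspace])
  qed
  ultimately show ?thesis by (intro bexI[of _ u1] bexI[of _ "u - u1"]) auto
qed

text \<open>The usual projection onto a character: \<open>z * z\<close> and \<open>z\<close> are the
  inverses of \<open>z\<close> and \<open>z * z\<close>.\<close>

lemma rot_projection:
  assumes u: "u \<in> form_domain bc" and z: "z * z * z = 1"
  shows "(\<lambda>x. (u x + z * z * u (q 1 * x) + z * u (q 2 * x)) / 3) \<in> rot_type bc z"
proof -
  let ?\<rho> = "\<lambda>x. q 1 * x"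
  have D: "u \<circ> ?\<rho> \<in> form_domain bc" "u \<circ> ?\<rho> \<circ> ?\<rho> \<in> form_domain bc" using u rotation.comp_form_domain by auto
  have "cscale (1/3) (u + cscale (z * z) (u \<circ> ?\<rho>) + cscale z (u \<circ> ?\<rho> \<circ> ?\<rho>)) \<in> form_domain bc"
    using u D by (intro cfun.subspace_scale cfun.subspace_add form_domain_subspace)
  also have "cscale (1/3) (u + cscale (z * z) (u \<circ> ?\<rho>) + cscale z (u \<circ> ?\<rho> \<circ> ?\<rho>))
    = (\<lambda>x. (u x + z * z * u (q 1 * x) + z * u (q 2 * x)) / 3)"
    unfolding cscale_def comp_def q_mult plus_fun_def by (simp add: fun_eq_iff)
  finally have fd: "(\<lambda>x. (u x + z * z * u (q 1 * x) + z * u (q 2 * x)) / 3) \<in> form_domain bc" .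
  have "u (q 1 * x) + z * z * u (q 2 * x) + z * u x = z * (u x + z * z * u (q 1 * x) + z * u (q 2 * x))" for x
  proof -
    have "z * (u x + z * z * u (q 1 * x) + z * u (q 2 * x)) = z * u x + (z * z * z) * u (q 1 * x) + z * z * u (q 2 * x)"
      by (simp add: algebra_simps)
    then show ?thesis unfolding z by (simp add: algebra_simps)
  qed
  then show ?thesis unfolding rot_type_def mem_Collect_eq q_mult using fd by simp
qed

text \<open>A function is the sum of its three character projections, and for a function of standard
  type the one for the trivial character vanishes.\<close>

lemma standard_decomposition:
  assumes u: "u \<in> standard_type bc" shows "\<exists>u1\<in>rot_type bc (q 1). \<exists>u2\<in>rot_type bc (q 2). u = u1 + u2"
proof -
  have uD: "u \<in> form_domain bc" using u standard_type_domain by blast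
  have cubes: "q 1 * q 1 * q 1 = 1" "q 2 * q 2 * q 2 = 1" "q 2 * q 2 = q 1"
    using q1_facts by (metis mult.assoc mult.commute mult_1)+
  let ?u = "\<lambda>z x. (u x + z * z * u (q 1 * x) + z * u (q 2 * x)) / 3"
  have "u x = ?u (q 1) x + ?u (q 2) x" for x
  proof -
    have s: "u (q 2 * x) = - u x - u (q 1 * x)"
    proof -
      have "u x + u (q 1 * x) + u (q 2 * x) = 0" using u unfolding standard_type_def by blast
      then show ?thesis by (simp add: algebra_simps eq_neg_iff_add_eq_0)
    qed
    have q2: "q 2 = - 1 - q 1" using q1_facts(3) by (simp add: eq_neg_iff_add_eq_0 eq_diff_eq add_ac)
    have "?u (q 1) x + ?u (q 2) x = (2 * u x + (q 2 + q 1) * (u (q 1 * x) + u (q 2 * x))) / 3"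
      unfolding cubes(3) q1_facts(1) by (simp add: field_simps)
    also have "\<dots> = u x" unfolding s by (simp add: q2)
    finally show ?thesis ..
  qed
  then have "u = ?u (q 1) + ?u (q 2)" by (auto simp: fun_eq_iff)
  then show ?thesis using rot_projection[OF uD cubes(1)] rot_projection[OF uD cubes(2)] by blast
qed

lemma parity_decomposition:
  assumes u: "u \<in> rot_type bc 1" shows "\<exists>u1\<in>parity_type bc 1. \<exists>u2\<in>parity_type bc (-1). u = u1 + u2"
proof -
  have uD: "u \<in> form_domain bc" "u \<circ> cnj \<in> form_domain bc"
    using u reflection.comp_form_domain unfolding rot_type_def by blast+
  have "u (cnj (q 1 * x)) = u (cnj x)" for x
  proof -
    have "cnj (q 1 * x) = q 1 * (q 1 * cnj x)" by (simp only: complex_cnj_mult q1_facts(7) q_mult(1))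
    then have "u (cnj (q 1 * x)) = u (q 1 * (q 1 * cnj x))" by (simp only:)
    then show ?thesis using u by (simp add: rot_type_def)
  qed
  then have uc: "u \<circ> cnj \<in> rot_type bc 1" using uD by (simp add: rot_type_def)
  define u1 where "u1 = cscale (1/2) (u + (u \<circ> cnj))"
  define u2 where "u2 = cscale (1/2) (u - (u \<circ> cnj))"
  have "u1 \<in> rot_type bc 1" "u2 \<in> rot_type bc 1"
    unfolding u1_def u2_def using u uc by (auto intro!: cfun.subspace_scale cfun.subspace_add cfun.subspace_diff rot_type_subspace)
  then have "u1 \<in> parity_type bc 1" "u2 \<in> parity_type bc (-1)"
    by (auto simp: parity_type_def u1_def u2_def cscale_def minus_divide_left)
  moreover have "u = u1 + u2" by (auto simp: u1_def u2_def cscale_def fun_eq_iff field_simps)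
  ultimately show ?thesis by blast
qed

section \<open>Counting functions of symmetry types\<close>

definition eigs :: "(complex \<Rightarrow> complex) set \<Rightarrow> real \<Rightarrow> (complex \<Rightarrow> complex) set" where
  "eigs D s = {u \<in> D. \<forall>v\<in>D. energy u v = of_real s * inner_\<mu> u v}"

definition eigencount :: "(complex \<Rightarrow> complex) set \<Rightarrow> real \<Rightarrow> nat" where
  "eigencount D t = (\<Sum>s | s \<le> t \<and> eigs D s \<noteq> {0}. cfun.dim (eigs D s))"

lemma eigencount_cut:
  assumes "compact_form D energy inner_\<mu>"
  obtains B where "spectral_cut D energy inner_\<mu> t B" "card B = eigencount D t"
proof -
  interpret compact_form D energy inner_\<mu> by fact
  have eq: "eig = eigs D" by (auto simp: eig_def eigs_def)
  show ?thesis
    by (rule spectral_cut_exists[of t], rule that) (simp_all add: eigencount_def eq)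
qed

lemma eigencount_orthogonal_sum:
  assumes D: "compact_form D energy inner_\<mu>" "compact_form D1 energy inner_\<mu>" "compact_form D2 energy inner_\<mu>"
    and sub: "D1 \<subseteq> D" "D2 \<subseteq> D" "cfun.subspace D1" "cfun.subspace D2"
    and orth: "\<And>u v. u \<in> D1 \<Longrightarrow> v \<in> D2 \<Longrightarrow> energy u v = 0 \<and> inner_\<mu> u v = 0"
    and dec: "\<And>u. u \<in> D \<Longrightarrow> \<exists>u1\<in>D1. \<exists>u2\<in>D2. u = u1 + u2"
  shows "eigencount D t = eigencount D1 t + eigencount D2 t"
proof -
  obtain B B1 B2 where B: "spectral_cut D energy inner_\<mu> t B" "card B = eigencount D t"
    "spectral_cut D1 energy inner_\<mu> t B1" "card B1 = eigencount D1 t"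
    "spectral_cut D2 energy inner_\<mu> t B2" "card B2 = eigencount D2 t"
    using eigencount_cut D by metis
  have "card B = card B1 + card B2"
    by (rule compact_form.spectral_cut_orthogonal_sum[OF D(1) B(1,3,5) sub]) (use orth dec in auto)
  then show ?thesis unfolding B(2,4,6) .
qed

lemma eigencount_invariant_standard:
  "eigencount (form_domain bc) t = eigencount (rot_type bc 1) t + eigencount (standard_type bc) t"
  by (rule eigencount_orthogonal_sum[OF compact_form_domain compact_form_rot_type compact_form_standard_type
      rot_type_domain standard_type_domain rot_type_subspace standard_type_subspace _ invariant_standard_decomposition])
    (auto intro: invariant_form.invariant_standard_orthogonal[OF invariant_energy] invariant_form.invariant_standard_orthogonal[OF invariant_inner])

lemma rot_type_standard: "z \<in> {q 1, q 2} \<Longrightarrow> rot_type bc z \<subseteq> standard_type bc"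
proof
  fix u assume z: "z \<in> {q 1, q 2}" and u: "u \<in> rot_type bc z"
  have "1 + z + z * z = 0"
  proof -
    have "q 2 * q 2 = q 1" using q1_facts by (metis mult.assoc mult.commute mult_1)
    then show ?thesis using z q1_facts(1,3) by (auto simp: add_ac)
  qed
  moreover have "u (q 2 * x) = z * z * u x" for x
    using u unfolding q_mult(1)[symmetric] rot_type_def by simp
  moreover have "u (q 1 * x) = z * u x" for x using u by (simp add: rot_type_def)
  ultimately have "u x + u (q 1 * x) + u (q 2 * x) = 0" for x
    by (metis distrib_right mult_1 mult_zero_left)
  then show "u \<in> standard_type bc" using u by (simp add: rot_type_def standard_type_def)
qed

lemma eigencount_standard:
  "eigencount (standard_type bc) t = eigencount (rot_type bc (q 1)) t + eigencount (rot_type bc (q 2)) t"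
proof (rule eigencount_orthogonal_sum[OF compact_form_standard_type compact_form_rot_type compact_form_rot_type
      _ _ rot_type_subspace rot_type_subspace _ standard_decomposition])
  have "q 1 * cnj (q 2) \<noteq> 1" using q1_facts by simp
  then show "energy u v = 0 \<and> inner_\<mu> u v = 0" if "u \<in> rot_type bc (q 1)" "v \<in> rot_type bc (q 2)" for u v
    using that invariant_form.rot_types_orthogonal[OF invariant_energy] invariant_form.rot_types_orthogonal[OF invariant_inner] by blast
qed (auto intro: rot_type_standard[THEN subsetD])

lemma eigencount_parity:
  "eigencount (rot_type bc 1) t = eigencount (parity_type bc 1) t + eigencount (parity_type bc (-1)) t"
  by (rule eigencount_orthogonal_sum[OF compact_form_rot_type compact_form_parity_type compact_form_parity_type
      parity_type_rot parity_type_rot parity_type_subspace parity_type_subspace _ parity_decomposition])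
    (auto intro: invariant_form.parity_types_orthogonal[OF invariant_energy] invariant_form.parity_types_orthogonal[OF invariant_inner])

section \<open>Cutting at vertices\<close>

text \<open>The three boundary vertices of the cell with address \<open>w\<close>.\<close>

primrec corner :: "nat list \<Rightarrow> complex set" where
  "corner [] = V0"
| "corner (i # w) = F i ` corner w"

lemma V_corners: "V m = (\<Union>w\<in>words m. corner w)"
proof (induction m)
  case (Suc m)
  have "(\<Union>w\<in>words (Suc m). corner w) = (\<Union>i<3. F i ` (\<Union>w\<in>words m. corner w))"
    by (auto simp: words_Suc)
  then show ?case using Suc by simp
qed (simp add: words_0)

text \<open>If the first letter were not \<open>j\<close>, the preimage of \<open>q j\<close> would
  have \<open>j\<close>-th coordinate 2, impossible in the gasket. So the letter is
  \<open>j\<close>, which fixes \<open>q j\<close>, and the induction continues.\<close>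

lemma q_in_cell: "set w \<subseteq> {..<3} \<Longrightarrow> j < 3 \<Longrightarrow> q j \<in> cell w \<Longrightarrow> q j \<in> corner w"
proof (induction w)
  case Nil
  then show ?case by (simp add: V0_def)
next
  case (Cons i v)
  then obtain y where y: "y \<in> cell v" "q j = F i y" by auto
  have ySG: "y \<in> SG" using y cell_subset_SG[of v] Cons.prems by auto
  have "i = j"
  proof (rule ccontr)
    assume "i \<noteq> j"
    then have "bary j y = 2"
      using bary_F[of j i y] bary_q[of j j] y Cons.prems by simp
    moreover have "bary j y \<le> 1"
      using bary_sum[of y] bary_nonneg[OF ySG, of 0] bary_nonneg[OF ySG, of 1] bary_nonneg[OF ySG, of 2] Cons.prems(2)
      by (elim less_3_cases) auto
    ultimately show False by simp
  qed
  then have "y = q j" using y F_q[of j] by (metis F_eq_iff)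
  then have "q j \<in> corner v" using Cons y by auto
  then have "F j (q j) \<in> corner (j # v)" unfolding corner.simps by (rule imageI)
  then show ?case using \<open>i = j\<close> by simp
qed

text \<open>After the common prefix the two cells lie in different copies of the gasket, which meet
  in one point; seen from within a copy that point is a vertex of the triangle, hence a corner of
  the cell.\<close>

lemma cells_meet_corner:
  "length w = length w' \<Longrightarrow> set w \<subseteq> {..<3} \<Longrightarrow> set w' \<subseteq> {..<3} \<Longrightarrow> w \<noteq> w' \<Longrightarrow> x \<in> cell w \<Longrightarrow> x \<in> cell w' \<Longrightarrow> x \<in> corner w"
proof (induction w arbitrary: w' x)
  case (Cons i v)
  obtain i' v' where w': "w' = i' # v'" using Cons.prems(1) by (cases w') auto
  obtain y where y: "y \<in> cell v" "x = F i y" using Cons.prems by auto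
  show ?case
  proof (cases "i = i'")
    case True
    then have "y \<in> cell v'" using Cons.prems(6) w' y by auto
    then have "y \<in> corner v" using Cons.IH[of v' y] Cons.prems w' y True by auto
    then show ?thesis using y by simp
  next
    case False
    have "x \<in> F i ` SG" "x \<in> F i' ` SG"
      using y Cons.prems w' cell_subset_SG[of v] cell_subset_SG[of v'] by auto
    then have "x = F i (q i')" using F_image_Int[of i i' x] False Cons.prems w' by auto
    then have "y = q i'" using y by simp
    then have "y \<in> corner v" using q_in_cell[of v i'] y Cons.prems w' by auto
    then show ?thesis using y by simp
  qed
qed auto

section \<open>Multipliers constant on cells\<close>

lemma edges_in_cell: "(x, y) \<in> edges m \<Longrightarrow> n \<le> m \<Longrightarrow> \<exists>w\<in>words n. x \<in> cell w \<and> y \<in> cell w"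
proof (induction n arbitrary: m x y)
  case 0
  then show ?case using edges_V V_subset_SG by (fastforce simp: words_0)
next
  case (Suc n)
  then obtain m' where m': "m = Suc m'" "n \<le> m'" by (cases m) auto
  then obtain i x' y' where i: "i < 3" "(x', y') \<in> edges m'" "x = F i x'" "y = F i y'" using Suc.prems by auto
  obtain w where w: "w \<in> words n" "x' \<in> cell w" "y' \<in> cell w" using Suc.IH[OF i(2) m'(2)] by blast
  have "i # w \<in> words (Suc n)" using i w by (auto simp: words_Suc)
  then show ?case using i w by (intro bexI[of _ "i # w"]) auto
qed

text \<open>An edge of level at least n lies in one cell of level n, where \<open>v\<close> and
  \<open>v'\<close> are constant multiples of \<open>u\<close>; jumps of the factors between cells
  are invisible. The squared moduli of the factors add up to 1, so the energy splits, although
  \<open>v + v'\<close> need not be \<open>u\<close>.\<close>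

lemma cell_multiplier_en:
  assumes v: "\<And>w x. w \<in> words n \<Longrightarrow> x \<in> cell w \<Longrightarrow> v x = c w * u x"
    and v': "\<And>w x. w \<in> words n \<Longrightarrow> x \<in> cell w \<Longrightarrow> v' x = c' w * u x"
    and c: "\<And>w. w \<in> words n \<Longrightarrow> (cmod (c w))\<^sup>2 + (cmod (c' w))\<^sup>2 = 1" and m: "n \<le> m"
  shows "en m v + en m v' = en m u"
proof -
  have "(cmod (v x - v y))\<^sup>2 + (cmod (v' x - v' y))\<^sup>2 = (cmod (u x - u y))\<^sup>2" if xy: "(x, y) \<in> edges m" for x y
  proof -
    obtain w where w: "w \<in> words n" "x \<in> cell w" "y \<in> cell w" using edges_in_cell[OF xy m] by blast
    have "(cmod (v x - v y))\<^sup>2 + (cmod (v' x - v' y))\<^sup>2 = ((cmod (c w))\<^sup>2 + (cmod (c' w))\<^sup>2) * (cmod (u x - u y))\<^sup>2"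
      unfolding v[OF w(1,2)] v[OF w(1,3)] v'[OF w(1,2)] v'[OF w(1,3)] right_diff_distrib[symmetric] norm_mult
      by (simp add: power_mult_distrib distrib_right)
    then show ?thesis using c w by simp
  qed
  then have "(\<Sum>(x, y)\<in>edges m. (cmod (v x - v y))\<^sup>2) + (\<Sum>(x, y)\<in>edges m. (cmod (v' x - v' y))\<^sup>2)
    = (\<Sum>(x, y)\<in>edges m. (cmod (u x - u y))\<^sup>2)"
    unfolding sum.distrib[symmetric] by (intro sum.cong) auto
  then show ?thesis unfolding en_def distrib_left[symmetric] by simp
qed

text \<open>At a point common to several cells the hypothesis on \<open>v\<close> holds for each of
  them, which encodes that \<open>u\<close> vanishes wherever the factors disagree; this makes
  \<open>v\<close> continuous.\<close>

lemma cell_multiplier_domain: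
  assumes u: "u \<in> form_domain bc"
    and v: "\<And>w x. w \<in> words n \<Longrightarrow> x \<in> cell w \<Longrightarrow> v x = c w * u x" "\<And>x. x \<notin> SG \<Longrightarrow> v x = 0"
    and le: "\<And>m. n \<le> m \<Longrightarrow> en m v \<le> en m u"
  shows "v \<in> form_domain bc"
proof -
  have ug: "continuous_on SG u" using u by (simp add: form_domain_iff gasket_functions_def)
  have "continuous_on (\<Union>w\<in>words n. cell w) v"
  proof (rule continuous_on_closed_Union)
    fix w assume w: "w \<in> words n"
    show "closed (cell w)" using compact_cell by (rule compact_imp_closed)
    have "continuous_on (cell w) (\<lambda>x. c w * u x)"
      using cell_subset_SG[of w] w by (intro continuous_intros continuous_on_subset[OF ug]) (auto simp: words_def)
    then show "continuous_on (cell w) v" using v(1)[OF w] by (simp cong: continuous_on_cong_simp)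
  qed (rule finite_words)
  then have "v \<in> gasket_functions" using v(2) by (simp add: SG_cells gasket_functions_def)
  moreover have "en m v \<le> Re (energy u u)" for m
  proof -
    have "en m v \<le> en (max m n) v" by (rule en_mono) simp
    also have "\<dots> \<le> en (max m n) u" by (rule le) simp
    also have "\<dots> \<le> Re (energy u u)" by (rule en_le_energy[OF u])
    finally show ?thesis .
  qed
  moreover have "v x = 0" if "bc = Dirichlet" "x \<in> V0" for x
  proof -
    have "x \<in> SG" using V0_subset_SG that by blast
    then obtain w where "w \<in> words n" "x \<in> cell w" using SG_cells[of n] by blast
    then show ?thesis using v(1) u that by (simp add: form_domain_iff)
  qed
  ultimately show ?thesis by (auto simp: form_domain_iff)
qed

lemma cell_multiplier_split:
  assumes u: "u \<in> form_domain bc"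
    and v: "\<And>w x. w \<in> words n \<Longrightarrow> x \<in> cell w \<Longrightarrow> v x = c w * u x" "\<And>x. x \<notin> SG \<Longrightarrow> v x = 0"
    and v': "\<And>w x. w \<in> words n \<Longrightarrow> x \<in> cell w \<Longrightarrow> v' x = c' w * u x" "\<And>x. x \<notin> SG \<Longrightarrow> v' x = 0"
    and c: "\<And>w. w \<in> words n \<Longrightarrow> (cmod (c w))\<^sup>2 + (cmod (c' w))\<^sup>2 = 1"
  shows "v \<in> form_domain bc" "v' \<in> form_domain bc"
    "Re (energy u u) = Re (energy v v) + Re (energy v' v')"
    "Re (inner_\<mu> u u) = Re (inner_\<mu> v v) + Re (inner_\<mu> v' v')"
proof -
  have en: "en m v + en m v' = en m u" if "n \<le> m" for m
    by (rule cell_multiplier_en[where c = c and c' = c', OF v(1) v'(1) c that])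
  have le: "en m v \<le> en m u" "en m v' \<le> en m u" if "n \<le> m" for m
    using en[OF that] en_nonneg[of m v] en_nonneg[of m v'] by linarith+
  show vD: "v \<in> form_domain bc" by (rule cell_multiplier_domain[OF u v le(1)])
  show vD': "v' \<in> form_domain bc" by (rule cell_multiplier_domain[OF u v' le(2)])
  show "Re (energy u u) = Re (energy v v) + Re (energy v' v')"
  proof (rule LIMSEQ_unique[OF en_tendsto[OF u]])
    have "(\<lambda>m. en m v + en m v') \<longlonglongrightarrow> Re (energy v v) + Re (energy v' v')"
      by (intro tendsto_add en_tendsto[OF vD] en_tendsto[OF vD'])
    moreover have "\<forall>\<^sub>F m in sequentially. en m v + en m v' = en m u"
      unfolding eventually_sequentially using en by blast
    ultimately show "(\<lambda>m. en m u) \<longlonglongrightarrow> Re (energy v v) + Re (energy v' v')"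
      by (rule Lim_transform_eventually)
  qed
  have "(cmod (u x))\<^sup>2 = (cmod (v x))\<^sup>2 + (cmod (v' x))\<^sup>2" for x
  proof (cases "x \<in> SG")
    case True
    then obtain w where w: "w \<in> words n" "x \<in> cell w" using SG_cells[of n] by blast
    show ?thesis unfolding v(1)[OF w] v'(1)[OF w] norm_mult power_mult_distrib distrib_right[symmetric] c[OF w(1)] by simp
  next
    case False
    then show ?thesis using u v(2) v'(2) by (simp add: form_domain_def)
  qed
  then show "Re (inner_\<mu> u u) = Re (inner_\<mu> v v) + Re (inner_\<mu> v' v')"
    using integrable_square_gasket form_domain_gasket vD vD' by (simp add: inner_diagonal)
qed

text \<open>The product of \<open>h\<close> and \<open>u\<close> is the part that is kept,
  \<open>w\<close> the part that is discarded, with quotient above \<open>t\<close>. As energy and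
  squared norm split, the kept part has quotient at most \<open>t\<close> if \<open>u\<close> has;
  and it is not zero, since otherwise the quotient of \<open>u\<close> would be that of
  \<open>w\<close>.\<close>

lemma eigencount_transplant:
  assumes D: "compact_form D energy inner_\<mu>" "D \<subseteq> form_domain bc"
    and D': "compact_form D' energy inner_\<mu>" "D' \<subseteq> form_domain bc"
    and h: "h \<in> borel_measurable borel" "\<And>x. cmod (h x) \<le> 1" and Z: "finite Z"
    and H: "\<And>u. u \<in> D \<Longrightarrow> \<forall>z\<in>Z. u z = 0 \<Longrightarrow> (\<lambda>x. h x * u x) \<in> D' \<and>
      (\<exists>w\<in>form_domain bc. Re (energy u u) = Re (energy (\<lambda>x. h x * u x) (\<lambda>x. h x * u x)) + Re (energy w w) \<and>
        Re (inner_\<mu> u u) = Re (inner_\<mu> (\<lambda>x. h x * u x) (\<lambda>x. h x * u x)) + Re (inner_\<mu> w w) \<and>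
        (w \<noteq> 0 \<longrightarrow> t * Re (inner_\<mu> w w) < Re (energy w w)))"
  shows "eigencount D t \<le> eigencount D' t + card Z"
proof -
  interpret compact_form D energy inner_\<mu> by fact
  obtain B where B: "spectral_cut D energy inner_\<mu> t B" "card B = eigencount D t"
    using eigencount_cut[OF D(1)] by blast
  obtain B' where B': "spectral_cut D' energy inner_\<mu> t B'" "card B' = eigencount D' t"
    using eigencount_cut[OF D'(1)] by blast
  have finB: "finite B" and BG: "B \<subseteq> gasket_functions" and BG': "B' \<subseteq> gasket_functions"
    using B(1) B'(1) D(2) D'(2) form_domain_gasket by (auto simp: spectral_cut_def)
  define T where "T u = (\<lambda>x. h x * u x)" for u :: "complex \<Rightarrow> complex"
  have "card B \<le> card B' + card Z"
  proof (rule spectral_cut_transplant[OF B(1) B'(1) Z, of T])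
    fix c b' assume b': "b' \<in> B'"
    have int: "integrable \<mu> (\<lambda>x. h x * b x * cnj (b' x))" if "b \<in> B" for b
    proof (rule Bochner_Integration.integrable_bound)
      show i: "integrable \<mu> (\<lambda>x. b x * cnj (b' x))" using that b' BG BG' by (intro integrable_mult_gasket) auto
      have [measurable]: "(\<lambda>x. b x * cnj (b' x)) \<in> borel_measurable \<mu>" using i by auto
      have [measurable]: "h \<in> borel_measurable borel" by fact
      show "(\<lambda>x. h x * b x * cnj (b' x)) \<in> borel_measurable \<mu>" unfolding mult.assoc by measurable
      show "AE x in \<mu>. norm (h x * b x * cnj (b' x)) \<le> norm (b x * cnj (b' x))"
        using h(2) by (auto simp: norm_mult mult.assoc intro!: mult_left_le_one_le)
    qed
    have "inner_\<mu> (T (lincomb c B)) b' = (LINT x|\<mu>. (\<Sum>b\<in>B. c b * (h x * b x * cnj (b' x))))"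
      unfolding inner_\<mu>_def T_def lincomb_apply
      by (intro Bochner_Integration.integral_cong refl) (simp add: sum_distrib_left sum_distrib_right mult_ac)
    also have "\<dots> = (\<Sum>b\<in>B. c b * (LINT x|\<mu>. h x * b x * cnj (b' x)))"
      using int by (subst Bochner_Integration.integral_sum) auto
    finally show "inner_\<mu> (T (lincomb c B)) b' = (\<Sum>b\<in>B. c b * inner_\<mu> (T b) b')"
      by (simp add: inner_\<mu>_def T_def)
  next
    fix u assume u: "u \<in> D" "u \<noteq> 0" "\<forall>z\<in>Z. u z = 0" and le: "Re (energy u u) \<le> t * Re (inner_\<mu> u u)"
    obtain w where w: "T u \<in> D'" "w \<in> form_domain bc"
      "Re (energy u u) = Re (energy (T u) (T u)) + Re (energy w w)"
      "Re (inner_\<mu> u u) = Re (inner_\<mu> (T u) (T u)) + Re (inner_\<mu> w w)"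
      "w \<noteq> 0 \<longrightarrow> t * Re (inner_\<mu> w w) < Re (energy w w)"
      using H[OF u(1,3)] unfolding T_def by blast
    have zero: "energy 0 0 = 0" "inner_\<mu> 0 0 = 0" using E.zero_left P.zero_left E.zero_mem by auto
    have "t * Re (inner_\<mu> w w) \<le> Re (energy w w)" using w(5) zero by (cases "w = 0") auto
    then have "Re (energy (T u) (T u)) \<le> t * Re (inner_\<mu> (T u) (T u))"
      using le unfolding w(3,4) by (simp add: algebra_simps)
    moreover have "T u \<noteq> 0"
    proof
      assume Tu: "T u = 0"
      have "0 < Re (inner_\<mu> u u)" using inner_pos u by blast
      then have "w \<noteq> 0" using w(4) Tu zero by auto
      then show False using w le Tu zero by simp
    qed
    ultimately show "T u \<in> D' \<and> T u \<noteq> 0 \<and> Re (energy (T u) (T u)) \<le> t * Re (inner_\<mu> (T u) (T u))"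
      using w by blast
  qed
  then show ?thesis using B B' by simp
qed

subsection \<open>Changing the rotation character\<close>

lemma words_1: "words (Suc 0) = {[0], [1], [2]}"
  by (auto simp: words_Suc words_0 lessThan_3)

lemma norm_cube_root: "z * z * z = 1 \<Longrightarrow> cmod z = 1"
proof -
  assume "z * z * z = 1"
  then have "cmod z ^ 3 = 1" by (simp add: norm_mult[symmetric] power3_eq_cube)
  then show ?thesis using power_eq_imp_eq_base[of "cmod z" 3 1] by simp
qed

lemma rotated_midpoints: "q 1 * F 1 (q 2) = F 2 (q 0)" "q 1 * F 2 (q 0) = F 0 (q 1)"
  using rotation.F_commute[of 1 "q 2"] rotation.vertex[of 2] rotation.F_commute[of 2 "q 0"] rotation.vertex[of 0]
  by (simp_all add: numeral_2_eq_2)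

text \<open>The factors on the three copies are 1, c and c^2. One prescribed zero suffices, because
  the character carries it to all three junction points. Nothing is discarded, so the error does not
  depend on \<open>t\<close>.\<close>

lemma eigencount_rot_le:
  assumes z: "z * z * z = 1" "z' * z' * z' = 1"
  shows "eigencount (rot_type bc z) t \<le> eigencount (rot_type bc z') t + 1"
proof -
  \<comment> \<open>This is z'/z, because \<open>z * z\<close> is the inverse of
    \<open>z\<close>.\<close>
  define c where "c = z' * (z * z)"
  have cz: "c * z = z'" using z(1) by (simp add: c_def mult.assoc)
  have cz2: "c * (c * (c * a)) = a" for a
  proof -
    have "c * (c * (c * a)) = (z' * z' * z') * (z * z * z) * (z * z * z) * a" by (simp add: c_def mult_ac)
    then show ?thesis by (simp add: z)
  qed
  have c3: "c * (c * c) = 1" using cz2[of 1] by simp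
  have nc: "cmod c = 1" using norm_cube_root[OF z(1)] norm_cube_root[OF z(2)] by (simp add: c_def norm_mult)
  \<comment> \<open>Junction points receive the factor of the first copy that contains them;
    \<open>u\<close> is zero there.\<close>
  define h where "h x = (if x \<in> cell [0] then 1 else if x \<in> cell [1] then c else if x \<in> cell [2] then c * c else 0)" for x
  have h_meas: "h \<in> borel_measurable borel" unfolding h_def by measurable
  have h_le: "cmod (h x) \<le> 1" for x by (simp add: h_def nc norm_mult)
  define \<gamma> where "\<gamma> w = (if w = [0::nat] then 1 else if w = [1] then c else c * c)" for w
  have "eigencount (rot_type bc z) t \<le> eigencount (rot_type bc z') t + card {F 1 (q 2)}"
  proof (rule eigencount_transplant[OF compact_form_rot_type rot_type_domain compact_form_rot_type rot_type_domain h_meas h_le])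
    fix u assume u: "u \<in> rot_type bc z" and "\<forall>y\<in>{F 1 (q 2)}. u y = 0"
    then have m12: "u (F 1 (q 2)) = 0" by simp
    have uD: "u \<in> form_domain bc" and ur: "u (q 1 * x) = z * u x" for x using u by (auto simp: rot_type_def)
    have m20: "u (F 2 (q 0)) = 0" using ur[of "F 1 (q 2)"] m12 unfolding rotated_midpoints(1) by simp
    have m01: "u (F 0 (q 1)) = 0" using ur[of "F 2 (q 0)"] m20 unfolding rotated_midpoints(2) by simp
    have meet: "u x = 0" if "x \<in> cell [i]" "x \<in> cell [j]" "i < 3" "j < 3" "i \<noteq> j" for x i j
    proof -
      have "x = F i (q j)" using F_image_Int[of i j x] that by simp
      then show ?thesis using that(3-5) m01 m12 m20
        by (elim less_3_cases) (auto simp: F_q_commute[of "Suc 0" 0] F_q_commute[of 2 "Suc 0"] F_q_commute[of 0 2])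
    qed
    define v where "v = (\<lambda>x. h x * u x)"
    have v: "v x = \<gamma> w * u x" if w: "w \<in> words (Suc 0)" "x \<in> cell w" for w x
      using w meet[of x 0 1] meet[of x 0 2] meet[of x 1 2] unfolding words_1
      by (auto simp: v_def h_def \<gamma>_def simp del: cell_Cons cell_Nil)
    have v0: "v x = 0" if "x \<notin> SG" for x using that uD by (simp add: v_def form_domain_def)
    have n\<gamma>: "(cmod (\<gamma> w))\<^sup>2 + (cmod 0)\<^sup>2 = 1" for w by (simp add: \<gamma>_def nc norm_mult)
    note split = cell_multiplier_split[where n = "Suc 0" and v = v and c = \<gamma> and v' = 0 and c' = "\<lambda>_. 0", OF uD v v0 _ _ n\<gamma>]
    have "v (q 1 * x) = z' * v x" for x
    proof (cases "x \<in> SG")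
      case True
      then obtain w where w: "w \<in> words (Suc 0)" "x \<in> cell w" using SG_cells[of "Suc 0"] by blast
      define w' where "w' = map (\<lambda>i. (i + 1) mod 3) w"
      have sw: "set w \<subseteq> {..<3}" using w by (auto simp: words_def)
      have "q 1 * x \<in> cell w'" using rotation.image_cell[OF sw] w(2) unfolding w'_def by blast
      moreover have w': "w' \<in> words (Suc 0)" using w unfolding w'_def words_1 by (auto simp: numeral_2_eq_2)
      ultimately have "v (q 1 * x) = \<gamma> w' * (z * u x)" using v ur by simp
      \<comment> \<open>From copy 2 back to copy 0 the factor has to change from c^2 to 1, which is
        multiplication by c since c is a cube root of unity.\<close>
      also have "\<gamma> w' * (z * u x) = z' * (\<gamma> w * u x)"
        using w(1) unfolding words_1 w'_def cz[symmetric] by (auto simp: \<gamma>_def numeral_2_eq_2 mult_ac cz2 c3)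
      also have "\<gamma> w * u x = v x" using v w by simp
      finally show ?thesis .
    next
      case False
      then show ?thesis using v0 rotation.SG_iff[of x] by simp
    qed
    then have "v \<in> rot_type bc z'" using split(1) by (simp add: rot_type_def)
    then show "(\<lambda>x. h x * u x) \<in> rot_type bc z' \<and>
      (\<exists>w\<in>form_domain bc. Re (energy u u) = Re (energy (\<lambda>x. h x * u x) (\<lambda>x. h x * u x)) + Re (energy w w) \<and>
        Re (inner_\<mu> u u) = Re (inner_\<mu> (\<lambda>x. h x * u x) (\<lambda>x. h x * u x)) + Re (inner_\<mu> w w) \<and>
        (w \<noteq> 0 \<longrightarrow> t * Re (inner_\<mu> w w) < Re (energy w w)))"
      using split unfolding v_def by (intro conjI bexI[of _ 0]) auto
  qed simp
  then show ?thesis by simp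
qed

subsection \<open>Changing the parity\<close>

context gasket_symmetry
begin

lemma image_corner: "set w \<subseteq> {..<3} \<Longrightarrow> g ` corner w = corner (map p w)"
proof (induction w)
  case (Cons i w)
  then have IH: "g ` corner w = corner (map p w)" and i: "i < 3" by auto
  have "g ` corner (i # w) = F (p i) ` (g ` corner w)" using i by (simp add: image_image F_commute)
  then show ?case unfolding IH by simp
qed (simp add: image_V0)

end

section \<open>Tip cells and the chambers between the axes\<close>

definition tips :: "nat \<Rightarrow> complex set" where
  "tips n = (\<Union>i<3. cell (replicate n i))"

lemma borel_tips [measurable]: "tips n \<in> sets borel"
  unfolding tips_def by (intro sets.finite_UN) auto

lemma (in gasket_symmetry) tips_iff: "g x \<in> tips n \<longleftrightarrow> x \<in> tips n"
proof -
  have "g ` tips n = (\<Union>i<3. cell (replicate n (p i)))"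
    unfolding tips_def image_UN
  proof (rule SUP_cong[OF refl])
    fix i :: nat assume "i \<in> {..<3}"
    then have "set (replicate n i) \<subseteq> {..<3}" by auto
    then show "g ` cell (replicate n i) = cell (replicate n (p i))"
      using image_cell[of "replicate n i"] by (simp add: map_replicate)
  qed
  also have "\<dots> = tips n" unfolding tips_def by (rule UN_perm)
  finally show ?thesis using inj by (metis inj_image_mem_iff)
qed

lemma replicate_words: "i < 3 \<Longrightarrow> replicate n i \<in> words n"
  by (auto simp: words_def)

lemma SG_bounds:
  assumes "x \<in> SG" shows "- 1 / 2 \<le> Re x" "sqrt 3 * \<bar>Im x\<bar> \<le> 1 - Re x"
  using bary_nonneg[OF assms, of 0] bary_nonneg[OF assms, of 1] bary_nonneg[OF assms, of 2]
  by (auto simp: bary_simps abs_if)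

lemma Im_F: "Im (F 0 x) = Im x / 2" "Im (F 1 x) = Im x / 2 + sqrt 3 / 4" "Im (F 2 x) = Im x / 2 - sqrt 3 / 4"
  by (auto simp: F_def q_simps)

lemma Im_SG_bound: "x \<in> SG \<Longrightarrow> \<bar>Im x\<bar> \<le> sqrt 3 / 2"
proof -
  assume "x \<in> SG"
  then have "sqrt 3 * \<bar>Im x\<bar> \<le> 3 / 2" using SG_bounds[of x] by linarith
  then have "sqrt 3 * (sqrt 3 * \<bar>Im x\<bar>) \<le> sqrt 3 * (3 / 2)" by (intro mult_left_mono) auto
  moreover have "sqrt 3 * (sqrt 3 * \<bar>Im x\<bar>) = 3 * \<bar>Im x\<bar>" by (simp add: mult.assoc[symmetric])
  ultimately show ?thesis by linarith
qed

text \<open>In copies 1 and 2 the imaginary part is shifted by sqrt 3 / 4 up or down and deviates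
  from that by no more than the same amount; in copy 0 it is merely halved. So only the cell at
  \<open>q 0\<close> can cross the real axis.\<close>

lemma cell_half_plane:
  "set w \<subseteq> {..<3} \<Longrightarrow> w \<noteq> replicate (length w) 0 \<Longrightarrow> (\<forall>x\<in>cell w. 0 \<le> Im x) \<or> (\<forall>x\<in>cell w. Im x \<le> 0)"
proof (induction w)
  case (Cons i v)
  have sub: "\<And>y. y \<in> cell v \<Longrightarrow> \<bar>Im y\<bar> \<le> sqrt 3 / 2" using Im_SG_bound cell_subset_SG[of v] Cons.prems by auto
  have "i < 3" using Cons.prems by simp
  then show ?case
  proof (elim less_3_cases)
    assume "i = 0"
    then have "(\<forall>x\<in>cell v. 0 \<le> Im x) \<or> (\<forall>x\<in>cell v. Im x \<le> 0)" using Cons by auto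
    then show ?thesis using \<open>i = 0\<close> by (auto simp: Im_F)
  next
    assume "i = 1"
    then show ?thesis using sub by (fastforce simp: Im_F[unfolded One_nat_def] abs_le_iff)
  next
    assume "i = 2"
    then show ?thesis using sub by (fastforce simp: Im_F abs_le_iff)
  qed
qed auto

text \<open>The three axes of reflection are the lines on which the imaginary part of the cube vanishes.\<close>

lemma Im_cube: "Im (x ^ 3) = Im x * ((sqrt 3 * Re x - Im x) * (sqrt 3 * Re x + Im x))"
proof -
  have "(sqrt 3 * Re x - Im x) * (sqrt 3 * Re x + Im x) = (sqrt 3 * sqrt 3) * (Re x * Re x) - Im x * Im x"
    by (simp only: algebra_simps)
  also have "\<dots> = 3 * (Re x * Re x) - Im x * Im x" by simp
  finally show ?thesis by (simp add: power3_eq_cube algebra_simps)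
qed

text \<open>The copy at \<open>q 0\<close> lies between the two other axes and touches them only at
  \<open>F 0 (q 1)\<close> and \<open>F 0 (q 2)\<close>. Apart from these two points, the imaginary
  part of x ^ 3 has there the sign of that of x.\<close>

lemma F0_sector:
  assumes "y \<in> SG"
  shows "0 \<le> sqrt 3 * Re (F 0 y) - Im (F 0 y)" "0 \<le> sqrt 3 * Re (F 0 y) + Im (F 0 y)"
    and "sqrt 3 * Re (F 0 y) = Im (F 0 y) \<Longrightarrow> y = q 1" "sqrt 3 * Re (F 0 y) = - Im (F 0 y) \<Longrightarrow> y = q 2"
proof -
  have ReF: "Re (F 0 y) = Re y / 2 + 1 / 2" "Im (F 0 y) = Im y / 2" by (auto simp: F_def q_simps)
  note b = SG_bounds[OF assms]
  have s: "sqrt 3 * (sqrt 3 * r) = 3 * r" for r by (simp add: mult.assoc[symmetric])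
  have pos: "0 \<le> r" if "0 \<le> sqrt 3 * r" for r using that by (simp add: zero_le_mult_iff)
  have e1: "sqrt 3 * (sqrt 3 * Re (F 0 y) - Im (F 0 y)) = (3 * Re y + 3 - sqrt 3 * Im y) / 2"
    unfolding ReF by (simp add: algebra_simps)
  have e2: "sqrt 3 * (sqrt 3 * Re (F 0 y) + Im (F 0 y)) = (3 * Re y + 3 + sqrt 3 * Im y) / 2"
    unfolding ReF by (simp add: algebra_simps)
  have a: "sqrt 3 * Im y \<le> sqrt 3 * \<bar>Im y\<bar>" "- (sqrt 3 * Im y) \<le> sqrt 3 * \<bar>Im y\<bar>" by (auto simp: abs_if)
  define m where "m = sqrt 3 * Im y"
  note e1 = e1[folded m_def] and e2 = e2[folded m_def]
  note c = b(1) order_trans[OF a(1) b(2), folded m_def] order_trans[OF a(2) b(2), folded m_def]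
  have "0 \<le> (3 * Re y + 3 - m) / 2" using c by (simp add: field_simps)
  then have "0 \<le> sqrt 3 * (sqrt 3 * Re (F 0 y) - Im (F 0 y))" by (simp only: e1)
  then show "0 \<le> sqrt 3 * Re (F 0 y) - Im (F 0 y)" by (rule pos)
  have "0 \<le> (3 * Re y + 3 + m) / 2" using c by (simp add: field_simps)
  then have "0 \<le> sqrt 3 * (sqrt 3 * Re (F 0 y) + Im (F 0 y))" by (simp only: e2)
  then show "0 \<le> sqrt 3 * Re (F 0 y) + Im (F 0 y)" by (rule pos)
  have Im_eq: "Im y = r" if "sqrt 3 * Im y = sqrt 3 * r" for r using that by simp
  show "y = q 1" if "sqrt 3 * Re (F 0 y) = Im (F 0 y)"
  proof -
    have "3 * Re y + 3 - m = 0" using e1 that by simp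
    then have "Re y = - 1 / 2" "m = 3 / 2" using c by linarith+
    then show ?thesis using Im_eq[of "sqrt 3 / 2"] by (simp add: q_simps complex_eq_iff m_def)
  qed
  show "y = q 2" if "sqrt 3 * Re (F 0 y) = - Im (F 0 y)"
  proof -
    have "3 * Re y + 3 + m = 0" using e2 that by simp
    then have "Re y = - 1 / 2" "m = - 3 / 2" using c by linarith+
    then show ?thesis using Im_eq[of "- sqrt 3 / 2"] by (simp add: q_simps complex_eq_iff m_def)
  qed
qed

lemma cube_rotation: "(q 1 * x) ^ 3 = x ^ 3"
  using q1_facts(1,2) by (simp add: power_mult_distrib power3_eq_cube mult.assoc)

lemma cell_chamber_0:
  assumes w: "0 # v \<in> words n" "0 # v \<noteq> replicate n 0"
  shows "(\<forall>x\<in>cell (0 # v). 0 \<le> Im (x ^ 3)) \<or> (\<forall>x\<in>cell (0 # v). Im (x ^ 3) \<le> 0)"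
proof -
  have sv: "set v \<subseteq> {..<3}" using w by (auto simp: words_def)
  have sector: "0 \<le> (sqrt 3 * Re x - Im x) * (sqrt 3 * Re x + Im x)" if "x \<in> cell (0 # v)" for x
    using that F0_sector cell_subset_SG[OF sv] by (auto intro!: mult_nonneg_nonneg)
  have "(\<forall>x\<in>cell (0 # v). 0 \<le> Im x) \<or> (\<forall>x\<in>cell (0 # v). Im x \<le> 0)"
    using w by (intro cell_half_plane) (auto simp: words_def)
  then show ?thesis
  proof
    assume "\<forall>x\<in>cell (0 # v). 0 \<le> Im x"
    then show ?thesis unfolding Im_cube by (intro disjI1 ballI mult_nonneg_nonneg[OF _ sector]) auto
  next
    assume "\<forall>x\<in>cell (0 # v). Im x \<le> 0"
    then show ?thesis unfolding Im_cube by (intro disjI2 ballI mult_nonpos_nonneg[OF _ sector]) auto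
  qed
qed

definition rot_word :: "nat list \<Rightarrow> nat list" where
  "rot_word w = map (\<lambda>i. (i + 1) mod 3) w"

lemma rot_word_words: "w \<in> words n \<Longrightarrow> rot_word w \<in> words n"
  by (auto simp: words_def rot_word_def)

lemma rot_cell: "w \<in> words n \<Longrightarrow> x \<in> cell w \<longleftrightarrow> q 1 * x \<in> cell (rot_word w)"
proof -
  assume "w \<in> words n"
  then have "(\<lambda>x. q 1 * x) ` cell w = cell (rot_word w)"
    unfolding rot_word_def by (intro rotation.image_cell) (auto simp: words_def)
  then show ?thesis using rotation.inj by (metis inj_image_mem_iff)
qed

lemma rot_word_thrice: "w \<in> words n \<Longrightarrow> rot_word (rot_word (rot_word w)) = w"
proof -
  have "(((i + 1) mod 3 + 1) mod 3 + 1) mod 3 = i" if "i < 3" for i :: nat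
    using that by (elim less_3_cases) auto
  then show "w \<in> words n \<Longrightarrow> ?thesis" by (auto simp: rot_word_def words_def comp_def intro!: map_idI)
qed

lemma rot_word_replicate: "rot_word (replicate n i) = replicate n ((i + 1) mod 3)"
  by (simp add: rot_word_def map_replicate)

text \<open>Every nonempty word starts with 0 after at most two rotations, so a property that passes
  back along rotations has to be checked only in the copy at \<open>q 0\<close>.\<close>

lemma word_rotation_induct:
  assumes w: "w \<in> words n" "0 < n" and step: "\<And>w. w \<in> words n \<Longrightarrow> R (rot_word w) \<Longrightarrow> R w"
    and base: "\<And>v. 0 # v \<in> words n \<Longrightarrow> R (0 # v)"
  shows "R w"
proof -
  obtain i v where iv: "w = i # v" using w by (cases w) (auto simp: words_def)
  have i: "i < 3" using w iv by (auto simp: words_def)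
  note ww = rot_word_words[OF w(1)] rot_word_words[OF rot_word_words[OF w(1)]]
  show ?thesis
    using i
  proof (elim less_3_cases)
    assume "i = 0"
    then show ?thesis using base w iv by simp
  next
    assume "i = 1"
    then have "rot_word (rot_word w) = 0 # tl (rot_word (rot_word w))" by (simp add: iv rot_word_def numeral_2_eq_2)
    then have "R (rot_word (rot_word w))" using base ww(2) by metis
    then show ?thesis using step w ww by blast
  next
    assume "i = 2"
    then have "rot_word w = 0 # tl (rot_word w)" by (simp add: iv rot_word_def numeral_2_eq_2)
    then have "R (rot_word w)" using base ww(1) by metis
    then show ?thesis using step w ww by blast
  qed
qed

text \<open>Rotation preserves x ^ 3, so the copy at \<open>q 0\<close> is enough, and there
  \<open>cell_half_plane\<close> decides the sign.\<close>

lemma cell_chamber: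
  assumes w: "w \<in> words n" "0 < n" and nt: "w \<notin> (\<lambda>i. replicate n i) ` {..<3}"
  shows "(\<forall>x\<in>cell w. 0 \<le> Im (x ^ 3)) \<or> (\<forall>x\<in>cell w. Im (x ^ 3) \<le> 0)"
proof -
  have "w \<notin> (\<lambda>i. replicate n i) ` {..<3} \<longrightarrow> (\<forall>x\<in>cell w. 0 \<le> Im (x ^ 3)) \<or> (\<forall>x\<in>cell w. Im (x ^ 3) \<le> 0)"
    using w
  proof (rule word_rotation_induct)
    fix w assume w: "w \<in> words n" and IH: "rot_word w \<notin> (\<lambda>i. replicate n i) ` {..<3} \<longrightarrow>
      (\<forall>x\<in>cell (rot_word w). 0 \<le> Im (x ^ 3)) \<or> (\<forall>x\<in>cell (rot_word w). Im (x ^ 3) \<le> 0)"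
    show "w \<notin> (\<lambda>i. replicate n i) ` {..<3} \<longrightarrow> (\<forall>x\<in>cell w. 0 \<le> Im (x ^ 3)) \<or> (\<forall>x\<in>cell w. Im (x ^ 3) \<le> 0)"
    proof
      assume nt: "w \<notin> (\<lambda>i. replicate n i) ` {..<3}"
      have "rot_word w \<notin> (\<lambda>i. replicate n i) ` {..<3}"
      proof
        assume "rot_word w \<in> (\<lambda>i. replicate n i) ` {..<3}"
        then obtain i where "rot_word w = replicate n i" by auto
        then have "w = replicate n ((((i + 1) mod 3) + 1) mod 3)"
          using rot_word_thrice[OF w] rot_word_replicate by metis
        then show False using nt by auto
      qed
      then show "(\<forall>x\<in>cell w. 0 \<le> Im (x ^ 3)) \<or> (\<forall>x\<in>cell w. Im (x ^ 3) \<le> 0)"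
        using IH rot_cell[OF w] cube_rotation by metis
    qed
  next
    fix v assume v: "0 # v \<in> words n"
    have "0 # v \<noteq> replicate n 0" if "0 # v \<notin> (\<lambda>i. replicate n i) ` {..<3}"
      using that by (metis imageI lessThan_iff zero_less_numeral)
    then show "0 # v \<notin> (\<lambda>i. replicate n i) ` {..<3} \<longrightarrow>
      (\<forall>x\<in>cell (0 # v). 0 \<le> Im (x ^ 3)) \<or> (\<forall>x\<in>cell (0 # v). Im (x ^ 3) \<le> 0)"
      using cell_chamber_0[OF v] by blast
  qed
  then show ?thesis using nt by blast
qed

text \<open>In copies 1 and 2 a real point comes from a point of extreme imaginary part, so it is
  the junction \<open>F 1 (q 2)\<close>; in copy 0 the situation repeats itself at half the scale,
  which produces the iterates of \<open>F 0\<close>.\<close>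

lemma real_axis:
  "x \<in> SG \<Longrightarrow> Im x = 0 \<Longrightarrow> x \<in> cell (replicate n 0) \<or> (\<exists>k<n. x = (F 0 ^^ k) (F 1 (q 2)))"
proof (induction n arbitrary: x)
  case (Suc n)
  obtain i y where iy: "i < 3" "y \<in> SG" "x = F i y" using Suc.prems(1) by (rule SG_cases)
  note b = SG_bounds[OF iy(2)]
  have Im_eq: "Im y = r" if "sqrt 3 * Im y = sqrt 3 * r" for r using that by simp
  from iy(1) show ?case
  proof (elim less_3_cases)
    assume i: "i = 0"
    then have "Im y = 0" using Suc.prems(2) iy by (simp add: Im_F)
    then have "y \<in> cell (replicate n 0) \<or> (\<exists>k<n. y = (F 0 ^^ k) (F 1 (q 2)))" using Suc.IH iy by blast
    then show ?thesis
    proof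
      assume "\<exists>k<n. y = (F 0 ^^ k) (F 1 (q 2))"
      then obtain k where "k < n" "y = (F 0 ^^ k) (F 1 (q 2))" by blast
      then have "Suc k < Suc n" "x = (F 0 ^^ Suc k) (F 1 (q 2))" using iy i by auto
      then show ?thesis by blast
    qed (use iy i in auto)
  next
    assume i: "i = 1"
    then have Imy: "Im y = - sqrt 3 / 2" using Suc.prems(2) iy Im_F(2)[of y] by simp
    have "sqrt 3 * \<bar>Im y\<bar> = 3 / 2" unfolding Imy by simp
    with b have "Re y = - 1 / 2" by linarith
    with Imy have "y = q 2" by (simp add: q_simps complex_eq_iff)
    then have "x = (F 0 ^^ 0) (F 1 (q 2))" using iy i by simp
    then show ?thesis by blast
  next
    assume i: "i = 2"
    then have Imy: "Im y = sqrt 3 / 2" using Suc.prems(2) iy Im_F(3)[of y] by simp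
    have "sqrt 3 * \<bar>Im y\<bar> = 3 / 2" unfolding Imy by simp
    with b have "Re y = - 1 / 2" by linarith
    with Imy have "y = q 1" by (simp add: q_simps complex_eq_iff)
    then have "x = (F 0 ^^ 0) (F 1 (q 2))" using iy i F_q_commute[of 2 1] by simp
    then show ?thesis by blast
  qed
qed auto

text \<open>Zeros at these points propagate, by symmetry, to all points of the three axes outside the cells
  of level n at the vertices and to the corners of those cells.\<close>

definition cut_points :: "nat \<Rightarrow> complex set" where
  "cut_points n = (\<lambda>k. (F 0 ^^ k) (F 1 (q 2))) ` {..<n} \<union> {(F 0 ^^ n) (q 1), q 0}"

lemma card_cut_points: "finite (cut_points n)" "card (cut_points n) \<le> n + 2"
proof -
  show "finite (cut_points n)" by (simp add: cut_points_def)
  have "card (cut_points n) \<le> card ((\<lambda>k. (F 0 ^^ k) (F 1 (q 2))) ` {..<n}) + card {(F 0 ^^ n) (q 1), q 0}"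
    unfolding cut_points_def by (rule card_Un_le)
  also have "\<dots> \<le> n + 2"
    using card_image_le[of "{..<n}" "\<lambda>k. (F 0 ^^ k) (F 1 (q 2))"] card_insert_le_m1[of 2 "{q 0}" "(F 0 ^^ n) (q 1)"] by simp
  finally show "card (cut_points n) \<le> n + 2" .
qed

lemma corner_replicate: "corner (replicate n i) = (F i ^^ n) ` V0"
  by (induction n) (auto simp: image_comp)

lemma cnj_F0_power: "cnj ((F 0 ^^ n) x) = (F 0 ^^ n) (cnj x)"
  by (induction n) (simp_all add: reflection.F_commute swap12_def)

context
  fixes u bc s n
  assumes u: "u \<in> parity_type bc s" and zero: "\<And>z. z \<in> cut_points n \<Longrightarrow> u z = 0" and n: "0 < n"
begin

lemma parity_rot: "u (q 1 * x) = u x" and parity_cnj: "u (cnj x) = s * u x"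
  using u by (auto simp: parity_type_def rot_type_def)

text \<open>By parity a zero at the corner coming from \<open>q 1\<close> of the tip at
  \<open>q 0\<close> gives one at the corner coming from \<open>q 2\<close>, and rotation reaches
  the other tips; so two prescribed zeros cover the corners of all three tips.\<close>

lemma zero_tip_corners: "i < 3 \<Longrightarrow> x \<in> corner (replicate n i) \<Longrightarrow> u x = 0"
proof -
  have c0: "u x = 0" if "x \<in> corner (replicate n 0)" for x
  proof -
    have "(F 0 ^^ n) (q 0) = q 0" by (induction n) auto
    moreover have "(F 0 ^^ n) (q 2) = cnj ((F 0 ^^ n) (q 1))"
      using q1_facts(7) by (simp only: cnj_F0_power)
    ultimately have "x \<in> {q 0, (F 0 ^^ n) (q 1), cnj ((F 0 ^^ n) (q 1))}"
      using that by (auto simp: corner_replicate V0_eq)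
    moreover have "u ((F 0 ^^ n) (q 1)) = 0" "u (q 0) = 0" by (rule zero; simp add: cut_points_def)+
    ultimately show ?thesis by (auto simp: parity_cnj simp del: complex_cnj_mult)
  qed
  have img: "(\<lambda>x. q 1 * x) ` corner (replicate n i) = corner (replicate n ((i + 1) mod 3))" if "i < 3" for i
  proof -
    have "set (replicate n i) \<subseteq> {..<3}" using that by auto
    from rotation.image_corner[OF this] show ?thesis by (simp add: map_replicate)
  qed
  have c1: "u x = 0" if "x \<in> corner (replicate n 1)" for x
  proof -
    have "x \<in> (\<lambda>x. q 1 * x) ` corner (replicate n 0)" using img[of 0] that by simp
    then show ?thesis using c0 parity_rot by auto
  qed
  have c2: "u x = 0" if "x \<in> corner (replicate n 2)" for x
  proof -
    have "x \<in> (\<lambda>x. q 1 * x) ` corner (replicate n 1)" using img[of 1] that by (simp add: numeral_2_eq_2)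
    then show ?thesis using c1 parity_rot by auto
  qed
  show "i < 3 \<Longrightarrow> x \<in> corner (replicate n i) \<Longrightarrow> ?thesis" using c0 c1 c2 by (elim less_3_cases) blast+
qed

lemma zero_tip_boundary:
  assumes w: "w \<in> words n" "w \<notin> (\<lambda>i. replicate n i) ` {..<3}" and x: "x \<in> cell w" "x \<in> tips n"
  shows "u x = 0"
proof -
  obtain i where i: "i < 3" "x \<in> cell (replicate n i)" using x by (auto simp: tips_def)
  have "replicate n i \<noteq> w" using w(2) i(1) by auto
  then have "x \<in> corner (replicate n i)"
    using cells_meet_corner[of "replicate n i" w x] w x i replicate_words[OF i(1), of n] by (auto simp: words_def)
  then show ?thesis using zero_tip_corners i by blast
qed

lemma zero_midpoint: "u (F 1 (q 2)) = 0" "u (F 2 (q 0)) = 0" "u (F 0 (q 1)) = 0"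
proof -
  have "(F 0 ^^ 0) (F 1 (q 2)) \<in> cut_points n" unfolding cut_points_def using n by blast
  then show 1: "u (F 1 (q 2)) = 0" using zero by simp
  show 2: "u (F 2 (q 0)) = 0" using parity_rot[of "F 1 (q 2)"] 1 unfolding rotated_midpoints(1) by simp
  show "u (F 0 (q 1)) = 0" using parity_rot[of "F 2 (q 0)"] 2 unfolding rotated_midpoints(2) by simp
qed

text \<open>Rotation reduces to the copy at \<open>q 0\<close>, where the axes contribute the points
  of \<open>real_axis\<close> and the two junction points \<open>F 0 (q 1)\<close> and
  \<open>F 0 (q 2)\<close>.\<close>

lemma zero_axes:
  assumes x: "x \<in> SG" "x \<notin> tips n" "Im (x ^ 3) = 0"
  shows "u x = 0"
proof -
  have "\<forall>x\<in>cell w. x \<notin> tips n \<longrightarrow> Im (x ^ 3) = 0 \<longrightarrow> u x = 0" if "w \<in> words n" for w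
    using that n
  proof (rule word_rotation_induct)
    fix w assume w: "w \<in> words n" and IH: "\<forall>x\<in>cell (rot_word w). x \<notin> tips n \<longrightarrow> Im (x ^ 3) = 0 \<longrightarrow> u x = 0"
    show "\<forall>x\<in>cell w. x \<notin> tips n \<longrightarrow> Im (x ^ 3) = 0 \<longrightarrow> u x = 0"
      using IH rot_cell[OF w] cube_rotation rotation.tips_iff parity_rot by metis
  next
    fix v assume v: "0 # v \<in> words n"
    show "\<forall>x\<in>cell (0 # v). x \<notin> tips n \<longrightarrow> Im (x ^ 3) = 0 \<longrightarrow> u x = 0"
    proof (intro ballI impI)
      fix x assume x: "x \<in> cell (0 # v)" "x \<notin> tips n" "Im (x ^ 3) = 0"
      then obtain y where y: "y \<in> SG" "x = F 0 y" using cell_subset_SG[of v] v by (auto simp: words_def)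
      consider "Im x = 0" | "sqrt 3 * Re x = Im x" | "sqrt 3 * Re x = - Im x"
        using x(3) unfolding Im_cube by (auto simp: eq_neg_iff_add_eq_0)
      then show "u x = 0"
      proof cases
        case 1
        have "x \<notin> cell (replicate n 0)" using x(2) by (auto simp: tips_def)
        moreover have "x \<in> SG" using y F_SG[of 0] by simp
        ultimately obtain k where "k < n" "x = (F 0 ^^ k) (F 1 (q 2))" using real_axis[of x n] 1 by blast
        then show ?thesis by (intro zero) (auto simp: cut_points_def)
      next
        case 2
        then have "x = F 0 (q 1)" using F0_sector(3)[OF y(1)] y(2) by simp
        then show ?thesis using zero_midpoint by simp
      next
        case 3
        then have "x = F 0 (q 2)" using F0_sector(4)[OF y(1)] y(2) by simp
        then show ?thesis using zero_midpoint by (simp add: F_q_commute[of 0 2])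
      qed
    qed
  qed
  moreover obtain w where "w \<in> words n" "x \<in> cell w" using SG_cells[of n] x(1) by blast
  ultimately show ?thesis using x by blast
qed

end

text \<open>The factor is the sign of the imaginary part of x ^ 3 off the tips and 0 on them. This
  sign is invariant under rotation and odd under complex conjugation, so the parity changes. The
  discarded restriction of \<open>u\<close> to the tips vanishes on \<open>V n\<close>, and
  \<open>Poincare_strict\<close> puts its quotient above \<open>t\<close>.\<close>

lemma eigencount_parity_le:
  assumes s: "s \<in> {1, -1}" and n: "0 < n" "25 * t < 5 ^ n"
  shows "eigencount (parity_type bc s) t \<le> eigencount (parity_type bc (- s)) t + (n + 2)"
proof -
  define h :: "complex \<Rightarrow> complex" where
    "h x = (if x \<in> tips n then 0 else if Im (x ^ 3) > 0 then 1 else if Im (x ^ 3) < 0 then -1 else 0)" for x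
  have [measurable]: "Im \<in> borel_measurable borel" by (intro borel_measurable_continuous_onI continuous_intros)
  have h_meas: "h \<in> borel_measurable borel" unfolding h_def by measurable
  have h_le: "cmod (h x) \<le> 1" for x by (simp add: h_def)
  have dom: "parity_type bc r \<subseteq> form_domain bc" for r using parity_type_rot rot_type_domain by blast
  let ?tip = "\<lambda>w. w \<in> (\<lambda>i. replicate n i) ` {..<3}"
  \<comment> \<open>Outside the tip cells the last alternative means that the imaginary part of x ^
    3 is \<le> 0 on the whole cell, by \<open>cell_chamber\<close>.\<close>
  define \<gamma> :: "nat list \<Rightarrow> complex" where
    "\<gamma> w = (if ?tip w then 0 else if \<forall>x\<in>cell w. 0 \<le> Im (x ^ 3) then 1 else -1)" for w
  define \<gamma>' :: "nat list \<Rightarrow> complex" where "\<gamma>' w = (if ?tip w then 1 else 0)" for w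
  have "eigencount (parity_type bc s) t \<le> eigencount (parity_type bc (- s)) t + card (cut_points n)"
  proof (rule eigencount_transplant[OF compact_form_parity_type dom compact_form_parity_type dom h_meas h_le card_cut_points(1)])
    fix u assume u: "u \<in> parity_type bc s" and z: "\<forall>z\<in>cut_points n. u z = 0"
    have zero: "\<And>z. z \<in> cut_points n \<Longrightarrow> u z = 0" using z by blast
    have uD: "u \<in> form_domain bc" using u dom by blast
    have ur: "u (q 1 * x) = u x" and uc: "u (cnj x) = s * u x" for x
      using u by (auto simp: parity_type_def rot_type_def)
    have off: "u x = 0" if "x \<notin> SG" for x using uD that by (simp add: form_domain_def)
    define v where "v = (\<lambda>x. h x * u x)"
    define v' where "v' x = (if x \<in> tips n then u x else 0)" for x
    have in_tips: "x \<in> tips n" if "?tip w" "x \<in> cell w" for x w using that by (auto simp: tips_def)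
    have v: "v x = \<gamma> w * u x" if w: "w \<in> words n" "x \<in> cell w" for w x
    proof (cases "?tip w")
      case True
      then show ?thesis using in_tips[OF True w(2)] by (simp add: v_def h_def \<gamma>_def)
    next
      case False
      have xSG: "x \<in> SG" using w SG_cells[of n] by blast
      show ?thesis
      proof (cases "x \<in> tips n \<or> Im (x ^ 3) = 0")
        case True
        then have "u x = 0"
          using zero_tip_boundary[OF u zero n(1) w(1) False w(2)] zero_axes[OF u zero n(1) xSG] by blast
        then show ?thesis by (simp add: v_def)
      next
        case ne: False
        have "h x = \<gamma> w"
        proof (cases "\<forall>x\<in>cell w. 0 \<le> Im (x ^ 3)")
          case True
          then have "0 < Im (x ^ 3)" using ne w(2) by (simp add: order_less_le)
          then show ?thesis using ne False True by (simp add: h_def \<gamma>_def)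
        next
          case neg: False
          then have "\<forall>x\<in>cell w. Im (x ^ 3) \<le> 0" using cell_chamber[OF w(1) n(1) False] by blast
          then have "Im (x ^ 3) < 0" using ne w(2) by (simp add: order_less_le)
          moreover have "\<gamma> w = -1" unfolding \<gamma>_def using False neg by argo
          ultimately show ?thesis using ne by (simp add: h_def)
        qed
        then show ?thesis by (simp add: v_def)
      qed
    qed
    have v': "v' x = \<gamma>' w * u x" if w: "w \<in> words n" "x \<in> cell w" for w x
      using in_tips[OF _ w(2)] zero_tip_boundary[OF u zero n(1) w(1) _ w(2)] by (auto simp: v'_def \<gamma>'_def)
    have v0: "v x = 0" "v' x = 0" if "x \<notin> SG" for x using off[OF that] by (simp_all add: v_def v'_def)
    have n\<gamma>: "(cmod (\<gamma> w))\<^sup>2 + (cmod (\<gamma>' w))\<^sup>2 = 1" for w by (simp add: \<gamma>_def \<gamma>'_def)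
    note split = cell_multiplier_split[where n = n and v = v and c = \<gamma> and v' = v' and c' = \<gamma>', OF uD v v0(1) v' v0(2) n\<gamma>]
    have "v (q 1 * x) = v x" for x
      unfolding v_def h_def cube_rotation rotation.tips_iff ur ..
    moreover have "v (cnj x) = - s * v x" for x
    proof -
      have "Im (cnj x ^ 3) = - Im (x ^ 3)" by (simp add: complex_cnj_power[symmetric] del: complex_cnj_power)
      then have "h (cnj x) = - h x" unfolding h_def reflection.tips_iff by auto
      then show ?thesis unfolding v_def uc by simp
    qed
    ultimately have vP: "v \<in> parity_type bc (- s)" using split(1) by (simp add: parity_type_def rot_type_def)
    \<comment> \<open>A vertex of level n in a tip cell is one of its corners, where
      \<open>u\<close> is zero; at the other vertices \<open>v'\<close> is cut off.\<close>
    have v'V: "v' x = 0" if xV: "x \<in> V n" for x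
    proof (cases "x \<in> tips n")
      case True
      obtain w where w: "w \<in> words n" "x \<in> corner w" using xV V_corners by auto
      obtain i where i: "i < 3" "x \<in> cell (replicate n i)" using True by (auto simp: tips_def)
      have corner_cell: "corner w \<subseteq> cell w" for w using V0_subset_SG by (induction w) auto
      have "x \<in> corner (replicate n i)"
        using cells_meet_corner[of "replicate n i" w x] w i corner_cell[of w] replicate_words[OF i(1), of n]
        by (cases "w = replicate n i") (auto simp: words_def)
      then show ?thesis using zero_tip_corners[OF u zero n(1) i(1)] by (simp add: v'_def)
    qed (simp add: v'_def)
    have "v' \<noteq> 0 \<longrightarrow> t * Re (inner_\<mu> v' v') < Re (energy v' v')"
      using Poincare_strict[OF split(2) _ v'V n(2)] by blast
    then show "(\<lambda>x. h x * u x) \<in> parity_type bc (- s) \<and>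
      (\<exists>w\<in>form_domain bc. Re (energy u u) = Re (energy (\<lambda>x. h x * u x) (\<lambda>x. h x * u x)) + Re (energy w w) \<and>
        Re (inner_\<mu> u u) = Re (inner_\<mu> (\<lambda>x. h x * u x) (\<lambda>x. h x * u x)) + Re (inner_\<mu> w w) \<and>
        (w \<noteq> 0 \<longrightarrow> t * Re (inner_\<mu> w w) < Re (energy w w)))"
      using vP split unfolding v_def by blast
  qed
  then show ?thesis using card_cut_points(2)[of n] by linarith
qed

section \<open>Isotypic subspaces\<close>

lemma q2_facts: "q 2 * q 1 = 1" "q 2 * q 2 = q 1" "cnj (q 2) = q 1" "cnj (q 0) = q 0" "q 0 = 1"
  by (auto simp: q_simps complex_eq_iff)

lemma q_cnj_mult: "q k * cnj (q k) = 1" "cnj (q k) * q k = 1"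
  using complex_norm_square[of "q k"] by (auto simp: norm_q mult.commute)

text \<open>Expanding the squares, the difference of the squared norms is 3 times the difference of
  the i-th barycentric coordinates, for every i. The coordinates of a point sum to 1, so this
  difference is 0 and all coordinates agree.\<close>

lemma point_determined_by_distances:
  assumes "\<And>i. i < 3 \<Longrightarrow> dist x (q i) = dist y (q i)" shows "x = y"
proof -
  have eq: "(Re x - Re (q i))\<^sup>2 + (Im x - Im (q i))\<^sup>2 = (Re y - Re (q i))\<^sup>2 + (Im y - Im (q i))\<^sup>2" if "i < 3" for i
  proof -
    have "(dist x (q i))\<^sup>2 = (dist y (q i))\<^sup>2" using assms[OF that] by simp
    then show ?thesis by (simp add: dist_norm cmod_power2)
  qed
  have n: "(Re (q i))\<^sup>2 + (Im (q i))\<^sup>2 = 1" for i using norm_q[of i] cmod_power2[of "q i"] by simp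
  define S where "S = (Re x)\<^sup>2 + (Im x)\<^sup>2 - ((Re y)\<^sup>2 + (Im y)\<^sup>2)"
  have S: "S = 3 * (bary i x - bary i y)" if "i < 3" for i
  proof -
    have b: "3 * bary i z = 1 + 2 * (Re z * Re (q i) + Im z * Im (q i))" for z by (simp add: bary_def)
    show ?thesis using eq[OF that] unfolding S_def right_diff_distrib b by (simp add: power2_eq_square algebra_simps)
  qed
  have "S = 0" using S[of 0] S[of 1] S[of 2] bary_sum[of x] bary_sum[of y] by simp
  then show ?thesis using S by (intro bary_eqI) auto
qed

lemma V0_rotated: "k < 3 \<Longrightarrow> V0 = {q k, q k * q 1, q k * q 2}"
  by (elim less_3_cases) (auto simp: V0_eq q2_facts[unfolded One_nat_def] q1_facts[unfolded One_nat_def])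

lemma dist_rotation: "dist (q k * x) (q k * y) = dist x y"
  unfolding dist_norm right_diff_distrib[symmetric] norm_mult norm_q by simp

lemma dist_cnj: "dist (cnj x) (cnj y) = dist x y"
  unfolding dist_norm complex_cnj_diff[symmetric] complex_mod_cnj ..

text \<open>An isometry permutes the vertices and is determined by their images; the image of
  \<open>q 0\<close> and the order of the two others leave the six listed maps.\<close>

lemma D3_cases:
  assumes g: "g \<in> D3"
  obtains k where "k < 3" "g = (\<lambda>x. q k * x)" | k where "k < 3" "g = (\<lambda>x. q k * cnj x)"
proof -
  have iso: "dist (g x) (g y) = dist x y" for x y using g by (simp add: D3_def)
  have V: "g ` V0 = V0" using g by (simp add: D3_def)
  have ne: "g (q i) \<noteq> g (q j)" if "i < 3" "j < 3" "i \<noteq> j" for i j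
    using iso[of "q i" "q j"] q_eq_iff[OF that(1,2)] that(3) by auto
  have determined: "g = h" if h: "\<And>x y. dist (h x) (h y) = dist x y" "\<And>i. i < 3 \<Longrightarrow> h (q i) = g (q i)" for h
  proof
    fix x
    show "g x = h x"
    proof (rule point_determined_by_distances)
      fix j :: nat assume "j < 3"
      then have "q j \<in> g ` V0" unfolding V by (auto simp: V0_def)
      then obtain i where i: "i < 3" "q j = g (q i)" by (auto simp: V0_def)
      have "dist (g x) (g (q i)) = dist (h x) (h (q i))" unfolding iso h(1) ..
      then show "dist (g x) (q j) = dist (h x) (q j)" using h(2)[OF i(1)] i(2) by simp
    qed
  qed
  have mem: "g (q i) \<in> V0" if "i < 3" for i using V that by (auto simp: V0_def)
  obtain k where k: "k < 3" "g (q 0) = q k" using mem[of 0] by (auto simp: V0_def)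
  note d1 = dist_rotation[of k]
  have d2: "dist (q k * cnj x) (q k * cnj y) = dist x y" for x y
    unfolding d1 by (rule dist_cnj)
  have V': "g (q 1) \<in> {q k, q k * q 1, q k * q 2}" "g (q 2) \<in> {q k, q k * q 1, q k * q 2}"
    using mem[of 1] mem[of 2] unfolding V0_rotated[OF k(1)] by simp_all
  have m: "g (q 1) \<in> {q k * q 1, q k * q 2}" "g (q 2) \<in> {q k * q 1, q k * q 2}" "g (q 1) \<noteq> g (q 2)"
    using V' ne[of 0 1] ne[of 0 2] ne[of 1 2] k(2) by auto
  then consider "g (q 1) = q k * q 1" "g (q 2) = q k * q 2" | "g (q 1) = q k * q 2" "g (q 2) = q k * q 1"
    by auto
  then show ?thesis
  proof cases
    case 1
    have "g = (\<lambda>x. q k * x)"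
    proof (rule determined[OF d1])
      fix i :: nat assume "i < 3"
      then show "q k * q i = g (q i)" using 1 k q2_facts(5) by (elim less_3_cases) auto
    qed
    then show ?thesis using that(1) k by blast
  next
    case 2
    have "g = (\<lambda>x. q k * cnj x)"
    proof (rule determined[OF d2])
      fix i :: nat assume "i < 3"
      then show "q k * cnj (q i) = g (q i)" using 2 k q2_facts(3-5) q1_facts(7) by (elim less_3_cases) auto
    qed
    then show ?thesis using that(2) k by blast
  qed
qed

lemma rotations_D3: "k < 3 \<Longrightarrow> (\<lambda>x. q k * x) \<in> D3"
proof -
  assume k: "k < 3"
  have "(\<lambda>x. q k * x) ` V0 = {q k * q 0, q k * q 1, q k * q 2}"
    unfolding V0_eq by (simp only: image_insert image_empty)
  also have "\<dots> = V0" unfolding V0_rotated[OF k] q2_facts(5) by (simp only: mult_1_right)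
  finally have "(\<lambda>x. q k * x) ` V0 = V0" .
  then show ?thesis by (simp add: D3_def dist_rotation)
qed

lemma cnj_D3: "cnj \<in> D3"
  using reflection.image_V0 by (simp add: D3_def dist_cnj)

lemma inv_rotation: "inv (\<lambda>x. q k * x) = (\<lambda>x. cnj (q k) * x)"
  by (rule inv_unique_comp) (auto simp: fun_eq_iff mult.assoc[symmetric] q_cnj_mult)

lemma inv_reflection: "inv (\<lambda>x. q k * cnj x) = (\<lambda>x. q k * cnj x)"
  by (rule inv_unique_comp) (auto simp: fun_eq_iff mult.assoc[symmetric] q_cnj_mult)

lemma inv_cnj: "inv cnj = cnj"
  by (rule inv_unique_comp) (auto simp: fun_eq_iff)

lemma plane_matrix_rotation:
  "plane_matrix (\<lambda>x. q k * x) 0 0 = Re (q k)" "plane_matrix (\<lambda>x. q k * x) 1 0 = Im (q k)"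
  "plane_matrix (\<lambda>x. q k * x) 0 1 = - Im (q k)" "plane_matrix (\<lambda>x. q k * x) 1 1 = Re (q k)"
  by (auto simp: plane_matrix_def)

lemma plane_matrix_reflection:
  "plane_matrix (\<lambda>x. q k * cnj x) 0 0 = Re (q k)" "plane_matrix (\<lambda>x. q k * cnj x) 1 0 = Im (q k)"
  "plane_matrix (\<lambda>x. q k * cnj x) 0 1 = Im (q k)" "plane_matrix (\<lambda>x. q k * cnj x) 1 1 = - Re (q k)"
  by (auto simp: plane_matrix_def)

lemma norm_q_parts: "Re (q k) * Re (q k) + Im (q k) * Im (q k) = 1"
  using norm_q[of k] cmod_power2[of "q k"] by (simp add: power2_eq_square)

lemma irrep_1: "irrep 1 (\<lambda>x. q k * x) 0 0 = 1" "irrep 1 (\<lambda>x. q k * cnj x) 0 0 = -1"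
proof -
  have det: "Re (q k) * Re (q k) - - Im (q k) * Im (q k) = 1" "Re (q k) * - Re (q k) - Im (q k) * Im (q k) = -1"
    using norm_q_parts[of k] by simp_all
  show "irrep 1 (\<lambda>x. q k * x) 0 0 = 1" "irrep 1 (\<lambda>x. q k * cnj x) 0 0 = -1"
    unfolding irrep_def plane_matrix_rotation plane_matrix_reflection det by simp_all
qed

lemma irrep_2: "irrep 2 g l k = of_real (plane_matrix g l k)"
  by (simp add: irrep_def)

section \<open>Relations satisfied by isotypic functions\<close>

lemma gasket_functions_L2: "gasket_functions \<subseteq> L2"
  using integrable_square_gasket gasket_functions_measurable by (auto simp: L2_def)

lemma gasket_function_AE_zero:
  assumes "u \<in> gasket_functions" "AE x in \<mu>. u x = 0" shows "u = 0"
proof (rule ccontr)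
  assume "u \<noteq> 0"
  then have "0 < Re (inner_\<mu> u u)" using inner_pos assms(1) by blast
  moreover have "(LINT x|\<mu>. (cmod (u x))\<^sup>2) = 0" using assms(2) by (intro integral_eq_zero_AE) auto
  ultimately show False by (simp add: inner_diagonal)
qed

lemma L2_measurable: "f \<in> L2 \<Longrightarrow> f \<in> borel_measurable borel"
  by (simp add: L2_def cong: measurable_cong_sets)

lemma L2_subspace: "cfun.subspace L2"
proof (rule cfun.subspaceI)
  show "0 \<in> L2" by (simp add: L2_def zero_fun_def)
  fix f g :: "complex \<Rightarrow> complex" and c assume f: "f \<in> L2" and g: "g \<in> L2"
  have [measurable]: "f \<in> borel_measurable borel" "g \<in> borel_measurable borel" using f g L2_measurable by auto
  have "integrable \<mu> (\<lambda>x. (cmod (f x + g x))\<^sup>2)"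
  proof (rule Bochner_Integration.integrable_bound)
    show "integrable \<mu> (\<lambda>x. 2 * (cmod (f x))\<^sup>2 + 2 * (cmod (g x))\<^sup>2)" using f g by (auto simp: L2_def)
    show "AE x in \<mu>. norm ((cmod (f x + g x))\<^sup>2) \<le> norm (2 * (cmod (f x))\<^sup>2 + 2 * (cmod (g x))\<^sup>2)"
      using cmod_add_squared_le by auto
  qed measurable
  then show "f + g \<in> L2" using f g by (simp add: L2_def plus_fun_def)
  have "integrable \<mu> (\<lambda>x. (cmod c)\<^sup>2 * (cmod (f x))\<^sup>2)" using f by (auto simp: L2_def)
  then show "cscale c f \<in> L2" using f by (simp add: L2_def cscale_def norm_mult power_mult_distrib)
qed

lemma AE_rotation: "AE x in \<mu>. Q x \<Longrightarrow> AE x in \<mu>. Q (q 1 * x)" "AE x in \<mu>. Q x \<Longrightarrow> AE x in \<mu>. Q (q 2 * x)"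
  using rotation.AE_comp[of Q] rotation.AE_comp[OF rotation.AE_comp[of Q]] unfolding q_mult by auto

text \<open>One shape for rotation invariance, parity and zero average over the rotations.\<close>

definition satisfies :: "complex \<Rightarrow> complex \<Rightarrow> complex \<Rightarrow> (complex \<Rightarrow> complex) \<Rightarrow> (complex \<Rightarrow> complex) \<Rightarrow> (complex \<Rightarrow> complex) \<Rightarrow> bool" where
  "satisfies a b c g1 g2 f \<longleftrightarrow> (AE x in \<mu>. a * f x + b * f (g1 x) + c * f (g2 x) = 0)"

text \<open>The operator \<open>R\<close> is bounded on square integrable functions because the
  symmetries preserve the measure; so a relation valid on the generating subspaces passes to their
  span and to its closure.\<close>

lemma satisfies_isotypic:
  assumes g: "gasket_symmetry g1 p1" "gasket_symmetry g2 p2"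
    and V: "\<And>W f. acts_as j W \<Longrightarrow> f \<in> W \<Longrightarrow> f \<in> L2 \<and> satisfies a b c g1 g2 f"
    and f: "f \<in> isotypic j"
  shows "satisfies a b c g1 g2 f"
proof -
  interpret g1: gasket_symmetry g1 p1 by fact
  interpret g2: gasket_symmetry g2 p2 by fact
  have fL2: "f \<in> L2" using f by (simp add: isotypic_def)
  define R where "R h x = a * h x + b * h (g1 x) + c * h (g2 x)" for h :: "complex \<Rightarrow> complex" and x
  have sub: "cfun.subspace {h \<in> L2. AE x in \<mu>. R h x = 0}"
  proof (rule cfun.subspaceI)
    show "0 \<in> {h \<in> L2. AE x in \<mu>. R h x = 0}" using cfun.subspace_0[OF L2_subspace] by (simp add: R_def)
    fix h k s assume h: "h \<in> {h \<in> L2. AE x in \<mu>. R h x = 0}" and k: "k \<in> {h \<in> L2. AE x in \<mu>. R h x = 0}"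
    have "R (h + k) x = R h x + R k x" "R (cscale s h) x = s * R h x" for x
      by (simp_all add: R_def cscale_def algebra_simps)
    then show "h + k \<in> {h \<in> L2. AE x in \<mu>. R h x = 0}" "cscale s h \<in> {h \<in> L2. AE x in \<mu>. R h x = 0}"
      using h k cfun.subspace_add[OF L2_subspace] cfun.subspace_scale[OF L2_subspace] by auto
  qed
  have "\<Union>{W. acts_as j W} \<subseteq> {h \<in> L2. AE x in \<mu>. R h x = 0}" using V by (auto simp: satisfies_def R_def)
  then have span: "cfun.span (\<Union>{W. acts_as j W}) \<subseteq> {h \<in> L2. AE x in \<mu>. R h x = 0}"
    using sub by (rule cfun.span_minimal)
  \<comment> \<open>The factor 4 comes from two applications of |a + b|^2 \<le> 2 |a|^2 + 2
    |b|^2.\<close>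
  define K where "K = 4 * ((cmod a)\<^sup>2 + (cmod b)\<^sup>2 + (cmod c)\<^sup>2)"
  have K0: "0 \<le> K" by (simp add: K_def)
  have [measurable]: "f \<in> borel_measurable borel" using fL2 L2_measurable by auto
  have bound: "integrable \<mu> (\<lambda>x. (cmod (R d x))\<^sup>2) \<and> (LINT x|\<mu>. (cmod (R d x))\<^sup>2) \<le> K * (LINT x|\<mu>. (cmod (d x))\<^sup>2)"
    if d: "d \<in> L2" for d
  proof -
    have [measurable]: "d \<in> borel_measurable borel" using d L2_measurable by auto
    have i: "integrable \<mu> (\<lambda>x. (cmod (d x))\<^sup>2)" using d by (simp add: L2_def)
    note i1 = g1.integrable_comp[OF i] and i2 = g2.integrable_comp[OF i]
    have sq: "(\<lambda>x. (cmod (d x))\<^sup>2) \<in> borel_measurable borel" by measurable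
    let ?b = "\<lambda>x. 4 * (cmod a)\<^sup>2 * (cmod (d x))\<^sup>2 + 4 * (cmod b)\<^sup>2 * (cmod (d (g1 x)))\<^sup>2 + 4 * (cmod c)\<^sup>2 * (cmod (d (g2 x)))\<^sup>2"
    have le: "(cmod (R d x))\<^sup>2 \<le> ?b x" for x
    proof -
      have "(cmod (R d x))\<^sup>2 \<le> 2 * (cmod (a * d x + b * d (g1 x)))\<^sup>2 + 2 * (cmod (c * d (g2 x)))\<^sup>2"
        unfolding R_def by (rule cmod_add_squared_le)
      also have "\<dots> \<le> 2 * (2 * (cmod (a * d x))\<^sup>2 + 2 * (cmod (b * d (g1 x)))\<^sup>2) + 4 * (cmod (c * d (g2 x)))\<^sup>2"
        by (intro add_mono mult_left_mono cmod_add_squared_le) auto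
      finally show ?thesis by (simp add: norm_mult power_mult_distrib)
    qed
    have ib: "integrable \<mu> ?b" using i i1 i2 by auto
    have iR: "integrable \<mu> (\<lambda>x. (cmod (R d x))\<^sup>2)"
    proof (rule Bochner_Integration.integrable_bound[OF ib])
      show "(\<lambda>x. (cmod (R d x))\<^sup>2) \<in> borel_measurable \<mu>" unfolding R_def by measurable
      show "AE x in \<mu>. norm ((cmod (R d x))\<^sup>2) \<le> norm (?b x)" using le by auto
    qed
    have "(LINT x|\<mu>. (cmod (R d x))\<^sup>2) \<le> (LINT x|\<mu>. ?b x)" using iR ib le by (intro integral_mono) auto
    also have "\<dots> = K * (LINT x|\<mu>. (cmod (d x))\<^sup>2)"
      using i i1 i2 g1.integral_comp[OF sq] g2.integral_comp[OF sq] by (simp add: K_def algebra_simps)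
    finally show ?thesis using iR by simp
  qed
  have small: "(LINT x|\<mu>. (cmod (R f x))\<^sup>2) \<le> K * \<epsilon>\<^sup>2" if \<epsilon>: "0 < \<epsilon>" for \<epsilon>
  proof -
    obtain h where h: "h \<in> cfun.span (\<Union>{W. acts_as j W})" "L2_norm (f - h) < \<epsilon>"
      using f \<epsilon> by (auto simp: isotypic_def)
    have hL2: "h \<in> L2" and Rh: "AE x in \<mu>. R h x = 0" using h(1) span by auto
    have dL2: "f - h \<in> L2" using fL2 hL2 cfun.subspace_diff[OF L2_subspace] by blast
    have "R (f - h) x = R f x - R h x" for x by (simp add: R_def algebra_simps)
    then have eq: "AE x in \<mu>. (cmod (R f x))\<^sup>2 = (cmod (R (f - h) x))\<^sup>2" using Rh by auto
    have [measurable]: "h \<in> borel_measurable borel" using hL2 L2_measurable by auto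
    have "(LINT x|\<mu>. (cmod (R f x))\<^sup>2) = (LINT x|\<mu>. (cmod (R (f - h) x))\<^sup>2)"
      using eq unfolding R_def minus_apply by (intro integral_cong_AE) measurable
    also have "\<dots> \<le> K * (LINT x|\<mu>. (cmod ((f - h) x))\<^sup>2)" using bound[OF dL2] by blast
    also have "(LINT x|\<mu>. (cmod ((f - h) x))\<^sup>2) = (L2_norm (f - h))\<^sup>2" by (simp add: L2_norm_def)
    also have "K * (L2_norm (f - h))\<^sup>2 \<le> K * \<epsilon>\<^sup>2"
      using h(2) K0 by (intro mult_left_mono power_mono) (auto simp: L2_norm_def)
    finally show ?thesis .
  qed
  have "(LINT x|\<mu>. (cmod (R f x))\<^sup>2) \<le> 0"
  proof (rule field_le_epsilon)
    fix e :: real assume e: "0 < e"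
    define \<epsilon> where "\<epsilon> = sqrt (e / (K + 1))"
    have "0 < \<epsilon>" using e K0 by (simp add: \<epsilon>_def)
    then have "(LINT x|\<mu>. (cmod (R f x))\<^sup>2) \<le> K * (e / (K + 1))" using small[of \<epsilon>] e K0 by (simp add: \<epsilon>_def)
    also have "\<dots> \<le> e" using e K0 by (simp add: field_simps)
    finally show "(LINT x|\<mu>. (cmod (R f x))\<^sup>2) \<le> 0 + e" by simp
  qed
  then have "(LINT x|\<mu>. (cmod (R f x))\<^sup>2) = 0" by (simp add: order_antisym)
  then have "AE x in \<mu>. (cmod (R f x))\<^sup>2 = 0"
    using bound[OF fL2] by (subst (asm) integral_nonneg_eq_0_iff_AE) auto
  then show ?thesis unfolding satisfies_def R_def by simp
qed

lemma acts_as_relation_1d: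
  assumes V: "acts_as j W" "f \<in> W" and j: "j \<noteq> 2" and g: "g \<in> D3" "gasket_symmetry (inv g) p"
  shows "AE x in \<mu>. f (inv g x) = irrep j g 0 0 * f x"
proof -
  interpret g: gasket_symmetry "inv g" p by fact
  have d: "irrep_dim j = 1" using j by (simp add: irrep_dim_def)
  obtain e where e: "W = {f \<in> L2. \<exists>c. AE x in \<mu>. f x = (\<Sum>k<irrep_dim j. c k * e k x)}"
    "\<forall>g\<in>D3. \<forall>k<irrep_dim j. AE x in \<mu>. e k (inv g x) = (\<Sum>l<irrep_dim j. irrep j g l k * e l x)"
    using V(1) unfolding acts_as_def by blast
  obtain c where c: "AE x in \<mu>. f x = c (0::nat) * e 0 x" using V(2) e(1) d by auto
  have "AE x in \<mu>. e 0 (inv g x) = irrep j g 0 0 * e 0 x" using e(2) g d by auto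
  then show ?thesis using c g.AE_comp[OF c] by eventually_elim simp
qed

text \<open>The matrices of the identity and of the two rotations have sum zero, because 1 + q 1 + q
  2 = 0.\<close>

lemma acts_as_relation_2d:
  assumes V: "acts_as 2 W" "f \<in> W"
  shows "satisfies 1 1 1 (\<lambda>x. q 1 * x) (\<lambda>x. q 2 * x) f"
proof -
  have d: "irrep_dim 2 = 2" by (simp add: irrep_dim_def)
  obtain e where e: "W = {f \<in> L2. \<exists>c. AE x in \<mu>. f x = (\<Sum>k<irrep_dim 2. c k * e k x)}"
    "\<forall>g\<in>D3. \<forall>k<irrep_dim 2. AE x in \<mu>. e k (inv g x) = (\<Sum>l<irrep_dim 2. irrep 2 g l k * e l x)"
    using V(1) unfolding acts_as_def by blast
  have two: "(\<Sum>k<2. h k) = h 0 + h (1::nat)" for h :: "nat \<Rightarrow> complex" by (simp add: numeral_2_eq_2)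
  obtain c where c: "AE x in \<mu>. f x = c 0 * e 0 x + c (1::nat) * e 1 x" using V(2) e(1) d two by auto
  have rel: "AE x in \<mu>. e k (cnj (q m) * x) = irrep 2 (\<lambda>x. q m * x) 0 k * e 0 x + irrep 2 (\<lambda>x. q m * x) 1 k * e 1 x"
    if "k < 2" "m < 3" for k m
    using e(2) rotations_D3[OF that(2)] that(1) unfolding d two inv_rotation[symmetric] by blast
  have q: "Re (q 1) = -1/2" "Re (q 2) = -1/2" "Im (q 2) = - Im (q 1)" by (auto simp: q_simps)
  note r = rel[unfolded irrep_2, of 0 1] rel[unfolded irrep_2, of 0 2] rel[unfolded irrep_2, of 1 1] rel[unfolded irrep_2, of 1 2]
  have e0: "AE x in \<mu>. e 0 x + e 0 (q 1 * x) + e 0 (q 2 * x) = 0"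
    using r(1,2) unfolding plane_matrix_rotation q1_facts(7) q2_facts(3) q by auto
  have e1: "AE x in \<mu>. e 1 x + e 1 (q 1 * x) + e 1 (q 2 * x) = 0"
    using r(3,4) unfolding plane_matrix_rotation q1_facts(7) q2_facts(3) q by auto
  show ?thesis
    unfolding satisfies_def using c AE_rotation(1)[OF c] AE_rotation(2)[OF c] e0 e1
  proof eventually_elim
    case (elim x)
    have "1 * f x + 1 * f (q 1 * x) + 1 * f (q 2 * x)
      = c 0 * (e 0 x + e 0 (q 1 * x) + e 0 (q 2 * x)) + c 1 * (e 1 x + e 1 (q 1 * x) + e 1 (q 2 * x))"
      unfolding elim(1-3) by (simp add: algebra_simps)
    then show ?case unfolding elim(4,5) by simp
  qed
qed

lemma rotation_symmetries:
  "gasket_symmetry (\<lambda>x. q 1 * x) (\<lambda>i. (i + 1) mod 3)" "gasket_symmetry cnj swap12"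
  "gasket_symmetry (\<lambda>x. q 2 * x) (\<lambda>i. (i + 2) mod 3)"
proof -
  show "gasket_symmetry (\<lambda>x. q 1 * x) (\<lambda>i. (i + 1) mod 3)" by (rule rotation.gasket_symmetry_axioms)
  show "gasket_symmetry cnj swap12" by (rule reflection.gasket_symmetry_axioms)
  show "gasket_symmetry (\<lambda>x. q 2 * x) (\<lambda>i. (i + 2) mod 3)"
  proof
    show "bij_betw (\<lambda>i. (i + 2) mod 3) {..<3} {..<3::nat}"
      by (auto simp: bij_betw_def inj_on_def lessThan_3)
    show vertex: "q 2 * q i = q ((i + 2) mod 3)" if "i < 3" for i
      using that by (elim less_3_cases) (use q2_facts in \<open>auto simp: numeral_2_eq_2\<close>)
    show "q 2 * F i x = F ((i + 2) mod 3) (q 2 * x)" if "i < 3" for i x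
      using vertex[OF that] by (simp add: F_def algebra_simps)
    show "continuous_on UNIV (\<lambda>x. q 2 * x)" by (intro continuous_intros)
    show "inj (\<lambda>x. q 2 * x)" using norm_q[of 2] by (auto simp: inj_def)
  qed
qed

text \<open>The left-hand side is itself continuous on the gasket and zero off it, so vanishing
  almost everywhere means vanishing everywhere.\<close>

lemma satisfies_gasket:
  assumes u: "u \<in> gasket_functions" and s: "satisfies a b c g1 g2 u"
    and g: "gasket_symmetry g1 p1" "gasket_symmetry g2 p2"
  shows "a * u x + b * u (g1 x) + c * u (g2 x) = 0"
proof -
  interpret g1: gasket_symmetry g1 p1 by fact
  interpret g2: gasket_symmetry g2 p2 by fact
  let ?w = "cscale a u + cscale b (u \<circ> g1) + cscale c (u \<circ> g2)"
  have "?w \<in> gasket_functions" using u g1.comp_gasket_functions g2.comp_gasket_functions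
    by (intro cfun.subspace_add cfun.subspace_scale gasket_functions_subspace) auto
  moreover have "AE x in \<mu>. ?w x = 0" using s by (simp add: satisfies_def cscale_def)
  ultimately have "?w = 0" by (rule gasket_function_AE_zero)
  then have "?w x = 0" by simp
  then show ?thesis by (simp add: cscale_def)
qed

lemma isotypic_relation:
  assumes u: "u \<in> form_domain bc" "u \<in> isotypic j"
    and V: "\<And>W f. acts_as j W \<Longrightarrow> f \<in> W \<Longrightarrow> satisfies a b c g1 g2 f"
    and g: "gasket_symmetry g1 p1" "gasket_symmetry g2 p2"
  shows "a * u x + b * u (g1 x) + c * u (g2 x) = 0"
proof -
  have "satisfies a b c g1 g2 u"
  proof (rule satisfies_isotypic[OF g _ u(2)])
    fix W f assume W: "acts_as j W" "f \<in> W"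
    then have "f \<in> L2" by (auto simp: acts_as_def)
    then show "f \<in> L2 \<and> satisfies a b c g1 g2 f" using V W by blast
  qed
  then show ?thesis using satisfies_gasket form_domain_gasket u(1) g by blast
qed

lemma isotypic_subset_parity:
  assumes j: "j < 2" and u: "u \<in> form_domain bc" "u \<in> isotypic j"
  shows "u \<in> parity_type bc (if j = 0 then 1 else -1)"
proof -
  define s :: complex where "s = (if j = 0 then 1 else -1)"
  have j2: "j \<noteq> 2" using j by simp
  have ir: "irrep j (\<lambda>x. q 2 * x) 0 0 = 1" "irrep j cnj 0 0 = s"
    using j irrep_1(1)[of 2] irrep_1(2)[of 0] q2_facts(5)
    by (auto simp: s_def irrep_def[of 0] less_2_cases_iff)
  \<comment> \<open>The action is composition with the inverse, so the group element
    \<open>q 2\<close> yields the relation for \<open>q 1\<close>.\<close>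
  have inv2: "inv (\<lambda>x. q 2 * x) = (\<lambda>x. q 1 * x)" unfolding inv_rotation q2_facts(3) ..
  have rot: "satisfies 1 (-1) 0 (\<lambda>x. q 1 * x) (\<lambda>x. q 1 * x) f" if "acts_as j W" "f \<in> W" for W f
  proof -
    have "AE x in \<mu>. f (q 1 * x) = 1 * f x"
      using acts_as_relation_1d[OF that j2 rotations_D3[of 2]] rotation_symmetries(1) unfolding inv2 ir by simp
    then show ?thesis unfolding satisfies_def by eventually_elim simp
  qed
  have ref: "satisfies (- s) 1 0 cnj cnj f" if "acts_as j W" "f \<in> W" for W f
  proof -
    have "AE x in \<mu>. f (cnj x) = s * f x"
      using acts_as_relation_1d[OF that j2 cnj_D3] rotation_symmetries(2) unfolding inv_cnj ir by simp
    then show ?thesis unfolding satisfies_def by eventually_elim simp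
  qed
  have "u (q 1 * x) = 1 * u x" for x
    using isotypic_relation[OF u rot rotation_symmetries(1,1), where x = x] by simp
  moreover have "u (cnj x) = s * u x" for x
    using isotypic_relation[OF u ref rotation_symmetries(2,2), where x = x] by simp
  ultimately show ?thesis using u by (simp add: parity_type_def rot_type_def s_def)
qed

lemma isotypic_subset_standard:
  assumes u: "u \<in> form_domain bc" "u \<in> isotypic 2" shows "u \<in> standard_type bc"
  using isotypic_relation[OF u acts_as_relation_2d rotation_symmetries(1,3)] u(1)
  by (simp add: standard_type_def)

section \<open>Symmetry types inside the isotypic subspaces\<close>

lemma span_isotypic:
  assumes "u \<in> L2" "u \<in> cfun.span (\<Union>{W. acts_as j W})" shows "u \<in> isotypic j"
proof -
  have "L2_norm (u - u) = 0" by (simp add: L2_norm_def)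
  then show ?thesis using assms unfolding isotypic_def
    by (intro CollectI conjI allI impI bexI[of _ u]) simp_all
qed

lemma parity_subset_isotypic:
  assumes j: "j < 2" and u: "u \<in> parity_type bc (if j = 0 then 1 else -1)"
  shows "u \<in> isotypic j"
proof (rule span_isotypic)
  define s :: complex where "s = (if j = 0 then 1 else -1)"
  have ug: "u \<in> gasket_functions" using u form_domain_gasket by (auto simp: parity_type_def rot_type_def)
  then show uL2: "u \<in> L2" using gasket_functions_L2 by blast
  have ur: "u (q 1 * x) = u x" and uc: "u (cnj x) = s * u x" for x
    using u by (auto simp: parity_type_def rot_type_def s_def)
  have ur2: "u (q 2 * x) = u x" for x using ur[of "q 1 * x"] ur[of x] unfolding q_mult by simp
  have urk: "u (q k * x) = u x" "u (cnj (q k) * x) = u x" if "k < 3" for k x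
    using that ur ur2 q1_facts(7) q2_facts(3-5) by (elim less_3_cases; simp)+
  have d: "irrep_dim j = 1" using j by (simp add: irrep_dim_def)
  show "u \<in> cfun.span (\<Union>{W. acts_as j W})"
  \<comment> \<open>The zero function spans no copy, as \<open>acts_as\<close> asks for independence
    modulo null functions.\<close>
  proof (cases "u = 0")
    case True
    then show ?thesis using cfun.span_zero by simp
  next
    case False
    define W where "W = {f \<in> L2. \<exists>c. AE x in \<mu>. f x = (\<Sum>k<irrep_dim j. c k * u x)}"
    have "acts_as j W"
      unfolding acts_as_def
    proof (intro exI[of _ "\<lambda>_. u"] conjI allI impI ballI)
      fix c k assume "AE x in \<mu>. (\<Sum>k<irrep_dim j. c k * u x) = 0" and k: "k < irrep_dim j"
      then have "AE x in \<mu>. cscale (c 0) u x = 0" by (simp add: d cscale_def)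
      then have "cscale (c 0) u = 0"
        by (rule gasket_function_AE_zero[rotated]) (rule cfun.subspace_scale[OF gasket_functions_subspace ug])
      then have "c 0 = 0" using False by (auto simp: cscale_def fun_eq_iff)
      then show "c k = 0" using k d by simp
    next
      fix g k assume g: "g \<in> D3" and k: "k < irrep_dim j"
      have "u (inv g x) = irrep j g 0 0 * u x" for x
        using g
      proof (cases rule: D3_cases)
        case (1 m)
        have "irrep j g 0 0 = 1" using j irrep_1(1)[of m] unfolding 1(2) by (auto simp: irrep_def[of 0] less_2_cases_iff)
        then show ?thesis unfolding 1(2) inv_rotation using urk 1(1) by simp
      next
        case (2 m)
        have "irrep j g 0 0 = s" using j irrep_1(2)[of m] unfolding 2(2) by (auto simp: irrep_def[of 0] less_2_cases_iff s_def)
        then show ?thesis unfolding 2(2) inv_reflection using urk 2(1) uc by simp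
      qed
      then show "AE x in \<mu>. u (inv g x) = (\<Sum>l<irrep_dim j. irrep j g l k * u x)" using k d by simp
    qed (use uL2 in \<open>auto simp: W_def\<close>)
    moreover have "u \<in> W" using uL2 unfolding W_def by (intro CollectI conjI exI[of _ "\<lambda>_. 1"]) (auto simp: d)
    ultimately show ?thesis by (intro cfun.span_base) blast
  qed
qed

text \<open>In complex coordinates the plane representation is the sum of the two nontrivial characters
  of the rotations: v and its reflection span a copy, with real basis v + w and -i(v - w).\<close>

lemma rot_type_span:
  assumes v: "v \<in> rot_type bc (q 1)"
  shows "v \<in> cfun.span (\<Union>{W. acts_as 2 W})" "v \<circ> cnj \<in> cfun.span (\<Union>{W. acts_as 2 W})"
proof -
  define w where "w = v \<circ> cnj"
  have vg: "v \<in> gasket_functions" using v form_domain_gasket by (auto simp: rot_type_def)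
  have wg: "w \<in> gasket_functions" unfolding w_def by (rule reflection.comp_gasket_functions[OF vg])
  have v1: "v (q 1 * x) = q 1 * v x" for x using v by (simp add: rot_type_def)
  have v2: "v (q 2 * x) = q 2 * v x" for x
    using v1[of "q 1 * x"] v1[of x] unfolding q_mult by (simp add: mult.assoc[symmetric] q1_facts(1)[unfolded One_nat_def])
  have vk: "v (q k * x) = q k * v x" if "k < 3" for k x
    using that v1 v2 q2_facts(5) by (elim less_3_cases; simp)
  have vk': "v (cnj (q k) * x) = cnj (q k) * v x" if "k < 3" for k x
  proof -
    have "v x = v (q k * (cnj (q k) * x))" by (simp only: mult.assoc[symmetric] q_cnj_mult mult_1)
    also have "\<dots> = q k * v (cnj (q k) * x)" by (rule vk[OF that])
    finally have "cnj (q k) * v x = (cnj (q k) * q k) * v (cnj (q k) * x)" by simp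
    then show ?thesis by (simp only: q_cnj_mult mult_1)
  qed
  have wk': "w (cnj (q k) * x) = q k * w x" if "k < 3" for k x using vk[OF that, of "cnj x"] by (simp add: w_def)
  have vw: "v (cnj x) = w x" "w (cnj x) = v x" for x by (simp_all add: w_def)
  define e where "e k = (if k = (0::nat) then cscale 1 v + cscale 1 w else cscale (- \<i>) v + cscale \<i> w)" for k
  have e_apply: "e 0 x = v x + w x" "e 1 x = - \<i> * (v x - w x)" for x
    by (simp_all add: e_def cscale_def algebra_simps)
  have eg: "e k \<in> gasket_functions" for k
  proof -
    have "cscale a v + cscale b w \<in> gasket_functions" for a b
      by (intro cfun.subspace_add cfun.subspace_scale gasket_functions_subspace vg wg)
    then show ?thesis unfolding e_def by presburger
  qed
  have d: "irrep_dim 2 = 2" by (simp add: irrep_dim_def)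
  have two: "(\<Sum>k<2. h k) = h 0 + h (1::nat)" for h :: "nat \<Rightarrow> complex" by (simp add: numeral_2_eq_2)
  have L2: "v \<in> L2" "w \<in> L2" "e k \<in> L2" for k using vg wg eg gasket_functions_L2 by auto
  have mem: "v \<in> cfun.span (\<Union>{W. acts_as 2 W}) \<and> w \<in> cfun.span (\<Union>{W. acts_as 2 W})"
  proof (cases "v = 0")
    case True
    then have "w = 0" by (auto simp: w_def fun_eq_iff)
    then show ?thesis using True cfun.span_zero by simp
  next
    case False
    then obtain x0 where x0: "v x0 \<noteq> 0" by (auto simp: fun_eq_iff)
    define W where "W = {f \<in> L2. \<exists>c. AE x in \<mu>. f x = (\<Sum>k<irrep_dim 2. c k * e k x)}"
    have "acts_as 2 W"
      unfolding acts_as_def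
    proof (intro exI[of _ e] conjI allI impI ballI)
      fix c k assume ae: "AE x in \<mu>. (\<Sum>k<irrep_dim 2. c k * e k x) = 0" and k: "k < irrep_dim 2"
      define A where "A = c 0 - \<i> * c (1::nat)"
      define B where "B = c 0 + \<i> * c (1::nat)"
      have eq: "c 0 * e 0 x + c 1 * e 1 x = A * v x + B * w x" for x
        unfolding e_apply A_def B_def by (simp add: algebra_simps)
      have "AE x in \<mu>. (cscale A v + cscale B w) x = 0"
        using ae unfolding d two eq by (simp add: cscale_def)
      then have "cscale A v + cscale B w = 0"
        by (rule gasket_function_AE_zero[rotated])
          (intro cfun.subspace_add cfun.subspace_scale gasket_functions_subspace vg wg)
      then have z: "A * v x + B * w x = 0" for x by (simp add: cscale_def fun_eq_iff)
      \<comment> \<open>At the rotated point \<open>q 2 * x0\<close> the functions \<open>v\<close>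
        and \<open>w\<close> acquire different factors, so subtracting \<open>q 1\<close> times the
        relation at \<open>x0\<close> isolates \<open>A\<close>.\<close>
      have "A * (q 2 * v x0) + B * (q 1 * w x0) = 0"
        using z[of "q 2 * x0"] v2 wk'[of 1 x0] q1_facts(7) by simp
      moreover have "q 1 * (A * v x0 + B * w x0) = 0" using z by simp
      moreover have "(q 2 - q 1) * (A * v x0) = (A * (q 2 * v x0) + B * (q 1 * w x0)) - q 1 * (A * v x0 + B * w x0)"
        by (simp add: algebra_simps)
      ultimately have "(q 2 - q 1) * (A * v x0) = 0" by (simp only: diff_self)
      moreover have "q 2 \<noteq> q 1" using q_eq_iff[of 2 1] by simp
      ultimately have A: "A = 0" using x0 by simp
      then have "B = 0" using z[of "cnj x0"] vw x0 by simp
      then have "c 0 = 0" "c 1 = 0" using A by (auto simp: A_def B_def add_eq_0_iff)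
      then show "c k = 0" using k d by (cases k) (auto simp: less_Suc_eq numeral_2_eq_2)
    next
      fix g k assume g: "g \<in> D3" and k: "k < irrep_dim 2"
      define a b where "a m = complex_of_real (Re (q m))" and "b m = complex_of_real (Im (q m))" for m
      have parts: "q m = a m + \<i> * b m" "cnj (a m) = a m" "cnj (b m) = b m" for m
        by (simp_all add: a_def b_def complex_eq_iff)
      have "e 0 (inv g x) = irrep 2 g 0 0 * e 0 x + irrep 2 g 1 0 * e 1 x \<and>
        e 1 (inv g x) = irrep 2 g 0 1 * e 0 x + irrep 2 g 1 1 * e 1 x" for x
        using g
      proof (cases rule: D3_cases)
        case (1 m)
        have vw: "v (inv g x) = cnj (q m) * v x" "w (inv g x) = q m * w x"
          unfolding 1(2) inv_rotation using vk' wk' 1(1) by auto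
        have "irrep 2 g 0 0 = a m" "irrep 2 g 1 0 = b m" "irrep 2 g 0 1 = - b m" "irrep 2 g 1 1 = a m"
          unfolding irrep_2 1(2) plane_matrix_rotation by (simp_all add: a_def b_def)
        then show ?thesis unfolding e_apply vw parts(1) by (simp add: parts(2,3) algebra_simps)
      next
        case (2 m)
        have 3: "v (inv g x) = q m * w x"
          unfolding 2(2) inv_reflection using vk[OF 2(1)] vw by simp
        have 4: "w (inv g x) = cnj (q m) * v x"
          unfolding 2(2) inv_reflection w_def comp_def using vk'[OF 2(1), of x] by simp
        have "irrep 2 g 0 0 = a m" "irrep 2 g 1 0 = b m" "irrep 2 g 0 1 = b m" "irrep 2 g 1 1 = - a m"
          unfolding irrep_2 2(2) plane_matrix_reflection by (simp_all add: a_def b_def)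
        then show ?thesis unfolding e_apply 3 4 parts(1) by (simp add: parts(2,3) algebra_simps)
      qed
      then show "AE x in \<mu>. e k (inv g x) = (\<Sum>l<irrep_dim 2. irrep 2 g l k * e l x)"
        using k unfolding d two by (cases k) (auto simp: less_Suc_eq numeral_2_eq_2)
    qed (use L2 in \<open>auto simp: W_def\<close>)
    \<comment> \<open>Inverting the change of basis: \<open>v\<close> is half of
      \<open>e 0 + \<i> * e 1\<close> and \<open>w\<close> half of
      \<open>e 0 - \<i> * e 1\<close>.\<close>
    moreover have "v \<in> W"
      unfolding W_def using L2(1)
      by (intro CollectI conjI exI[of _ "\<lambda>k. if k = 0 then 1 / 2 else \<i> / 2"])
        (auto simp: d two e_apply[unfolded One_nat_def] field_simps)
    moreover have "w \<in> W"
      unfolding W_def using L2(2)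
      by (intro CollectI conjI exI[of _ "\<lambda>k. if k = 0 then 1 / 2 else - \<i> / 2"])
        (auto simp: d two e_apply[unfolded One_nat_def] field_simps)
    ultimately show ?thesis by (intro conjI cfun.span_base) blast+
  qed
  then show "v \<in> cfun.span (\<Union>{W. acts_as 2 W})" "v \<circ> cnj \<in> cfun.span (\<Union>{W. acts_as 2 W})"
    by (simp_all add: w_def)
qed

text \<open>The reflection of the part with character \<open>q 2\<close> has character
  \<open>q 1\<close>; so this part is the reflection of a function to which
  \<open>rot_type_span\<close> applies.\<close>

lemma standard_subset_isotypic:
  assumes u: "u \<in> standard_type bc" shows "u \<in> isotypic 2"
proof (rule span_isotypic)
  show "u \<in> L2" using u form_domain_gasket gasket_functions_L2 by (auto simp: standard_type_def)
  obtain u1 u2 where u12: "u1 \<in> rot_type bc (q 1)" "u2 \<in> rot_type bc (q 2)" "u = u1 + u2"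
    using standard_decomposition[OF u] by blast
  have "u2 \<circ> cnj \<in> rot_type bc (q 1)"
  proof -
    have "u2 (cnj (q 1 * x)) = q 1 * u2 (cnj x)" for x
    proof -
      have "u2 (cnj (q 1 * x)) = u2 (q 2 * cnj x)" by (simp only: complex_cnj_mult q1_facts(7))
      also have "\<dots> = u2 (q 1 * (q 1 * cnj x))" by (simp only: q_mult(1))
      also have "\<dots> = q 2 * (q 2 * u2 (cnj x))" using u12(2) by (simp add: rot_type_def)
      also have "\<dots> = q 1 * u2 (cnj x)" by (rule q_mult(4))
      finally show ?thesis .
    qed
    then show ?thesis using u12(2) reflection.comp_form_domain[of u2 bc] by (simp add: rot_type_def)
  qed
  then have "u2 \<circ> cnj \<circ> cnj \<in> cfun.span (\<Union>{W. acts_as 2 W})" by (rule rot_type_span(2))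
  moreover have "u2 \<circ> cnj \<circ> cnj = u2" by (simp add: fun_eq_iff)
  ultimately show "u \<in> cfun.span (\<Union>{W. acts_as 2 W})"
    unfolding u12(3) using rot_type_span(1)[OF u12(1)] by (intro cfun.span_add) auto
qed

section \<open>Counting\<close>

lemma eigenspace_eigs: "eigenspace bc s = eigs (form_domain bc) s"
proof -
  have "(\<lambda>x. of_real s * u x) \<in> L2" if "u \<in> form_domain bc" for u
    using cfun.subspace_scale[OF L2_subspace, of u "of_real s"] that form_domain_gasket gasket_functions_L2
    by (auto simp: cscale_def)
  then show ?thesis
    by (auto simp: eigenspace_def neg_laplacian_def eigs_def inner_\<mu>_def mult.assoc)
qed

text \<open>Testing on the summand is enough: both forms vanish between the summands, so the other
  component of a test function adds nothing to either side of the eigenvalue equation.\<close>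

lemma eigs_summands:
  assumes Q: "hermitian_form D energy" "hermitian_form D inner_\<mu>" and sub: "D1 \<subseteq> D" "D2 \<subseteq> D"
    and orth: "\<And>u v. u \<in> D1 \<Longrightarrow> v \<in> D2 \<Longrightarrow> energy u v = 0 \<and> inner_\<mu> u v = 0"
    and dec: "\<And>u. u \<in> D \<Longrightarrow> \<exists>u1\<in>D1. \<exists>u2\<in>D2. u = u1 + u2"
  shows "eigs D s \<inter> D1 = eigs D1 s" "eigs D s \<inter> D2 = eigs D2 s"
proof -
  interpret E: hermitian_form D energy by fact
  interpret P: hermitian_form D inner_\<mu> by fact
  have orth': "energy v u = 0 \<and> inner_\<mu> v u = 0" if "u \<in> D1" "v \<in> D2" for u v
    using orth[OF that] E.sym[of u v] P.sym[of u v] sub that by auto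
  have "energy u v = of_real s * inner_\<mu> u v"
    if u: "u \<in> D1" "\<forall>v\<in>D1. energy u v = of_real s * inner_\<mu> u v" and v: "v \<in> D" for u v
  proof -
    obtain v1 v2 where v12: "v1 \<in> D1" "v2 \<in> D2" "v = v1 + v2" using dec v by blast
    then have D: "v1 \<in> D" "v2 \<in> D" "u \<in> D" using u(1) sub by auto
    have "energy u v = energy u v1 + energy u v2" "inner_\<mu> u v = inner_\<mu> u v1 + inner_\<mu> u v2"
      unfolding v12(3) using E.add_right[OF D] P.add_right[OF D] by simp_all
    moreover have "energy u v1 = of_real s * inner_\<mu> u v1" using u(2) v12 by blast
    ultimately show ?thesis using orth[OF u(1) v12(2)] by simp
  qed
  then show "eigs D s \<inter> D1 = eigs D1 s" using sub unfolding eigs_def by blast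
  have "energy u v = of_real s * inner_\<mu> u v"
    if u: "u \<in> D2" "\<forall>v\<in>D2. energy u v = of_real s * inner_\<mu> u v" and v: "v \<in> D" for u v
  proof -
    obtain v1 v2 where v12: "v1 \<in> D1" "v2 \<in> D2" "v = v1 + v2" using dec v by blast
    then have D: "v1 \<in> D" "v2 \<in> D" "u \<in> D" using u(1) sub by auto
    have "energy u v = energy u v1 + energy u v2" "inner_\<mu> u v = inner_\<mu> u v1 + inner_\<mu> u v2"
      unfolding v12(3) using E.add_right[OF D] P.add_right[OF D] by simp_all
    moreover have "energy u v2 = of_real s * inner_\<mu> u v2" using u(2) v12 by blast
    ultimately show ?thesis using orth'[OF v12(1) u(1)] by simp
  qed
  then show "eigs D s \<inter> D2 = eigs D2 s" using sub unfolding eigs_def by blast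
qed

lemma eigs_types:
  "eigs (form_domain bc) s \<inter> rot_type bc 1 = eigs (rot_type bc 1) s"
  "eigs (form_domain bc) s \<inter> standard_type bc = eigs (standard_type bc) s"
  "eigs (rot_type bc 1) s \<inter> parity_type bc 1 = eigs (parity_type bc 1) s"
  "eigs (rot_type bc 1) s \<inter> parity_type bc (-1) = eigs (parity_type bc (-1)) s"
proof -
  interpret E: invariant_form bc energy by (rule invariant_energy)
  interpret P: invariant_form bc inner_\<mu> by (rule invariant_inner)
  note dom = eigs_summands[OF E.hermitian_form_axioms P.hermitian_form_axioms rot_type_domain standard_type_domain
      conjI[OF E.invariant_standard_orthogonal P.invariant_standard_orthogonal] invariant_standard_decomposition]
  show "eigs (form_domain bc) s \<inter> rot_type bc 1 = eigs (rot_type bc 1) s" by (rule dom(1))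
  show "eigs (form_domain bc) s \<inter> standard_type bc = eigs (standard_type bc) s" by (rule dom(2))
  note rot = eigs_summands[OF hermitian_form_subset[OF E.hermitian_form_axioms rot_type_subspace rot_type_domain]
      hermitian_form_subset[OF P.hermitian_form_axioms rot_type_subspace rot_type_domain] parity_type_rot parity_type_rot
      conjI[OF E.parity_types_orthogonal P.parity_types_orthogonal] parity_decomposition]
  show "eigs (rot_type bc 1) s \<inter> parity_type bc 1 = eigs (parity_type bc 1) s" by (rule rot(1))
  show "eigs (rot_type bc 1) s \<inter> parity_type bc (-1) = eigs (parity_type bc (-1)) s" by (rule rot(2))
qed

lemma counting_eigencount:
  assumes "\<And>s. eigenspace bc s \<inter> H = eigs D s" shows "counting bc H t = eigencount D t"
  unfolding counting_def eigencount_def assms ..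

lemma counting_L2: "counting bc L2 t = eigencount (form_domain bc) t"
proof (rule counting_eigencount)
  show "eigenspace bc s \<inter> L2 = eigs (form_domain bc) s" for s
    unfolding eigenspace_eigs using form_domain_gasket gasket_functions_L2 by (auto simp: eigs_def)
qed

lemma counting_isotypic_1d:
  assumes "j < 2"
  shows "counting bc (isotypic j) t = eigencount (parity_type bc (if j = 0 then 1 else -1)) t"
proof (rule counting_eigencount)
  fix s
  let ?P = "parity_type bc (if j = 0 then 1 else -1)"
  have "eigenspace bc s \<inter> isotypic j = eigs (form_domain bc) s \<inter> ?P"
    unfolding eigenspace_eigs
    using isotypic_subset_parity[OF assms, of _ bc] parity_subset_isotypic[OF assms, of _ bc] by (auto simp: eigs_def)
  also have "\<dots> = eigs (form_domain bc) s \<inter> rot_type bc 1 \<inter> ?P" using parity_type_rot by blast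
  also have "\<dots> = eigs ?P s" unfolding eigs_types(1) using eigs_types(3,4) by simp
  finally show "eigenspace bc s \<inter> isotypic j = eigs ?P s" .
qed

lemma counting_isotypic_2d: "counting bc (isotypic 2) t = eigencount (standard_type bc) t"
proof (rule counting_eigencount)
  fix s
  have "eigenspace bc s \<inter> isotypic 2 = eigs (form_domain bc) s \<inter> standard_type bc"
    unfolding eigenspace_eigs
    using isotypic_subset_standard[of _ bc] standard_subset_isotypic[of _ bc] by (auto simp: eigs_def)
  then show "eigenspace bc s \<inter> isotypic 2 = eigs (standard_type bc) s" unfolding eigs_types(2) .
qed

text \<open>The counts of the nontrivial rotation characters differ from that of the trivial one by
  at most 1, and its two parities from each other by at most n + 2. For the two-dimensional
  representation only the rotation counts enter.\<close>

lemma counting_error: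
  assumes j: "j \<in> {0, 1, 2}" and n: "0 < n" "25 * t < 5 ^ n"
  shows "\<bar>real (counting bc (isotypic j) t) - (real (irrep_dim j))\<^sup>2 / 6 * real (counting bc L2 t)\<bar> \<le> real n + 3"
proof -
  define N R S P M W1 W2 where "N = real (eigencount (form_domain bc) t)" "R = real (eigencount (rot_type bc 1) t)"
    "S = real (eigencount (standard_type bc) t)" "P = real (eigencount (parity_type bc 1) t)"
    "M = real (eigencount (parity_type bc (-1)) t)" "W1 = real (eigencount (rot_type bc (q 1)) t)"
    "W2 = real (eigencount (rot_type bc (q 2)) t)"
  note defs = this
  have cubes: "1 * 1 * 1 = (1::complex)" "q 1 * q 1 * q 1 = 1" "q 2 * q 2 * q 2 = 1"
    using q1_facts q2_facts by (simp_all add: mult.assoc)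
  have sums: "N = R + S" "R = P + M" "S = W1 + W2"
    unfolding defs by (simp_all add: eigencount_invariant_standard eigencount_parity eigencount_standard)
  have w: "R \<le> W1 + 1" "W1 \<le> R + 1" "R \<le> W2 + 1" "W2 \<le> R + 1"
    unfolding defs
    using eigencount_rot_le[OF cubes(1,2), of bc t] eigencount_rot_le[OF cubes(2,1), of bc t]
      eigencount_rot_le[OF cubes(1,3), of bc t] eigencount_rot_le[OF cubes(3,1), of bc t] by linarith+
  have p: "P \<le> M + (real n + 2)" "M \<le> P + (real n + 2)"
    unfolding defs
    using eigencount_parity_le[OF _ n, of 1 bc] eigencount_parity_le[OF _ n, of "-1" bc] by simp_all
  consider "j = 0" | "j = 1" | "j = 2" using j by blast
  then show ?thesis
  proof cases
    case 1
    have "\<bar>P - 1 / 6 * N\<bar> \<le> real n + 3" using sums w p by linarith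
    then show ?thesis using 1 counting_isotypic_1d[of 0 bc t] by (simp add: counting_L2 irrep_dim_def defs)
  next
    case 2
    have "\<bar>M - 1 / 6 * N\<bar> \<le> real n + 3" using sums w p by linarith
    then show ?thesis using 2 counting_isotypic_1d[of 1 bc t] by (simp add: counting_L2 irrep_dim_def defs)
  next
    case 3
    have "\<bar>S - 4 / 6 * N\<bar> \<le> real n + 3" using sums w by linarith
    then show ?thesis using 3 counting_isotypic_2d[of bc t] by (simp add: counting_L2 irrep_dim_def defs)
  qed
qed

lemma exp_le_power_5: "exp (real n) \<le> 5 ^ n"
proof -
  have "exp (real n) = exp 1 ^ n" by (simp add: exp_of_nat_mult[symmetric])
  also have "\<dots> \<le> 5 ^ n" using exp_le by (intro power_mono) auto
  finally show ?thesis .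
qed

theorem mainTheorem2:
  fixes bc :: boundary_condition and j :: nat
  assumes "j \<in> {0, 1, 2}"
  shows "(\<lambda>t. real (counting bc (isotypic j) t)
            - (real (irrep_dim j))\<^sup>2 / 6 * real (counting bc L2 t)) \<in> O[at_top](\<lambda>t. ln t)"
proof (rule bigoI)
  \<comment> \<open>The constant 30: n + 3 \<le> ln (25 t) + 5 \<le> ln t + 29, using ln 25 \<le>
    24, and ln t is at least 1 here.\<close>
  have "norm (real (counting bc (isotypic j) t) - (real (irrep_dim j))\<^sup>2 / 6 * real (counting bc L2 t))
      \<le> 30 * norm (ln t)" if t: "exp 1 \<le> t" for t :: real
  proof -
    have t0: "0 < t" using t exp_gt_zero[of "1::real"] by linarith
    have ln1: "1 \<le> ln t" using t t0 by (simp add: ln_ge_iff)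
    have ln25: "ln (25 * t) \<le> 24 + ln t" "0 < ln (25 * t)"
    proof -
      have "0 < ln (25 :: real)" "ln (25 :: real) \<le> 24" using ln_le_minus_one[of 25] by simp_all
      moreover have "ln (25 * t) = ln 25 + ln t" using t0 by (simp add: ln_mult)
      ultimately show "ln (25 * t) \<le> 24 + ln t" "0 < ln (25 * t)" using ln1 by linarith+
    qed
    \<comment> \<open>Since e \<le> 5, the natural logarithm suffices: 25 t < e ^ n \<le> 5 ^ n. The
      summand 1 makes the inequality strict.\<close>
    define n where "n = nat \<lceil>ln (25 * t)\<rceil> + 1"
    have n: "ln (25 * t) < real n" "real n \<le> ln (25 * t) + 2" using ln25(2) by (auto simp: n_def) linarith+
    have "25 * t = exp (ln (25 * t))" using t0 by simp
    also have "\<dots> < exp (real n)" using n(1) by simp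
    also have "\<dots> \<le> 5 ^ n" by (rule exp_le_power_5)
    finally have "25 * t < 5 ^ n" .
    then have "\<bar>real (counting bc (isotypic j) t) - (real (irrep_dim j))\<^sup>2 / 6 * real (counting bc L2 t)\<bar> \<le> real n + 3"
      by (intro counting_error assms) (auto simp: n_def)
    also have "\<dots> \<le> 30 * ln t" using n(2) ln25(1) ln1 by linarith
    finally show ?thesis using ln1 by simp
  qed
  then show "\<forall>\<^sub>F t in at_top. norm (real (counting bc (isotypic j) t) - (real (irrep_dim j))\<^sup>2 / 6 * real (counting bc L2 t))
      \<le> 30 * norm (ln t)"
    by (intro eventually_at_top_linorderI[of "exp 1"])
qed

end
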